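(* Consider any weak SIRSN and let $0<\lambda<\infty$. Then $p(\lambda,r)\to0$ as $r\to\infty$. In particular, $\mathcal S(\lambda)$ has almost surely no doubly infinite geodesics.
   Context: $\mathbf 0$ is the origin of $\mathbb{R}^2$, $\mathbf 1=(1,0)$, $\mathrm{disc}(z,r)$ is the closed disc, $\mathrm{len}$ is length, $\sigma_c(z)=cz$. A (feasible) route $\mathsf r(z,z')$ is a non-self-intersecting path from $z$ to $z'$ made of straight line segments between successive points $(z_i)$, with finite, semi-infinite or doubly infinite index set (with $z_i\to z$ as $i\to-\infty$, $z_i\to z'$ as $i\to\infty$ in the infinite directions), of finite total length; $\mathsf r(z',z)$ is the reversal of $\mathsf r(z,z')$. Routes are pairwise compatible if whenever two routes meet at two points they coincide on the subroute between these points. A feasible subnetwork on a locally finite configuration $(z_i)$ is the union $\mathsf s$ of pairwise compatible routes $\mathsf r(z_i,z_j)$, one for each pair (with marks recording which edges are in which routes), with $\mathrm{len}(\mathsf s\cap \mathrm{disc}(\mathbf 0,r))<\infty$ for all $r<\infty$. A process of random routes $\mathcal R(z_1,z_2)$, $z_1,z_2\in\mathbb R^2$, is specified by its finite-dimensional distributions: for each finite set $z_1,\dots,z_k$, the distribution $\mu_{z_1,\dots,z_k}$ of the random feasible subnetwork $\mathrm{span}(z_1,\dots,z_k)$ formed by the routes $\mathcal R(z_i,z_j)$. These are required to be consistent, invariant under translation and rotation, invariant under scaling (the image of $\mathrm{span}(z_1,\dots,z_k)$ under $\sigma_c$ is distributed as $\mathrm{span}(cz_1,\dots,cz_k)$,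 for all $c>0$), and with $(z_1,\dots,z_k)\mapsto\mu_{z_1,\dots,z_k}$ measurable. Let $(\Xi(\lambda),0<\lambda<\infty)$ be the positions of the points arriving during time $[0,\lambda]$ in a rate-one space-time Poisson point process on $\mathbb R^2\times[0,\infty)$, independent of the routes, and let $\mathcal S(\lambda)$ be the subnetwork on $\Xi(\lambda)$ consisting of the routes $\mathcal R(\xi,\xi')$, $\xi,\xi'\in\Xi(\lambda)$. The edge-intensity of a translation-invariant random edge process $\mathcal E$ is the $\iota\in[0,\infty]$ with $\mathbb E\,\mathrm{len}(\mathcal E\cap A)=\iota\cdot\mathrm{area}(A)$. Put $D_1=\mathrm{len}\,\mathcal R(\mathbf 0,\mathbf 1)$ and $\ell=$ edge-intensity of $\mathcal S(1)$. The process is a weak SIRSN if its finite-dimensional distributions are distributions of random feasible subnetworks which are consistent, invariant under translation, rotation and scaling, and depend measurably on $(z_1,\dots,z_k)$, and moreover $1<\mathbb E D_1<\infty$ and $\ell<\infty$. Define $\mathcal E(\lambda,r)=\bigcup_{\xi,\xi'\in\Xi(\lambda)}\mathcal R(\xi,\xi')\setminus(\mathrm{disc}(\xi,r)\cup\mathrm{disc}(\xi',r))$, and let $p(\lambda,r)$ be its edge-intensity. A doubly infinite geodesic in $\mathcal S(\lambda)$ is a path $\pi$ which is an increasing union of segments $\pi_k$, where each $\pi_k$ is a segment of some route $\mathcal R(\xi_k,\xi'_k)$ between two points of $\Xi(\lambda)$, and both endpoints of $\pi_k$ go to infinity as $k\to\infty$. *)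

theory Defs
  imports "HOL-Probability.Probability"
begin

text \<open>
  The plane is the type \<^typ>\<open>complex\<close>: the points \<open>(0,0)\<close> and \<open>(1,0)\<close> are \<^term>\<open>0::complex\<close> and
  \<^term>\<open>1::complex\<close>, rotations about the origin are multiplications by \<^term>\<open>cis \<theta>\<close>, and area is
  \<^term>\<open>lborel :: complex measure\<close>.
\<close>

section \<open>Length\<close>

text \<open>
  Length is one-dimensional Hausdorff measure, so that length shared by several routes is counted
  once. Covers consist of bounded sets because \<^const>\<open>diameter\<close> is meaningless on unbounded ones.
\<close>

definition len_approx :: "real \<Rightarrow> 'a::metric_space set \<Rightarrow> ennreal" where
  "len_approx \<delta> A =
     (INF C \<in> {C :: nat \<Rightarrow> 'a set. A \<subseteq> (\<Union>n. C n) \<and> (\<forall>n. bounded (C n) \<and> diameter (C n) \<le> \<delta>)}.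
        \<Sum>n. ennreal (diameter (C n)))"

definition len :: "'a::metric_space set \<Rightarrow> ennreal" where
  "len A = (SUP \<delta>\<in>{0<..}. len_approx \<delta> A)"

section \<open>Routes and feasible subnetworks\<close>

text \<open>
  A route does not intersect itself, so it is determined by its endpoints \<open>z\<close>, \<open>z'\<close> and the set \<open>A\<close>
  of points it visits, and its reversal has the same set. The vertices are \<open>v i\<close> for \<open>i\<close> in an interval
  \<open>I\<close> of integers, which may be finite or infinite in either direction. In a direction in which \<open>I\<close> is
  infinite the endpoint is only a limit of vertices, and must be kept off the edges explicitly.
\<close>

definition route :: "complex \<Rightarrow> complex \<Rightarrow> complex set \<Rightarrow> bool" where
  "route z z' A \<longleftrightarrow> z \<noteq> z' \<and>
    (\<exists>(I::int set) (v::int \<Rightarrow> complex).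
      let E = {i. i \<in> I \<and> i + 1 \<in> I};
          edge = (\<lambda>i. closed_segment (v i) (v (i + 1)))
      in (\<forall>i\<in>I. \<forall>j\<in>I. {i..j} \<subseteq> I) \<and>
         ((\<exists>a\<in>I. I \<subseteq> {a..} \<and> v a = z) \<or>
          (\<forall>a. \<exists>i\<in>I. i < a) \<and> (v \<longlongrightarrow> z) at_bot \<and> (\<forall>i\<in>E. z \<notin> edge i)) \<and>
         ((\<exists>b\<in>I. I \<subseteq> {..b} \<and> v b = z') \<or>
          (\<forall>b. \<exists>i\<in>I. b < i) \<and> (v \<longlongrightarrow> z') at_top \<and> (\<forall>i\<in>E. z' \<notin> edge i)) \<and>
         (\<forall>i\<in>E. v i \<noteq> v (i + 1)) \<and>
         (\<forall>i\<in>E. \<forall>j\<in>E. i < j \<longrightarrow> edge i \<inter> edge j = (if j = i + 1 then {v j} else {})) \<and>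
         (\<lambda>i. dist (v i) (v (i + 1))) summable_on E \<and>
         A = {z, z'} \<union> (\<Union>i\<in>E. edge i))"

text \<open>
  The part of an arc between two of its points is the least connected subset containing both; see
  the lemma \<open>subroute_arc\<close>.
\<close>

definition subroute :: "complex set \<Rightarrow> complex \<Rightarrow> complex \<Rightarrow> complex set" where
  "subroute A p q = \<Inter>{C. C \<subseteq> A \<and> connected C \<and> p \<in> C \<and> q \<in> C}"

lemma subroute_arc:
  assumes "arc g" and st: "0 \<le> s" "s \<le> t" "t \<le> 1"
  shows "subroute (path_image g) (g s) (g t) = g ` {s..t}"
proof
  have cont: "continuous_on {0..1} g" and inj: "inj_on g {0..1}"
    using assms(1) by (auto simp: arc_def path_def)
  have "connected (g ` {s..t})"
    using st by (intro connected_continuous_image continuous_on_subset[OF cont]) auto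
  then show "subroute (path_image g) (g s) (g t) \<subseteq> g ` {s..t}"
    unfolding subroute_def path_image_def using st by (intro Inter_lower) auto
  show "g ` {s..t} \<subseteq> subroute (path_image g) (g s) (g t)"
    unfolding subroute_def
  proof (rule Inter_greatest)
    fix C assume "C \<in> {C. C \<subseteq> path_image g \<and> connected C \<and> g s \<in> C \<and> g t \<in> C}"
    then have C: "C \<subseteq> g ` {0..1}" "connected C" "g s \<in> C" "g t \<in> C"
      by (auto simp: path_image_def)
    let ?h = "inv_into {0..1} g"
    have "continuous_on (g ` {0..1}) ?h"
      by (rule continuous_on_inv[OF cont]) (auto simp: inj)
    then have "connected (?h ` C)"
      using C by (intro connected_continuous_image) (auto intro: continuous_on_subset)
    moreover have "s \<in> ?h ` C" "t \<in> ?h ` C"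
      using C st inj by (force simp: image_iff)+
    ultimately have "{s..t} \<subseteq> ?h ` C"
      by (rule connected_contains_Icc)
    then show "g ` {s..t} \<subseteq> C"
      using C(1) by (fastforce simp: f_inv_into_f)
  qed
qed

definition compatible :: "complex set \<Rightarrow> complex set \<Rightarrow> bool" where
  "compatible A B \<longleftrightarrow>
     (\<forall>p\<in>A \<inter> B. \<forall>q\<in>A \<inter> B. p \<noteq> q \<longrightarrow> subroute A p q = subroute B p q)"

text \<open>
  A subnetwork on points \<open>z i\<close> (\<open>i \<in> I\<close>) is recorded as the family of its routes, \<open>\<rho> (i, j)\<close> being
  the route from \<open>z i\<close> to \<open>z j\<close>; this carries the marks saying which edges are in which routes.
\<close>

definition offdiag :: "'i set \<Rightarrow> ('i \<times> 'i) set" where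
  "offdiag I = {(i, j). i \<in> I \<and> j \<in> I \<and> i \<noteq> j}"

definition compatible_routes ::
    "'i set \<Rightarrow> ('i \<Rightarrow> complex) \<Rightarrow> ('i \<times> 'i \<Rightarrow> complex set) \<Rightarrow> bool" where
  "compatible_routes I z \<rho> \<longleftrightarrow>
     (\<forall>(i, j)\<in>offdiag I. route (z i) (z j) (\<rho> (i, j)) \<and> \<rho> (j, i) = \<rho> (i, j)) \<and>
     (\<forall>p\<in>offdiag I. \<forall>q\<in>offdiag I. compatible (\<rho> p) (\<rho> q))"

definition feasible_subnetwork ::
    "'i set \<Rightarrow> ('i \<Rightarrow> complex) \<Rightarrow> ('i \<times> 'i \<Rightarrow> complex set) \<Rightarrow> bool" where
  "feasible_subnetwork I z \<rho> \<longleftrightarrow>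
     compatible_routes I z \<rho> \<and>
     (\<forall>r::real. len ((\<Union>p\<in>offdiag I. \<rho> p) \<inter> cball 0 r) < \<infinity>)"

section \<open>Random routes\<close>

text \<open>Routes are random compact sets: the Effros Borel structure on the compact sets.\<close>

definition route_space :: "complex set measure" where
  "route_space = sigma {A. compact A} {{A. compact A \<and> A \<inter> U \<noteq> {}} | U. open U}"

abbreviation span_space :: "nat \<Rightarrow> (nat \<times> nat \<Rightarrow> complex set) measure" where
  "span_space k \<equiv> \<Pi>\<^sub>M p\<in>offdiag {..<k}. route_space"

definition map_routes ::
    "(complex \<Rightarrow> complex) \<Rightarrow> nat \<Rightarrow> (nat \<times> nat \<Rightarrow> complex set) \<Rightarrow> nat \<times> nat \<Rightarrow> complex set" where
  "map_routes f k \<rho> = (\<lambda>p\<in>offdiag {..<k}. f ` \<rho> p)"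

text \<open>
  \<open>\<mu> [z\<^sub>0, \<dots>, z\<^sub>k\<^sub>-\<^sub>1]\<close> is the law of the span of distinct points. Reindexing by an arbitrary list of
  distinct indices makes \<open>consistent\<close> cover both passage to subsets and reordering of the points.
\<close>

locale random_routes =
  fixes \<mu> :: "complex list \<Rightarrow> (nat \<times> nat \<Rightarrow> complex set) measure"
  assumes prob_space_fdd: "distinct zs \<Longrightarrow> prob_space (\<mu> zs)"
    and sets_fdd: "distinct zs \<Longrightarrow> sets (\<mu> zs) = sets (span_space (length zs))"
    and feasible:
      "distinct zs \<Longrightarrow> AE \<rho> in \<mu> zs. feasible_subnetwork {..<length zs} (\<lambda>i. zs ! i) \<rho>"
    and consistent:
      "distinct zs \<Longrightarrow> distinct ks \<Longrightarrow> set ks \<subseteq> {..<length zs} \<Longrightarrow>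
        \<mu> (map (\<lambda>k. zs ! k) ks) =
          distr (\<mu> zs) (span_space (length ks))
            (\<lambda>\<rho>. \<lambda>(i, j)\<in>offdiag {..<length ks}. \<rho> (ks ! i, ks ! j))"
    and translation_invariant:
      "distinct zs \<Longrightarrow> \<mu> (map (\<lambda>z. a + z) zs) =
        distr (\<mu> zs) (span_space (length zs)) (map_routes (\<lambda>z. a + z) (length zs))"
    and rotation_invariant:
      "distinct zs \<Longrightarrow> \<mu> (map (\<lambda>z. cis \<theta> * z) zs) =
        distr (\<mu> zs) (span_space (length zs)) (map_routes (\<lambda>z. cis \<theta> * z) (length zs))"
    and scale_invariant:
      "distinct zs \<Longrightarrow> 0 < c \<Longrightarrow> \<mu> (map (\<lambda>z. of_real c * z) zs) =
        distr (\<mu> zs) (span_space (length zs)) (map_routes (\<lambda>z. of_real c * z) (length zs))"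
    and measurable_fdd:
      "(\<lambda>z. \<mu> (map z [0..<k])) \<in>
         restrict_space (\<Pi>\<^sub>M i\<in>{..<k}. borel) {z. inj_on z {..<k}} \<rightarrow>\<^sub>M
         subprob_algebra (span_space k)"

section \<open>Sampling at Poisson points\<close>

text \<open>
  \<open>X\<close> is some measurable enumeration of a rate-one Poisson point process on the plane times
  \<open>[0, \<infinity>)\<close>. Finiteness is stated separately because \<^const>\<open>card\<close> is \<open>0\<close> on infinite sets.
\<close>

definition poisson_points :: "'w measure \<Rightarrow> (nat \<Rightarrow> 'w \<Rightarrow> complex \<times> real) \<Rightarrow> bool" where
  "poisson_points M X \<longleftrightarrow>
     (\<forall>i. X i \<in> borel_measurable M) \<and>
     (\<forall>i. \<forall>\<omega>\<in>space M. 0 \<le> snd (X i \<omega>)) \<and>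
     (let F = {B \<in> sets borel. B \<subseteq> UNIV \<times> {0..} \<and> emeasure lborel B < \<infinity>};
          N = (\<lambda>B \<omega>. card {i. X i \<omega> \<in> B})
      in (\<forall>B\<in>F. (AE \<omega> in M. finite {i. X i \<omega> \<in> B}) \<and>
            (\<forall>n. measure M {\<omega>\<in>space M. N B \<omega> = n} =
                   measure lborel B ^ n / fact n * exp (- measure lborel B))) \<and>
         (\<forall>\<B>\<subseteq>F. finite \<B> \<and> disjoint \<B> \<longrightarrow>
            prob_space.indep_vars M (\<lambda>_. count_space UNIV) N \<B>))"

text \<open>
  \<open>R (i, j) \<omega>\<close> is the route between the positions of \<open>X i \<omega>\<close> and \<open>X j \<omega>\<close>. Independence of the
  routes and the Poisson process means that, conditionally on the whole sequence \<open>X\<close>, the routes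
  between the first \<open>k\<close> points have law \<open>\<mu>\<close> at these points (\<open>conditional_law\<close>); almost surely the
  positions are distinct. A jointly measurable realization of the routes from all points of the plane
  is not required, and need not exist.
\<close>

locale poisson_sampled_routes = random_routes \<mu> + prob_space M
  for \<mu> :: "complex list \<Rightarrow> (nat \<times> nat \<Rightarrow> complex set) measure"
    and M :: "'w measure"
    and X :: "nat \<Rightarrow> 'w \<Rightarrow> complex \<times> real"
    and R :: "nat \<times> nat \<Rightarrow> 'w \<Rightarrow> complex set" +
  assumes poisson: "poisson_points M X"
    and measurable_routes: "p \<in> offdiag UNIV \<Longrightarrow> R p \<in> M \<rightarrow>\<^sub>M route_space"
    and sampled_compatible:
      "AE \<omega> in M. compatible_routes UNIV (\<lambda>i. fst (X i \<omega>)) (\<lambda>p. R p \<omega>)"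
    and conditional_law:
      "A \<in> sets (\<Pi>\<^sub>M i\<in>UNIV. borel) \<Longrightarrow> B \<in> sets (span_space k) \<Longrightarrow>
        emeasure M {\<omega>\<in>space M. (\<lambda>i. X i \<omega>) \<in> A \<and> (\<lambda>p\<in>offdiag {..<k}. R p \<omega>) \<in> B} =
        (\<integral>\<^sup>+\<omega>. indicator A (\<lambda>i. X i \<omega>) * emeasure (\<mu> (map (\<lambda>i. fst (X i \<omega>)) [0..<k])) B \<partial>M)"

definition arrived :: "(nat \<Rightarrow> 'w \<Rightarrow> complex \<times> real) \<Rightarrow> real \<Rightarrow> 'w \<Rightarrow> nat set" where
  "arrived X t \<omega> = {i. snd (X i \<omega>) \<le> t}"

definition network ::
    "(nat \<Rightarrow> 'w \<Rightarrow> complex \<times> real) \<Rightarrow> (nat \<times> nat \<Rightarrow> 'w \<Rightarrow> complex set) \<Rightarrow> real \<Rightarrow>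
     'w \<Rightarrow> complex set" where
  "network X R t \<omega> = (\<Union>p\<in>offdiag (arrived X t \<omega>). R p \<omega>)"

definition far_edges ::
    "(nat \<Rightarrow> 'w \<Rightarrow> complex \<times> real) \<Rightarrow> (nat \<times> nat \<Rightarrow> 'w \<Rightarrow> complex set) \<Rightarrow> real \<Rightarrow> real \<Rightarrow>
     'w \<Rightarrow> complex set" where
  "far_edges X R t r \<omega> =
     (\<Union>(i, j)\<in>offdiag (arrived X t \<omega>).
        R (i, j) \<omega> - (cball (fst (X i \<omega>)) r \<union> cball (fst (X j \<omega>)) r))"

definition has_edge_intensity :: "'w measure \<Rightarrow> ('w \<Rightarrow> complex set) \<Rightarrow> ennreal \<Rightarrow> bool" where
  "has_edge_intensity M \<E> \<iota> \<longleftrightarrow>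
     (\<forall>A\<in>sets borel. (\<integral>\<^sup>+\<omega>. len (\<E> \<omega> \<inter> A) \<partial>M) = \<iota> * emeasure lborel A)"

definition doubly_infinite_geodesic ::
    "(nat \<Rightarrow> 'w \<Rightarrow> complex \<times> real) \<Rightarrow> (nat \<times> nat \<Rightarrow> 'w \<Rightarrow> complex set) \<Rightarrow> real \<Rightarrow>
     'w \<Rightarrow> complex set \<Rightarrow> bool" where
  "doubly_infinite_geodesic X R t \<omega> \<pi> \<longleftrightarrow>
     (\<exists>(p :: nat \<Rightarrow> nat \<times> nat) a b.
        (\<forall>k. p k \<in> offdiag (arrived X t \<omega>) \<and> a k \<in> R (p k) \<omega> \<and> b k \<in> R (p k) \<omega>) \<and>
        incseq (\<lambda>k. subroute (R (p k) \<omega>) (a k) (b k)) \<and>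
        \<pi> = (\<Union>k. subroute (R (p k) \<omega>) (a k) (b k)) \<and>
        filterlim a at_infinity sequentially \<and> filterlim b at_infinity sequentially)"

section \<open>Weak SIRSNs\<close>

text \<open>
  The law of the unlabelled sampled network is determined by \<open>\<mu>\<close>, so finiteness of the edge-intensity
  of the network at time \<open>1\<close> is a property of \<open>\<mu>\<close>, whichever realization \<open>M\<close>, \<open>X\<close>, \<open>R\<close> is used.
\<close>

locale weak_SIRSN = poisson_sampled_routes +
  assumes mean_route_length:
      "1 < (\<integral>\<^sup>+\<rho>. len (\<rho> (0, 1)) \<partial>\<mu> [0, 1])" "(\<integral>\<^sup>+\<rho>. len (\<rho> (0, 1)) \<partial>\<mu> [0, 1]) < \<infinity>"
    and finite_edge_intensity: "\<exists>l<\<infinity>. has_edge_intensity M (network X R 1) l"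

end

theory Submission
  imports Defs
begin

text \<open>
  The argument compares scaling with thinning. Let \<open>q r\<close> be the edge-intensity of \<open>far_edges\<close> at time
  \<open>1\<close>. It is at most the intensity of the whole network, hence finite, and it decreases in \<open>r\<close>; let
  \<open>\<kappa>\<close> be its limit, which is the intensity of the set of points that lie on routes with both
  endpoints arbitrarily far away.

  Scaling: the network at time \<open>t\<close> is a copy of the network at time \<open>1\<close>, contracted by \<open>sqrt t\<close>, so the
  intensity at time \<open>t\<close> is \<open>sqrt t * q (sqrt t * r)\<close>, with limit \<open>sqrt t * \<kappa>\<close> (\<open>plane_mean_scaled\<close>).

  Thinning: a point \<open>x\<close> that lies on routes with arbitrarily distant endpoints lies on routes between
  \<open>m\<close> disjoint pairs of points, for every \<open>m\<close> (\<open>many_far_of_all_far\<close>). Given the positions and the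
  routes, each of the points present at time \<open>1\<close> has arrived by time \<open>1/4\<close> with probability \<open>1/4\<close>,
  independently, so some pair has arrived by time \<open>1/4\<close> with probability at least
  \<open>1 - (15/16) ^ m\<close> (\<open>sum_thin_weight_containing\<close>). Letting \<open>m\<close> tend to infinity, \<open>\<kappa>\<close> is at most
  its value \<open>\<kappa> / 2\<close> at time \<open>1/4\<close>, so \<open>\<kappa> = 0\<close> (\<open>INF_intensity\<close>).

  Both steps rest on the formula \<open>window_mean\<close>, which expresses mean lengths in terms of \<open>\<mu>\<close> alone: the
  points in a bounded window are, given their number, independent and uniform (\<open>janossy\<close>), whatever
  the order in which they are enumerated, and the routes between them have law \<open>\<mu>\<close>
  (\<open>nn_integral_route_tuple\<close>). It also shows that the mean length is translation invariant, hence a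
  multiple of area.

  Finally, a point of a doubly infinite geodesic lies on routes with both endpoints arbitrarily far
  away (\<open>geodesic_far\<close>). The set of these points has length \<open>0\<close> almost surely because \<open>\<kappa> = 0\<close>, whereas a
  geodesic contains a nondegenerate connected set.
\<close>

section \<open>One-dimensional Hausdorff measure\<close>

lemma diameter_leI:
  fixes S :: "'a::metric_space set"
  assumes "0 \<le> d" and "\<And>x y. x \<in> S \<Longrightarrow> y \<in> S \<Longrightarrow> dist x y \<le> d"
  shows "diameter S \<le> d"
  using assms by (auto simp: diameter_def intro!: cSUP_least)

lemma len_approx_le:
  assumes "A \<subseteq> (\<Union>n. C n)" "\<And>n. bounded (C n)" "\<And>n. diameter (C n) \<le> \<delta>"
  shows "len_approx \<delta> A \<le> (\<Sum>n. ennreal (diameter (C n)))"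
  unfolding len_approx_def using assms by (intro INF_lower) auto

lemma len_approx_mono: "A \<subseteq> B \<Longrightarrow> len_approx \<delta> A \<le> len_approx \<delta> B"
  unfolding len_approx_def by (intro INF_superset_mono) auto

lemma len_approx_antimono: "\<delta> \<le> \<delta>' \<Longrightarrow> len_approx \<delta>' A \<le> len_approx \<delta> A"
  unfolding len_approx_def by (intro INF_superset_mono) (auto intro: order_trans)

lemma len_approx_le_len: "0 < \<delta> \<Longrightarrow> len_approx \<delta> A \<le> len A"
  unfolding len_def by (intro SUP_upper) auto

lemma len_mono: "A \<subseteq> B \<Longrightarrow> len A \<le> len B"
  unfolding len_def by (intro SUP_mono') (auto intro: len_approx_mono)

lemma len_empty [simp]: "len {} = 0"
proof -
  have "len_approx \<delta> ({} :: 'a set) \<le> 0" if "\<delta> > 0" for \<delta>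
    using len_approx_le[of "{}" "\<lambda>_. {}" \<delta>] that by simp
  then show ?thesis
    unfolding len_def by (intro antisym SUP_least) auto
qed

lemma len_approx_cover:
  assumes "len_approx \<delta> A < c"
  obtains C where "A \<subseteq> (\<Union>n. C n)" "\<And>n. bounded (C n)" "\<And>n. diameter (C n) \<le> \<delta>"
    "(\<Sum>n. ennreal (diameter (C n))) < c"
  using assms unfolding len_approx_def by (auto simp: INF_less_iff)

lemma len_approx_UN_le: "len_approx \<delta> (\<Union>i::nat. A i) \<le> (\<Sum>i. len_approx \<delta> (A i))"
proof (rule ennreal_le_epsilon)
  fix e :: real assume fin: "(\<Sum>i. len_approx \<delta> (A i)) < top" and e: "0 < e"
  have "\<exists>C. A i \<subseteq> (\<Union>n. C n) \<and> (\<forall>n. bounded (C n)) \<and> (\<forall>n. diameter (C n) \<le> \<delta>) \<and>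
     (\<Sum>n. ennreal (diameter (C n))) \<le> len_approx \<delta> (A i) + ennreal (e * (1/2) ^ Suc i)" for i
  proof -
    have "len_approx \<delta> (A i) < top"
      using fin ennreal_suminf_lessD by blast
    then have "len_approx \<delta> (A i) < len_approx \<delta> (A i) + ennreal (e * (1/2) ^ Suc i)"
      using e ennreal_add_left_cancel_less[of "len_approx \<delta> (A i)" 0 "ennreal (e * (1/2) ^ Suc i)"]
      by (simp add: less_top del: power_Suc)
    then show ?thesis
      by (rule len_approx_cover) (auto intro: less_imp_le)
  qed
  then obtain C where C: "\<And>i. A i \<subseteq> (\<Union>n. C i n)" "\<And>i n. bounded (C i n)"
      "\<And>i n. diameter (C i n) \<le> \<delta>"
      "\<And>i. (\<Sum>n. ennreal (diameter (C i n))) \<le> len_approx \<delta> (A i) + ennreal (e * (1/2) ^ Suc i)"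
    by metis
  let ?D = "\<lambda>m. case prod_decode m of (i, n) \<Rightarrow> C i n"
  have "len_approx \<delta> (\<Union>i. A i) \<le> (\<Sum>m. ennreal (diameter (?D m)))"
  proof (rule len_approx_le)
    show "(\<Union>i. A i) \<subseteq> (\<Union>m. ?D m)"
    proof (rule subsetI)
      fix x assume "x \<in> (\<Union>i. A i)"
      then obtain i n where "x \<in> C i n" using C(1) by blast
      then have "x \<in> ?D (prod_encode (i, n))" by simp
      then show "x \<in> (\<Union>m. ?D m)" by (rule UN_I[OF UNIV_I])
    qed
  qed (auto simp: C split: prod.split)
  also have "\<dots> = (\<Sum>m. (\<lambda>(i, n). ennreal (diameter (C i n))) (prod_decode m))"
    by (simp add: case_prod_beta)
  also have "\<dots> = (\<Sum>i. \<Sum>n. ennreal (diameter (C i n)))"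
    by (intro suminf_ennreal_2dimen) simp
  also have "\<dots> \<le> (\<Sum>i. len_approx \<delta> (A i) + ennreal (e * (1/2) ^ Suc i))"
    using C(4) by (intro suminf_le) auto
  also have "\<dots> = (\<Sum>i. len_approx \<delta> (A i)) + (\<Sum>i. ennreal (e * (1/2) ^ Suc i))"
    by (intro suminf_add[symmetric]) auto
  also have "(\<Sum>i. ennreal (e * (1/2) ^ Suc i)) = ennreal e"
    using e power_half_series sums_mult[OF power_half_series, of e]
    by (intro suminf_ennreal_eq) auto
  finally show "len_approx \<delta> (\<Union>i. A i) \<le> (\<Sum>i. len_approx \<delta> (A i)) + ennreal e" .
qed

lemma len_UN_le: "len (\<Union>i::nat. A i) \<le> (\<Sum>i. len (A i))"
  unfolding len_def[of "\<Union>i. A i"]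
proof (intro SUP_least)
  fix \<delta> :: real assume \<delta>: "\<delta> \<in> {0<..}"
  have "len_approx \<delta> (\<Union>i. A i) \<le> (\<Sum>i. len_approx \<delta> (A i))"
    by (rule len_approx_UN_le)
  also have "\<dots> \<le> (\<Sum>i. len (A i))"
    using \<delta> by (intro suminf_le) (auto intro: len_approx_le_len)
  finally show "len_approx \<delta> (\<Union>i. A i) \<le> (\<Sum>i. len (A i))" .
qed

lemma len_Un_le: "len (A \<union> B) \<le> len A + len B"
proof -
  have "len (\<Union>i::nat. (if i = 0 then A else if i = 1 then B else {})) \<le>
     (\<Sum>i. len (if i = 0 then A else if i = 1 then B else {}))"
    by (rule len_UN_le)
  also have "\<dots> = (\<Sum>i\<in>{0,1::nat}. len (if i = 0 then A else if i = 1 then B else {}))"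
    by (intro suminf_finite) auto
  also have "\<dots> = len A + len B" by simp
  also have "(\<Union>i::nat. (if i = 0 then A else if i = 1 then B else {})) = A \<union> B"
    by (auto split: if_splits)
  finally show ?thesis .
qed

text \<open>
  A set of diameter at most \<open>\<delta>\<close> cannot meet both of two sets at distance more than \<open>\<delta>\<close>, so a cover of
  their union splits into covers of each.
\<close>

lemma len_approx_Un_separated:
  assumes sep: "\<And>a b. a \<in> A \<Longrightarrow> b \<in> B \<Longrightarrow> \<delta> < dist a b" and "0 \<le> \<delta>"
  shows "len_approx \<delta> A + len_approx \<delta> B \<le> len_approx \<delta> (A \<union> B)"
  unfolding len_approx_def[of \<delta> "A \<union> B"]
proof (intro INF_greatest)
  fix C :: "nat \<Rightarrow> 'a set"
  assume "C \<in> {C. A \<union> B \<subseteq> (\<Union>n. C n) \<and> (\<forall>n. bounded (C n) \<and> diameter (C n) \<le> \<delta>)}"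
  then have C: "A \<union> B \<subseteq> (\<Union>n. C n)" "\<And>n. bounded (C n)" "\<And>n. diameter (C n) \<le> \<delta>" by auto
  let ?CA = "\<lambda>n. if C n \<inter> A = {} then {} else C n" and ?CB = "\<lambda>n. if C n \<inter> B = {} then {} else C n"
  have "len_approx \<delta> A \<le> (\<Sum>n. ennreal (diameter (?CA n)))"
    using C \<open>0 \<le> \<delta>\<close> by (intro len_approx_le) (auto, blast)
  moreover have "len_approx \<delta> B \<le> (\<Sum>n. ennreal (diameter (?CB n)))"
    using C \<open>0 \<le> \<delta>\<close> by (intro len_approx_le) (auto, blast)
  ultimately have "len_approx \<delta> A + len_approx \<delta> B \<le>
      (\<Sum>n. ennreal (diameter (?CA n))) + (\<Sum>n. ennreal (diameter (?CB n)))"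
    by (rule add_mono)
  also have "\<dots> = (\<Sum>n. ennreal (diameter (?CA n)) + ennreal (diameter (?CB n)))"
    by (intro suminf_add) auto
  also have "\<dots> \<le> (\<Sum>n. ennreal (diameter (C n)))"
  proof (intro suminf_le)
    fix n
    have "C n \<inter> A = {} \<or> C n \<inter> B = {}"
    proof (rule ccontr)
      assume "\<not> ?thesis"
      then obtain a b where "a \<in> C n" "a \<in> A" "b \<in> C n" "b \<in> B" by blast
      then show False
        using sep[of a b] diameter_bounded_bound[OF C(2), of a n b] C(3)[of n] by auto
    qed
    then show "ennreal (diameter (?CA n)) + ennreal (diameter (?CB n)) \<le> ennreal (diameter (C n))"
      by auto
  qed auto
  finally show "len_approx \<delta> A + len_approx \<delta> B \<le> (\<Sum>n. ennreal (diameter (C n)))" .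
qed

lemma len_Un_separated:
  assumes sep: "\<And>a b. a \<in> A \<Longrightarrow> b \<in> B \<Longrightarrow> \<eta> \<le> dist a b" and "0 < \<eta>"
  shows "len A + len B \<le> len (A \<union> B)"
proof -
  have "len A + len B = (SUP \<delta>\<in>{0<..}. len_approx \<delta> A + len_approx \<delta> B)"
    unfolding len_def
  proof (intro SUP_add_directed_ennreal[symmetric])
    fix i j :: real assume "i \<in> {0<..}" "j \<in> {0<..}"
    then show "\<exists>k\<in>{0<..}. len_approx i A + len_approx j B \<le> len_approx k A + len_approx k B"
      by (intro bexI[of _ "min i j"] add_mono len_approx_antimono) auto
  qed
  also have "\<dots> \<le> len (A \<union> B)"
  proof (intro SUP_least)
    fix \<delta> :: real assume \<delta>: "\<delta> \<in> {0<..}"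
    let ?d = "min \<delta> (\<eta> / 2)"
    have "len_approx \<delta> A + len_approx \<delta> B \<le> len_approx ?d A + len_approx ?d B"
      by (intro add_mono len_approx_antimono) auto
    also have "\<dots> \<le> len_approx ?d (A \<union> B)"
      using \<delta> \<open>0 < \<eta>\<close> by (intro len_approx_Un_separated) (auto dest!: sep)
    also have "\<dots> \<le> len (A \<union> B)"
      using \<delta> \<open>0 < \<eta>\<close> by (intro len_approx_le_len) auto
    finally show "len_approx \<delta> A + len_approx \<delta> B \<le> len (A \<union> B)" .
  qed
  finally show ?thesis .
qed

lemma sum_len_separated:
  assumes "\<And>i j a b. i < j \<Longrightarrow> a \<in> D i \<Longrightarrow> b \<in> D j \<Longrightarrow> \<eta> i \<le> dist a b" and "\<And>i::nat. 0 < \<eta> i"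
  shows "(\<Sum>i<n. len (D i)) \<le> len (\<Union>i<n. D i)"
proof (induction n)
  case (Suc n)
  define e where "e = Min (insert 1 (\<eta> ` {..<n}))"
  have e: "0 < e" "\<And>i. i < n \<Longrightarrow> e \<le> \<eta> i"
    using assms(2) by (auto simp: e_def)
  have "(\<Sum>i<Suc n. len (D i)) \<le> len (\<Union>i<n. D i) + len (D n)"
    using Suc by (auto intro: add_mono)
  also have "\<dots> \<le> len ((\<Union>i<n. D i) \<union> D n)"
  proof (rule len_Un_separated[where \<eta>=e])
    fix a b assume "a \<in> (\<Union>i<n. D i)" "b \<in> D n"
    then obtain i where "i < n" "a \<in> D i" by auto
    then show "e \<le> dist a b" using assms(1)[of i n a b] e(2)[of i] \<open>b \<in> D n\<close> by linarith
  qed (rule e)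
  also have "(\<Union>i<n. D i) \<union> D n = (\<Union>i<Suc n. D i)"
    by (auto simp: less_Suc_eq)
  finally show ?case .
qed simp

text \<open>
  Caratheodory's criterion: a closed set splits every set additively. The set \<open>A - F\<close> is cut into
  layers according to the distance from \<open>F\<close>; layers that are not adjacent are separated, so the
  lengths of the layers are summable and the layers close to \<open>F\<close> can be dropped.
\<close>

lemma len_closed_split:
  fixes F :: "'a::metric_space set"
  assumes "closed F"
  shows "len (A \<inter> F) + len (A - F) \<le> len A"
proof (cases "len A = top \<or> F = {}")
  case False
  then have fin: "len A < top" and ne: "F \<noteq> {}" by (auto simp: less_top)
  define L where "L n = {x\<in>A. 1 / real (Suc n) \<le> infdist x F}" for n
  define D where "D n = L (Suc n) - L n" for n
  have gap: "1 / real (Suc (Suc i)) - 1 / real (Suc j) \<le> dist a b"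
    if "a \<in> D i" "b \<in> D j" for a b i j
  proof -
    have "1 / real (Suc (Suc i)) \<le> infdist a F" "infdist b F < 1 / real (Suc j)"
      using that by (auto simp: D_def L_def)
    moreover have "infdist a F \<le> infdist b F + dist a b"
      by (rule infdist_triangle)
    ultimately show ?thesis by linarith
  qed
  define \<eta> where "\<eta> i = 1 / real (Suc (Suc i)) - 1 / real (Suc (Suc (Suc i)))" for i
  have \<eta>: "0 < \<eta> i" for i
    unfolding \<eta>_def by (simp add: frac_less2)
  have par: "(\<Sum>i<n. len (D (2 * i + c))) \<le> len A" for n c
  proof -
    have "(\<Sum>i<n. len (D (2 * i + c))) \<le> len (\<Union>i<n. D (2 * i + c))"
    proof (rule sum_len_separated[where \<eta>="\<lambda>i. \<eta> (2 * i + c)"])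
      fix i j a b assume ij: "i < (j::nat)" and "a \<in> D (2 * i + c)" "b \<in> D (2 * j + c)"
      then have "1 / real (Suc (Suc (2 * i + c))) - 1 / real (Suc (2 * j + c)) \<le> dist a b"
        by (intro gap)
      moreover have "1 / real (Suc (2 * j + c)) \<le> 1 / real (Suc (Suc (Suc (2 * i + c))))"
        using ij by (intro divide_left_mono) auto
      ultimately show "\<eta> (2 * i + c) \<le> dist a b" unfolding \<eta>_def by linarith
    qed (rule \<eta>)
    also have "\<dots> \<le> len A" by (intro len_mono) (auto simp: D_def L_def)
    finally show ?thesis .
  qed
  have half: "(\<Sum>i. len (D (2 * i + c))) \<le> len A" for c
    using par by (intro suminf_le_const) auto
  have "(\<Sum>i. len (D i)) = (\<Sum>i. \<Sum>j\<in>{..<2::nat}. len (D (2 * i + j)))"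
  proof -
    have "(\<lambda>i. len (D i)) sums (\<Sum>i. len (D i))" by (intro summable_sums) auto
    then have "(\<lambda>n. sum (\<lambda>i. len (D i)) {n * 2..<n * 2 + 2}) sums (\<Sum>i. len (D i))"
      by (intro sums_group) auto
    moreover have "sum (\<lambda>i. len (D i)) {n * 2..<n * 2 + 2} = (\<Sum>j\<in>{..<2::nat}. len (D (2 * n + j)))" for n
      by (simp add: numeral_2_eq_2 mult.commute)
    ultimately show ?thesis by (simp add: sums_iff)
  qed
  also have "\<dots> = (\<Sum>i. len (D (2 * i + 0)) + len (D (2 * i + 1)))"
    by (intro suminf_cong) (simp add: numeral_2_eq_2)
  also have "\<dots> = (\<Sum>i. len (D (2 * i + 0))) + (\<Sum>i. len (D (2 * i + 1)))"
    by (intro suminf_add[symmetric]) auto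
  also have "\<dots> \<le> len A + len A" by (intro add_mono half)
  also have "\<dots> < top" using fin by (simp add: ennreal_add_less_top)
  finally have D_fin: "(\<Sum>i. len (D i)) < top" .
  have tail: "len (A - F) \<le> len (L n) + (\<Sum>i. len (D (i + n)))" for n
  proof -
    have "A - F \<subseteq> L n \<union> (\<Union>i. D (i + n))"
    proof
      fix x assume x: "x \<in> A - F"
      then have "infdist x F \<noteq> 0"
        using in_closed_iff_infdist_zero[OF \<open>closed F\<close> ne] by auto
      then have "0 < infdist x F" using infdist_nonneg[of x F] by linarith
      then obtain m where "1 / real (Suc m) < infdist x F"
        using nat_approx_posE by (metis of_nat_Suc)
      then have "x \<in> L m" using x by (auto simp: L_def)
      define k where "k = (LEAST m. x \<in> L m)"
      have k: "x \<in> L k" "\<And>j. j < k \<Longrightarrow> x \<notin> L j"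
        using \<open>x \<in> L m\<close> unfolding k_def by (auto intro: LeastI dest: not_less_Least)
      have L_mono: "L i \<subseteq> L j" if "i \<le> j" for i j
      proof -
        have "1 / real (Suc j) \<le> 1 / real (Suc i)" using that by (intro divide_left_mono) auto
        then show ?thesis by (auto simp: L_def)
      qed
      show "x \<in> L n \<union> (\<Union>i. D (i + n))"
      proof (cases "k \<le> n")
        case True
        then show ?thesis using L_mono[OF True] k by auto
      next
        case False
        then have "x \<in> D (k - 1)" using k by (auto simp: D_def)
        then have "x \<in> D ((k - 1 - n) + n)" using False by simp
        then show ?thesis by blast
      qed
    qed
    then have "len (A - F) \<le> len (L n \<union> (\<Union>i. D (i + n)))" by (rule len_mono)
    also have "\<dots> \<le> len (L n) + len (\<Union>i. D (i + n))" by (rule len_Un_le)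
    also have "\<dots> \<le> len (L n) + (\<Sum>i. len (D (i + n)))" by (intro add_left_mono len_UN_le)
    finally show ?thesis .
  qed
  have "len (A \<inter> F) + len (A - F) \<le> len A + (\<Sum>i. len (D (i + n)))" for n
  proof -
    have "len (A \<inter> F) + len (L n) \<le> len (A \<inter> F \<union> L n)"
    proof (rule len_Un_separated)
      fix a b assume "a \<in> A \<inter> F" "b \<in> L n"
      then have "1 / real (Suc n) \<le> infdist b F" "infdist b F \<le> dist b a"
        by (auto simp: L_def intro: infdist_le)
      then show "1 / real (Suc n) \<le> dist a b" by (simp add: dist_commute)
    qed simp
    also have "\<dots> \<le> len A" by (intro len_mono) (auto simp: L_def)
    finally have "len (A \<inter> F) + len (L n) \<le> len A" .
    then have "(len (A \<inter> F) + len (L n)) + (\<Sum>i. len (D (i + n))) \<le> len A + (\<Sum>i. len (D (i + n)))"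
      by (rule add_right_mono)
    moreover have "len (A \<inter> F) + len (A - F) \<le> len (A \<inter> F) + (len (L n) + (\<Sum>i. len (D (i + n))))"
      by (intro add_left_mono tail)
    ultimately show ?thesis unfolding add.assoc by (rule order_trans[rotated])
  qed
  moreover have "(\<lambda>n. len A + (\<Sum>i. len (D (i + n)))) \<longlonglongrightarrow> len A + 0"
  proof (intro tendsto_add tendsto_const)
    define d where "d i = enn2real (len (D i))" for i
    have d: "len (D i) = ennreal (d i)" "0 \<le> d i" for i
      using ennreal_suminf_lessD[OF D_fin] by (auto simp: d_def)
    have sd: "summable d"
      using D_fin d by (intro summable_suminf_not_top) auto
    have "(\<Sum>i. len (D (i + n))) = ennreal (\<Sum>i. d (i + n))" for n
      using d sd by (simp add: suminf_ennreal2 summable_ignore_initial_segment)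
    moreover have "(\<lambda>n. ennreal (\<Sum>i. d (i + n))) \<longlonglongrightarrow> ennreal 0"
      by (intro tendsto_ennrealI suminf_exist_split2 sd)
    ultimately show "(\<lambda>n. \<Sum>i. len (D (i + n))) \<longlonglongrightarrow> 0" by simp
  qed
  ultimately show ?thesis
    by (intro LIMSEQ_le_const) auto
qed auto

text \<open>The restriction of \<^const>\<open>len\<close> to the Borel sets, as a measure.\<close>

definition len_measure :: "'a::metric_space measure" where
  "len_measure = measure_of UNIV (sets borel) len"

lemma measure_space_len: "measure_space (UNIV :: 'a::metric_space set) (sets borel) len"
proof -
  have oms: "outer_measure_space (Pow (UNIV :: 'a set)) len"
    unfolding outer_measure_space_def
    by (auto simp: positive_def increasing_def countably_subadditive_def intro: len_mono len_UN_le)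
  interpret sigma_algebra "UNIV :: 'a set" "Pow UNIV" by (rule sigma_algebra_Pow)
  let ?L = "lambda_system (UNIV :: 'a set) (Pow UNIV) len"
  have ms: "measure_space UNIV ?L len" by (rule caratheodory_lemma[OF oms])
  have "Collect closed \<subseteq> ?L"
  proof
    fix F :: "'a set" assume "F \<in> Collect closed"
    then have "len (x \<inter> F) + len (x - F) \<le> len x" for x by (intro len_closed_split) auto
    moreover have "len x \<le> len (x \<inter> F) + len (x - F)" for x
      using len_Un_le[of "x \<inter> F" "x - F"] by (simp add: Int_Diff_Un)
    ultimately have "len (F \<inter> x) + len ((UNIV - F) \<inter> x) = len x" for x
      by (metis Compl_eq_Diff_UNIV Diff_eq Int_commute antisym)
    then show "F \<in> ?L" by (auto simp: lambda_system_def)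
  qed
  moreover have sa: "sigma_algebra UNIV ?L" using ms by (simp add: measure_space_def)
  ultimately have "sigma_sets UNIV (Collect closed) \<subseteq> ?L"
    by (intro sigma_algebra.sigma_sets_subset)
  then have sub: "sets borel \<subseteq> ?L" by (simp add: borel_eq_closed)
  have "sigma_algebra (UNIV :: 'a set) (sets borel)"
    using sets.sigma_algebra_axioms[of "borel :: 'a measure"] by simp
  moreover have "countably_additive (sets borel) (len :: 'a set \<Rightarrow> ennreal)"
    unfolding countably_additive_def
  proof (intro allI impI)
    fix A :: "nat \<Rightarrow> 'a set"
    assume A: "range A \<subseteq> sets borel" "disjoint_family A" "(\<Union>i. A i) \<in> sets borel"
    have "countably_additive ?L len" using ms by (simp add: measure_space_def)
    then show "(\<Sum>i. len (A i)) = len (\<Union>i. A i)"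
      using A sub by (simp add: countably_additive_def subset_iff)
  qed
  ultimately show ?thesis
    unfolding measure_space_def by (simp add: positive_def)
qed

lemma sets_len_measure [simp, measurable_cong]: "sets (len_measure :: 'a::metric_space measure) = sets borel"
  using measure_space_len[where 'a='a] sets.sigma_sets_eq[of "borel :: 'a measure"]
  by (simp add: len_measure_def sets_measure_of_conv)

lemma space_len_measure [simp]: "space (len_measure :: 'a::metric_space measure) = UNIV"
  by (simp add: len_measure_def space_measure_of_conv)

lemma emeasure_len_measure: "A \<in> sets borel \<Longrightarrow> emeasure len_measure A = len A"
  using measure_space_len[where 'a='a] sets.space_closed[of "borel :: 'a measure"]
  by (intro emeasure_measure_of[OF len_measure_def]) (auto simp: measure_space_def)

lemma len_image_lipschitz:
  fixes f :: "'a::metric_space \<Rightarrow> 'b::metric_space"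
  assumes L: "0 < L" and lip: "\<And>x y. x \<in> A \<Longrightarrow> y \<in> A \<Longrightarrow> dist (f x) (f y) \<le> L * dist x y"
  shows "len (f ` A) \<le> ennreal L * len A"
  unfolding len_def[of "f ` A"]
proof (intro SUP_least)
  fix \<delta> :: real assume \<delta>: "\<delta> \<in> {0<..}"
  have "len_approx \<delta> (f ` A) \<le> ennreal L * len_approx (\<delta> / L) A"
  proof -
    have "len_approx \<delta> (f ` A) \<le> ennreal L * c" if c: "len_approx (\<delta> / L) A < c" for c
    proof -
      from c obtain C where C: "A \<subseteq> (\<Union>n. C n)" "\<And>n. bounded (C n)" "\<And>n. diameter (C n) \<le> \<delta> / L"
        "(\<Sum>n. ennreal (diameter (C n))) < c"
        using len_approx_cover by blast
      have d: "dist (f x) (f y) \<le> L * diameter (C n)" if "x \<in> C n \<inter> A" "y \<in> C n \<inter> A" for x y n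
      proof -
        have "dist (f x) (f y) \<le> L * dist x y" using that lip by auto
        also have "\<dots> \<le> L * diameter (C n)"
          using that L diameter_bounded_bound[OF C(2)] by (intro mult_left_mono) auto
        finally show ?thesis .
      qed
      have nn: "0 \<le> L * diameter (C n)" for n
        using L C(2) by (simp add: diameter_ge_0)
      have dd: "diameter (f ` (C n \<inter> A)) \<le> L * diameter (C n)" for n
        using d nn by (intro diameter_leI) auto
      have "len_approx \<delta> (f ` A) \<le> (\<Sum>n. ennreal (diameter (f ` (C n \<inter> A))))"
      proof (rule len_approx_le)
        show "f ` A \<subseteq> (\<Union>n. f ` (C n \<inter> A))" using C(1) by blast
        show "bounded (f ` (C n \<inter> A))" for n
          unfolding bounded_any_center
        proof (cases "C n \<inter> A = {}")
          case False
          then obtain a where "a \<in> C n \<inter> A" by blast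
          then show "bounded (f ` (C n \<inter> A))"
            unfolding bounded_def using d by (intro exI[of _ "f a"] exI[of _ "L * diameter (C n)"]) auto
        qed auto
        have "L * diameter (C n) \<le> \<delta>" for n using C(3)[of n] L by (simp add: field_simps)
        then show "diameter (f ` (C n \<inter> A)) \<le> \<delta>" for n using dd order_trans by blast
      qed
      also have "\<dots> \<le> (\<Sum>n. ennreal L * ennreal (diameter (C n)))"
        using dd L by (intro suminf_le) (auto simp: ennreal_mult'[symmetric] intro!: ennreal_leI)
      also have "\<dots> = ennreal L * (\<Sum>n. ennreal (diameter (C n)))" by simp
      also have "\<dots> \<le> ennreal L * c" using C(4) by (intro mult_left_mono) auto
      finally show ?thesis .
    qed
    then have *: "len_approx \<delta> (f ` A) / ennreal L \<le> c" if "len_approx (\<delta> / L) A < c" for c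
      using L that by (simp add: divide_le_posI_ennreal mult.commute)
    have "len_approx \<delta> (f ` A) / ennreal L \<le> len_approx (\<delta> / L) A"
      using * by (rule dense_ge)
    then have "ennreal L * (len_approx \<delta> (f ` A) / ennreal L) \<le> ennreal L * len_approx (\<delta> / L) A"
      by (intro mult_left_mono) auto
    moreover have "ennreal L * (len_approx \<delta> (f ` A) / ennreal L) = len_approx \<delta> (f ` A)"
      using L by (simp add: ennreal_times_divide mult.commute[of "ennreal L"] mult_divide_eq_ennreal)
    ultimately show ?thesis by simp
  qed
  also have "\<dots> \<le> ennreal L * len A"
    using L \<delta> by (intro mult_left_mono len_approx_le_len) auto
  finally show "len_approx \<delta> (f ` A) \<le> ennreal L * len A" .
qed

lemma len_image_similarity:
  fixes a :: complex
  assumes "0 < c"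
  shows "len ((\<lambda>z. a + of_real c * z) ` A) = ennreal c * len A"
proof (rule antisym)
  let ?f = "\<lambda>z. a + of_real c * z" and ?g = "\<lambda>z. (z - a) / of_real c"
  have "dist (of_real c * x) (of_real c * y) = c * dist x y" for x y :: complex
    using assms by (simp add: dist_norm right_diff_distrib[symmetric] norm_mult del: of_real_mult)
  then show "len (?f ` A) \<le> ennreal c * len A"
    using assms by (intro len_image_lipschitz) auto
  have "len (?g ` ?f ` A) \<le> ennreal (1 / c) * len (?f ` A)"
    using assms by (intro len_image_lipschitz)
      (auto simp: dist_norm diff_divide_distrib[symmetric] norm_divide)
  also have "?g ` ?f ` A = A" using assms by (auto simp: image_image)
  finally have "ennreal c * len A \<le> ennreal c * (ennreal (1 / c) * len (?f ` A))"
    by (intro mult_left_mono) auto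
  also have "\<dots> = len (?f ` A)"
    using assms by (simp add: mult.assoc[symmetric] ennreal_mult[symmetric])
  finally show "ennreal c * len A \<le> len (?f ` A)" .
qed

lemma len_Icc_ge: "ennreal d \<le> len {0..d::real}"
proof (cases "0 \<le> d")
  case True
  have "ennreal d \<le> len_approx 1 {0..d}"
    unfolding len_approx_def
  proof (intro INF_greatest)
    fix C :: "nat \<Rightarrow> real set"
    assume "C \<in> {C. {0..d} \<subseteq> (\<Union>n. C n) \<and> (\<forall>n. bounded (C n) \<and> diameter (C n) \<le> 1)}"
    then have C: "{0..d} \<subseteq> (\<Union>n. C n)" "\<And>n. bounded (C n)" by auto
    let ?I = "\<lambda>n. if C n = {} then {} else {Inf (C n)..Sup (C n)}"
    have sub: "C n \<subseteq> ?I n" for n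
      using bounded_imp_bdd_above[OF C(2)[of n]] bounded_imp_bdd_below[OF C(2)[of n]]
        cInf_lower[of _ "C n"] cSup_upper[of _ "C n"] by auto
    have "ennreal d = emeasure lborel {0..d}" using True by simp
    also have "\<dots> \<le> emeasure lborel (\<Union>n. ?I n)"
      using C(1) sub by (intro emeasure_mono) (blast, auto)
    also have "\<dots> \<le> (\<Sum>n. emeasure lborel (?I n))"
      by (intro emeasure_subadditive_countably) auto
    also have "\<dots> \<le> (\<Sum>n. ennreal (diameter (C n)))"
    proof (intro suminf_le)
      fix n
      show "emeasure lborel (?I n) \<le> ennreal (diameter (C n))"
      proof (cases "C n = {}")
        case False
        have "Sup (C n) - Inf (C n) \<le> diameter (C n)"
        proof -
          have "x - y \<le> diameter (C n)" if "x \<in> C n" "y \<in> C n" for x y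
            using diameter_bounded_bound[OF C(2) that] by (auto simp: dist_real_def)
          then have "x \<le> diameter (C n) + y" if "x \<in> C n" "y \<in> C n" for x y
            using that by fastforce
          then have "Sup (C n) \<le> diameter (C n) + y" if "y \<in> C n" for y
            using that False by (intro cSup_least) auto
          then have "Sup (C n) - diameter (C n) \<le> y" if "y \<in> C n" for y
            using that by fastforce
          then have "Sup (C n) - diameter (C n) \<le> Inf (C n)"
            using False by (intro cInf_greatest) auto
          then show ?thesis by simp
        qed
        moreover have "Inf (C n) \<le> Sup (C n)"
          using sub[of n] False by force
        ultimately show ?thesis using False by (auto intro: ennreal_leI)
      qed simp
    qed auto
    finally show "ennreal d \<le> (\<Sum>n. ennreal (diameter (C n)))" .
  qed
  also have "\<dots> \<le> len {0..d}" by (rule len_approx_le_len) simp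
  finally show ?thesis .
qed (simp add: ennreal_neg)

text \<open>
  The distance to \<open>p\<close> is Lipschitz and maps a connected set containing \<open>p\<close> and \<open>q\<close> onto a set containing
  the interval from \<open>0\<close> to their distance.
\<close>

lemma dist_le_len_connected:
  assumes "connected A" "p \<in> A" "q \<in> A"
  shows "ennreal (dist p q) \<le> len A"
proof -
  have "connected (dist p ` A)"
    using assms(1) by (rule connected_continuous_image[rotated])
      (intro continuous_on_dist continuous_on_const continuous_on_id)
  moreover have "0 \<in> dist p ` A" "dist p q \<in> dist p ` A"
    using assms(2,3) dist_self[of p] by (auto simp del: dist_self intro: image_eqI[of _ _ p])
  ultimately have "{0..dist p q} \<subseteq> dist p ` A" by (rule connected_contains_Icc)
  have "ennreal (dist p q) \<le> len {0..dist p q}" by (rule len_Icc_ge)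
  also have "\<dots> \<le> len (dist p ` A)" by (intro len_mono) fact
  also have "\<dots> \<le> ennreal 1 * len A"
  proof (rule len_image_lipschitz)
    fix x y
    show "dist (dist p x) (dist p y) \<le> 1 * dist x y"
      using abs_dist_diff_le[of x p y] by (simp add: dist_real_def dist_commute)
  qed simp
  finally show ?thesis by simp
qed

section \<open>Random compact sets\<close>

lemma space_route_space: "space route_space = {A. compact A}"
  unfolding route_space_def by (rule space_measure_of) auto

lemma sets_route_space:
  "sets route_space = sigma_sets {A. compact A} {{A. compact A \<and> A \<inter> U \<noteq> {}} | U. open U}"
  unfolding route_space_def by (rule sets_measure_of) auto

lemma sets_route_space_hits: "open U \<Longrightarrow> {A. compact A \<and> A \<inter> U \<noteq> {}} \<in> sets route_space"
  unfolding sets_route_space by (intro sigma_sets.Basic) auto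

text \<open>
  For a compact set, meeting a closed set is the same as meeting all of its open neighbourhoods.
\<close>

lemma sets_route_space_subset:
  assumes "open V"
  shows "{A. compact A \<and> A \<subseteq> V} \<in> sets route_space"
proof (cases "V = UNIV")
  case True
  then show ?thesis using sets.top[of route_space] by (simp add: space_route_space)
next
  case False
  let ?H = "\<lambda>n. {A. compact A \<and> A \<inter> {x. infdist x (- V) < 1 / real (Suc n)} \<noteq> {}}"
  have "{A. compact A \<and> A \<subseteq> V} = space route_space - (\<Inter>n. ?H n)"
  proof (intro set_eqI iffI)
    fix A assume A: "A \<in> {A. compact A \<and> A \<subseteq> V}"
    have "A \<notin> (\<Inter>n. ?H n)"
    proof (cases "A = {}")
      case ne: False
      obtain x where x: "x \<in> A" "\<And>y. y \<in> A \<Longrightarrow> infdist x (- V) \<le> infdist y (- V)"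
        using continuous_attains_inf[of A "\<lambda>x. infdist x (- V)"] A ne
          continuous_on_infdist[OF continuous_on_id, of A "- V"] by (metis mem_Collect_eq)
      have "infdist x (- V) \<noteq> 0"
        using in_closed_iff_infdist_zero[of "- V" x] x A assms False by auto
      then have "0 < infdist x (- V)" using infdist_nonneg[of x "- V"] by linarith
      then obtain n where "1 / real (Suc n) < infdist x (- V)"
        using nat_approx_posE by (metis of_nat_Suc)
      then have "A \<notin> ?H n" using x(2) by force
      then show ?thesis by blast
    qed auto
    then show "A \<in> space route_space - (\<Inter>n. ?H n)" using A by (simp add: space_route_space)
  next
    fix A assume "A \<in> space route_space - (\<Inter>n. ?H n)"
    then have "compact A" and A: "A \<notin> (\<Inter>n. ?H n)" by (auto simp: space_route_space)
    have "A \<subseteq> V"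
    proof (rule ccontr)
      assume "\<not> A \<subseteq> V"
      then obtain x where "x \<in> A" "x \<in> - V" by blast
      then have "x \<in> A" "infdist x (- V) = 0" by (auto intro: infdist_zero)
      then have "A \<in> (\<Inter>n. ?H n)" using \<open>compact A\<close> by auto
      then show False using A by contradiction
    qed
    then show "A \<in> {A. compact A \<and> A \<subseteq> V}" using \<open>compact A\<close> by simp
  qed
  also have "\<dots> \<in> sets route_space"
  proof (intro sets.Diff sets.top sets.countable_INT' image_subsetI)
    fix n
    have "open {x. infdist x (- V) < 1 / real (Suc n)}"
      by (intro open_Collect_less continuous_on_infdist continuous_on_id continuous_on_const)
    then show "?H n \<in> sets route_space" by (rule sets_route_space_hits)
  qed auto
  finally show ?thesis .
qed

text \<open>
  For a compact set, covers can be taken from a countable family: an open cover is refined by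
  finitely many sets of a countable basis, grouped according to the members that contain them.
\<close>

definition basic_covers :: "complex set set \<Rightarrow> real \<Rightarrow> complex set set list set" where
  "basic_covers \<B> \<delta> =
     {gs \<in> lists {F. finite F \<and> F \<subseteq> \<B>}. \<forall>g\<in>set gs. bounded (\<Union>g) \<and> diameter (\<Union>g) \<le> \<delta>}"

definition basic_cover_length :: "complex set set \<Rightarrow> real \<Rightarrow> complex set \<Rightarrow> ennreal" where
  "basic_cover_length \<B> \<delta> K = (INF gs\<in>basic_covers \<B> \<delta>.
     if K \<subseteq> (\<Union>g\<in>set gs. \<Union>g) then \<Sum>g\<leftarrow>gs. ennreal (diameter (\<Union>g)) else \<infinity>)"

lemma len_approx_le_basic_cover_length:
  assumes "0 \<le> \<delta>"
  shows "len_approx \<delta> K \<le> basic_cover_length \<B> \<delta> K"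
  unfolding basic_cover_length_def
proof (intro INF_greatest)
  fix gs assume gs: "gs \<in> basic_covers \<B> \<delta>"
  show "len_approx \<delta> K \<le>
     (if K \<subseteq> (\<Union>g\<in>set gs. \<Union>g) then \<Sum>g\<leftarrow>gs. ennreal (diameter (\<Union>g)) else \<infinity>)"
  proof (cases "K \<subseteq> (\<Union>g\<in>set gs. \<Union>g)")
    case True
    let ?C = "\<lambda>n. if n < length gs then \<Union>(gs ! n) else {}"
    have mem: "gs ! n \<in> set gs" if "n < length gs" for n using that by simp
    have "K \<subseteq> (\<Union>n. ?C n)"
    proof
      fix x assume "x \<in> K"
      then obtain g where "g \<in> set gs" "x \<in> \<Union>g" using True by blast
      then obtain n where "n < length gs" "x \<in> \<Union>(gs ! n)" by (metis in_set_conv_nth)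
      then show "x \<in> (\<Union>n. ?C n)" by (intro UN_I[of n]) auto
    qed
    then have "len_approx \<delta> K \<le> (\<Sum>n. ennreal (diameter (?C n)))"
      using gs mem assms by (intro len_approx_le) (auto simp: basic_covers_def)
    also have "\<dots> = (\<Sum>n<length gs. ennreal (diameter (?C n)))"
      by (intro suminf_finite) auto
    also have "\<dots> = (\<Sum>g\<leftarrow>gs. ennreal (diameter (\<Union>g)))"
      by (simp add: sum_list_sum_nth atLeast0LessThan)
    finally show ?thesis using True by simp
  qed auto
qed

lemma basic_cover_length_le_len_approx:
  assumes B: "topological_basis \<B>" and K: "compact K" and \<delta>: "0 < \<delta>"
  shows "basic_cover_length \<B> (2 * \<delta>) K \<le> len_approx \<delta> K"
proof (rule dense_ge)
  fix c assume "len_approx \<delta> K < c"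
  then obtain C where C: "K \<subseteq> (\<Union>n. C n)" "\<And>n. bounded (C n)" "\<And>n. diameter (C n) \<le> \<delta>"
    "(\<Sum>n. ennreal (diameter (C n))) < c"
    using len_approx_cover by blast
  have "basic_cover_length \<B> (2 * \<delta>) K \<le> (\<Sum>n. ennreal (diameter (C n)))"
  proof (rule ennreal_le_epsilon)
    fix e :: real assume e: "0 < e"
    define d where "d n = min \<delta> (e * (1/2) ^ Suc n)" for n
    have d: "0 < d n" "d n \<le> \<delta>" "d n \<le> e * (1/2) ^ Suc n" for n
      using \<delta> e by (auto simp: d_def)
    define V where "V n = (\<Union>x\<in>C n. ball x (d n / 2))" for n
    have openV: "open (V n)" for n by (auto simp: V_def)
    have "C n \<subseteq> V n" for n using d(1)[of n] by (force simp: V_def)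
    then have KV: "K \<subseteq> (\<Union>n. V n)" using C(1) by (meson SUP_mono' order_trans)
    have Vdist: "dist x y \<le> diameter (C n) + d n" if "x \<in> V n" "y \<in> V n" for x y n
    proof -
      obtain x' y' where x': "x' \<in> C n" "dist x' x < d n / 2" and y': "y' \<in> C n" "dist y' y < d n / 2"
        using \<open>x \<in> V n\<close> \<open>y \<in> V n\<close> by (auto simp: V_def)
      have "dist x y \<le> dist x' x + dist x' y' + dist y' y"
        using dist_triangle3[of x y x'] dist_triangle[of x' y y'] by linarith
      then show ?thesis using x' y' diameter_bounded_bound[OF C(2) x'(1) y'(1)] by linarith
    qed
    have nn: "0 \<le> diameter (C n)" for n using C(2) by (rule diameter_ge_0)
    have Vb: "bounded (V n)" for n
    proof (cases "V n = {}")
      case False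
      then obtain a where "a \<in> V n" by blast
      then show ?thesis
        unfolding bounded_def using Vdist by blast
    qed simp
    have Vd: "diameter (V n) \<le> diameter (C n) + d n" for n
      using Vdist nn[of n] d(1)[of n] by (intro diameter_leI) (auto intro: add_nonneg_nonneg)
    define \<F> where "\<F> = {B\<in>\<B>. \<exists>n. B \<subseteq> V n}"
    have "K \<subseteq> \<Union>\<F>"
    proof
      fix x assume "x \<in> K"
      then obtain n where "x \<in> V n" using KV by blast
      then obtain B where "B \<in> \<B>" "x \<in> B" "B \<subseteq> V n"
        using topological_basisE[OF B openV] by metis
      then show "x \<in> \<Union>\<F>" by (auto simp: \<F>_def)
    qed
    moreover have "\<forall>B\<in>\<F>. open B"
      using B by (auto simp: \<F>_def topological_basis_open)
    ultimately obtain \<G> where \<G>: "\<G> \<subseteq> \<F>" "finite \<G>" "K \<subseteq> \<Union>\<G>"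
      using K compactE by metis
    have "\<forall>B\<in>\<G>. \<exists>n. B \<subseteq> V n" using \<G>(1) by (auto simp: \<F>_def)
    then obtain m where m: "\<And>B. B \<in> \<G> \<Longrightarrow> B \<subseteq> V (m B)" by metis
    obtain k where k: "\<And>B. B \<in> \<G> \<Longrightarrow> m B < k"
      using finite_nat_set_iff_bounded[of "m ` \<G>"] \<G>(2) by auto
    let ?g = "\<lambda>n. {B\<in>\<G>. B \<subseteq> V n}"
    let ?gs = "map ?g [0..<k]"
    have gV: "\<Union>(?g n) \<subseteq> V n" for n by auto
    have gd: "diameter (\<Union>(?g n)) \<le> diameter (C n) + d n" for n
      using diameter_subset[OF gV Vb] Vd by (rule order_trans)
    have "?gs \<in> basic_covers \<B> (2 * \<delta>)"
      unfolding basic_covers_def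
    proof (intro CollectI conjI ballI)
      show "?gs \<in> lists {F. finite F \<and> F \<subseteq> \<B>}"
        using \<G> by (auto simp: \<F>_def in_lists_conv_set)
      fix g assume "g \<in> set ?gs"
      then obtain n where g: "g = ?g n" by auto
      show "bounded (\<Union>g)" unfolding g using bounded_subset[OF Vb gV] .
      show "diameter (\<Union>g) \<le> 2 * \<delta>"
        unfolding g using gd[of n] C(3)[of n] d(2)[of n] by linarith
    qed
    moreover have "K \<subseteq> (\<Union>g\<in>set ?gs. \<Union>g)"
    proof
      fix x assume "x \<in> K"
      then obtain B where "B \<in> \<G>" "x \<in> B" using \<G>(3) by blast
      then show "x \<in> (\<Union>g\<in>set ?gs. \<Union>g)"
        using m[of B] k[of B] by (auto intro!: bexI[of _ "m B"])
    qed
    ultimately have "basic_cover_length \<B> (2 * \<delta>) K \<le> (\<Sum>g\<leftarrow>?gs. ennreal (diameter (\<Union>g)))"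
      unfolding basic_cover_length_def by (intro INF_lower2[of ?gs]) simp_all
    also have "\<dots> = (\<Sum>n<k. ennreal (diameter (\<Union>(?g n))))"
      by (simp add: interv_sum_list_conv_sum_set_nat o_def atLeast0LessThan)
    also have "\<dots> \<le> (\<Sum>n<k. ennreal (diameter (C n)) + ennreal (e * (1/2) ^ Suc n))"
    proof (intro sum_mono)
      fix n
      have "diameter (\<Union>(?g n)) \<le> diameter (C n) + e * (1/2) ^ Suc n"
        using gd[of n] d(3)[of n] by linarith
      then show "ennreal (diameter (\<Union>(?g n))) \<le> ennreal (diameter (C n)) + ennreal (e * (1/2) ^ Suc n)"
        using nn e by (subst ennreal_plus[symmetric]) (auto intro: ennreal_leI simp del: ennreal_plus)
    qed
    also have "\<dots> \<le> (\<Sum>n. ennreal (diameter (C n)) + ennreal (e * (1/2) ^ Suc n))"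
      by (intro sum_le_suminf) auto
    also have "\<dots> = (\<Sum>n. ennreal (diameter (C n))) + (\<Sum>n. ennreal (e * (1/2) ^ Suc n))"
      by (intro suminf_add[symmetric]) auto
    also have "(\<Sum>n. ennreal (e * (1/2) ^ Suc n)) = ennreal e"
      using e power_half_series sums_mult[OF power_half_series, of e]
      by (intro suminf_ennreal_eq) auto
    finally show "basic_cover_length \<B> (2 * \<delta>) K \<le> (\<Sum>n. ennreal (diameter (C n))) + ennreal e" .
  qed
  with C(4) show "basic_cover_length \<B> (2 * \<delta>) K \<le> c" by simp
qed

lemma len_eq_SUP_basic_cover_length:
  assumes B: "topological_basis \<B>" and K: "compact K"
  shows "len K = (SUP n. basic_cover_length \<B> (1 / real (Suc n)) K)"
proof (rule antisym)
  show "len K \<le> (SUP n. basic_cover_length \<B> (1 / real (Suc n)) K)"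
    unfolding len_def
  proof (intro SUP_least)
    fix \<delta> :: real assume "\<delta> \<in> {0<..}"
    then obtain n where "1 / real (Suc n) < \<delta>"
      using nat_approx_posE by (metis greaterThan_iff of_nat_Suc)
    then have "len_approx \<delta> K \<le> len_approx (1 / real (Suc n)) K"
      by (intro len_approx_antimono) auto
    also have "\<dots> \<le> basic_cover_length \<B> (1 / real (Suc n)) K"
      by (intro len_approx_le_basic_cover_length) auto
    also have "\<dots> \<le> (SUP n. basic_cover_length \<B> (1 / real (Suc n)) K)" by (rule SUP_upper) simp
    finally show "len_approx \<delta> K \<le> (SUP n. basic_cover_length \<B> (1 / real (Suc n)) K)" .
  qed
  show "(SUP n. basic_cover_length \<B> (1 / real (Suc n)) K) \<le> len K"
  proof (rule SUP_least)
    fix n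
    have eq: "2 * (1 / real (2 * Suc n)) = 1 / real (Suc n)"
      by (simp add: divide_simps)
    have "basic_cover_length \<B> (1 / real (Suc n)) K \<le> len_approx (1 / real (2 * Suc n)) K"
      using basic_cover_length_le_len_approx[OF B K, of "1 / real (2 * Suc n)"]
      unfolding eq by (simp del: of_nat_Suc of_nat_mult)
    also have "\<dots> \<le> len K" by (rule len_approx_le_len) simp
    finally show "basic_cover_length \<B> (1 / real (Suc n)) K \<le> len K" .
  qed
qed

lemma borel_measurable_len_Int_closed:
  assumes "closed C"
  shows "(\<lambda>K. len (K \<inter> C)) \<in> borel_measurable route_space"
proof -
  obtain \<B> :: "complex set set" where \<B>: "countable \<B>" "topological_basis \<B>"
    using ex_countable_basis by blast
  have "(\<lambda>K. SUP n. basic_cover_length \<B> (1 / real (Suc n)) (K \<inter> C)) \<in> borel_measurable route_space"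
    unfolding basic_cover_length_def
  proof (intro borel_measurable_SUP borel_measurable_INF)
    fix n
    have "countable (lists {F. finite F \<and> F \<subseteq> \<B>})"
      using \<B>(1) by (intro countable_lists countable_Collect_finite_subset)
    then show "countable (basic_covers \<B> (1 / real (Suc n)))"
      by (rule countable_subset[rotated]) (auto simp: basic_covers_def)
    fix gs assume "gs \<in> basic_covers \<B> (1 / real (Suc n))"
    then have "\<forall>g\<in>set gs. \<forall>B\<in>g. open B"
      using topological_basis_open[OF \<B>(2)] by (fastforce simp: basic_covers_def in_lists_conv_set)
    then have "open ((\<Union>g\<in>set gs. \<Union>g) \<union> - C)"
      using assms by (intro open_Un open_UN open_Union) (auto simp: open_Compl)
    from sets_route_space_subset[OF this]
    have "{K \<in> space route_space. K \<inter> C \<subseteq> (\<Union>g\<in>set gs. \<Union>g)} \<in> sets route_space"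
      by (rule back_subst[of "\<lambda>A. A \<in> sets route_space"]) (auto simp: space_route_space)
    then show "(\<lambda>K. if K \<inter> C \<subseteq> (\<Union>g\<in>set gs. \<Union>g) then \<Sum>g\<leftarrow>gs. ennreal (diameter (\<Union>g)) else \<infinity>)
        \<in> borel_measurable route_space"
      by (intro measurable_If) auto
  qed auto
  also have "?this \<longleftrightarrow> ?thesis"
    using assms \<B>(2)
    by (intro measurable_cong) (auto simp: space_route_space len_eq_SUP_basic_cover_length compact_Int_closed)
  finally show ?thesis .
qed

lemma borel_measurable_len_route [measurable]: "len \<in> borel_measurable route_space"
  using borel_measurable_len_Int_closed[of UNIV] by simp

lemma compact_route:
  "N \<in> M \<rightarrow>\<^sub>M route_space \<Longrightarrow> \<omega> \<in> space M \<Longrightarrow> compact (N \<omega>)"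
  using measurable_space[of N M route_space \<omega>] by (simp add: space_route_space)

lemma sets_hits:
  assumes "N \<in> M \<rightarrow>\<^sub>M route_space" "open U"
  shows "{\<omega>\<in>space M. N \<omega> \<inter> U \<noteq> {}} \<in> sets M"
proof -
  have "N -` {A. compact A \<and> A \<inter> U \<noteq> {}} \<inter> space M \<in> sets M"
    by (rule measurable_sets[OF assms(1) sets_route_space_hits[OF assms(2)]])
  also have "N -` {A. compact A \<and> A \<inter> U \<noteq> {}} \<inter> space M = {\<omega>\<in>space M. N \<omega> \<inter> U \<noteq> {}}"
    using compact_route[OF assms(1)] by auto
  finally show ?thesis .
qed

lemma measurable_route_spaceI:
  assumes "\<And>\<omega>. \<omega> \<in> space M \<Longrightarrow> compact (N \<omega>)"
    and "\<And>U. open U \<Longrightarrow> {\<omega>\<in>space M. N \<omega> \<inter> U \<noteq> {}} \<in> sets M"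
  shows "N \<in> M \<rightarrow>\<^sub>M route_space"
  unfolding route_space_def
proof (rule measurable_measure_of)
  fix y :: "complex set set" assume "y \<in> {{A. compact A \<and> A \<inter> U \<noteq> {}} | U. open U}"
  then obtain U where "open U" and y: "y = {A. compact A \<and> A \<inter> U \<noteq> {}}" by auto
  have "N -` y \<inter> space M = {\<omega>\<in>space M. N \<omega> \<inter> U \<noteq> {}}"
    using assms(1) y by auto
  then show "N -` y \<inter> space M \<in> sets M" using assms(2)[OF \<open>open U\<close>] by simp
qed (use assms(1) in auto)

lemma measurable_route_UN:
  assumes "finite P" "\<And>p. p \<in> P \<Longrightarrow> N p \<in> M \<rightarrow>\<^sub>M route_space"
  shows "(\<lambda>\<omega>. \<Union>p\<in>P. N p \<omega>) \<in> M \<rightarrow>\<^sub>M route_space"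
proof (rule measurable_route_spaceI)
  fix \<omega> assume "\<omega> \<in> space M"
  then show "compact (\<Union>p\<in>P. N p \<omega>)"
    using assms(1) by (intro compact_UN) (auto intro: compact_route[OF assms(2)])
next
  fix U :: "complex set" assume "open U"
  then have "(\<Union>p\<in>P. {\<omega>\<in>space M. N p \<omega> \<inter> U \<noteq> {}}) \<in> sets M"
    using assms by (intro sets.finite_UN sets_hits) auto
  also have "(\<Union>p\<in>P. {\<omega>\<in>space M. N p \<omega> \<inter> U \<noteq> {}}) = {\<omega>\<in>space M. (\<Union>p\<in>P. N p \<omega>) \<inter> U \<noteq> {}}"
    by auto
  finally show "{\<omega>\<in>space M. (\<Union>p\<in>P. N p \<omega>) \<inter> U \<noteq> {}} \<in> sets M" .
qed

lemma sets_route_graph: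
  assumes "N \<in> M \<rightarrow>\<^sub>M route_space"
  shows "{z \<in> space (M \<Otimes>\<^sub>M borel). snd z \<in> N (fst z)} \<in> sets (M \<Otimes>\<^sub>M borel)"
proof -
  obtain Q :: "complex set" where Q: "countable Q" "\<And>X. open X \<Longrightarrow> X \<noteq> {} \<Longrightarrow> \<exists>d\<in>Q. d \<in> X"
    using countable_dense_setE by blast
  let ?e = "\<lambda>n. 1 / real (Suc n)"
  let ?H = "\<lambda>q n. {\<omega>\<in>space M. N \<omega> \<inter> ball q (?e n) \<noteq> {}}"
  have "{z \<in> space (M \<Otimes>\<^sub>M borel). snd z \<in> N (fst z)} =
      (\<Inter>n. \<Union>q\<in>Q. ?H q n \<times> ball q (?e n))"
  proof (intro set_eqI iffI)
    fix z assume z: "z \<in> {z \<in> space (M \<Otimes>\<^sub>M borel). snd z \<in> N (fst z)}"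
    have "\<exists>q\<in>Q. z \<in> ?H q n \<times> ball q (?e n)" for n
    proof -
      obtain q where "q \<in> Q" "q \<in> ball (snd z) (?e n)"
        using Q(2)[of "ball (snd z) (?e n)"] by auto
      then show ?thesis
        using z by (intro bexI[of _ q]) (auto simp: space_pair_measure dist_commute)
    qed
    then show "z \<in> (\<Inter>n. \<Union>q\<in>Q. ?H q n \<times> ball q (?e n))" by blast
  next
    fix z assume z: "z \<in> (\<Inter>n. \<Union>q\<in>Q. ?H q n \<times> ball q (?e n))"
    obtain \<omega> x where [simp]: "z = (\<omega>, x)" by (cases z)
    have \<omega>: "\<omega> \<in> space M" using z by auto
    have near: "\<exists>y\<in>N \<omega>. dist y x < 2 * ?e n" for n
    proof -
      have "z \<in> (\<Union>q\<in>Q. ?H q n \<times> ball q (?e n))" using z by blast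
      then obtain q y where "y \<in> N \<omega>" "dist q y < ?e n" "dist q x < ?e n" by auto
      then show ?thesis
        using dist_triangle3[of y x q] by (intro bexI[of _ y]) auto
    qed
    have "x \<in> closure (N \<omega>)"
      unfolding closure_approachable
    proof (intro allI impI)
      fix e :: real assume "0 < e"
      then obtain n where "?e n < e / 2" using nat_approx_posE[of "e / 2"] by (metis half_gt_zero of_nat_Suc)
      moreover obtain y where "y \<in> N \<omega>" "dist y x < 2 * ?e n" using near by blast
      ultimately show "\<exists>y\<in>N \<omega>. dist y x < e" by (intro bexI[of _ y]) auto
    qed
    then have "x \<in> N \<omega>" using compact_route[OF assms \<omega>] by (simp add: compact_imp_closed closure_closed)
    then show "z \<in> {z \<in> space (M \<Otimes>\<^sub>M borel). snd z \<in> N (fst z)}"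
      using \<omega> by (simp add: space_pair_measure)
  qed
  also have "\<dots> \<in> sets (M \<Otimes>\<^sub>M borel)"
  proof (intro sets.countable_INT'[OF _ _] image_subsetI sets.countable_UN'[OF Q(1)])
    fix n q
    show "?H q n \<times> ball q (?e n) \<in> sets (M \<Otimes>\<^sub>M borel)"
      by (intro pair_measureI sets_hits assms) auto
  qed auto
  finally show ?thesis .
qed

text \<open>
  The length of a measurable random part of a random compact set of finite length is a random
  variable. For closed parts this holds because the length of a compact set is computed from countably
  many covers; the general case follows because the parts for which the claim holds form a Dynkin
  system.
\<close>

lemma borel_measurable_len_section:
  assumes N: "N \<in> M \<rightarrow>\<^sub>M route_space" and D: "D \<in> sets (M \<Otimes>\<^sub>M borel)"
  shows "(\<lambda>\<omega>. if len (N \<omega>) < \<infinity> then len (N \<omega> \<inter> {x. (\<omega>, x) \<in> D}) else 0) \<in> borel_measurable M"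
proof -
  let ?f = "\<lambda>D \<omega>. if len (N \<omega>) < \<infinity> then len (N \<omega> \<inter> {x. (\<omega>, x) \<in> D}) else 0"
  let ?G = "{a \<times> b | a b. a \<in> sets M \<and> b \<in> Collect (closed :: complex set \<Rightarrow> bool)}"
  let ?O = "space M \<times> (UNIV :: complex set)"
  have sets_eq: "sets (M \<Otimes>\<^sub>M borel) = sigma_sets ?O ?G"
  proof -
    have "sets (M \<Otimes>\<^sub>M (borel :: complex measure)) = sets (sigma (space M \<times> space borel) ?G)"
    proof (rule sets_pair_eq[where Ca="{space M}" and Cb="{UNIV}"])
      show "sets M = sigma_sets (space M) (sets M)" by (simp add: sets.sigma_sets_eq)
      show "sets borel = sigma_sets (space borel) (Collect (closed :: complex set \<Rightarrow> bool))"
        by (simp add: borel_eq_closed)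
    qed (auto dest: sets.sets_into_space)
    also have "\<dots> = sigma_sets ?O ?G" by (subst sets_measure_of) (auto dest: sets.sets_into_space)
    finally show ?thesis .
  qed
  note [measurable] = N
  have fin [measurable]: "Measurable.pred M (\<lambda>\<omega>. len (N \<omega>) < \<infinity>)" by measurable
  have sec: "N \<omega> \<inter> {x. (\<omega>, x) \<in> A} \<in> sets borel" "{x. (\<omega>, x) \<in> A} \<in> sets borel"
    if "\<omega> \<in> space M" "A \<in> sigma_sets ?O ?G" for \<omega> A
  proof -
    have "Pair \<omega> -` A \<in> sets borel" using that by (intro sets_Pair1[of A M borel]) (simp add: sets_eq)
    then show "{x. (\<omega>, x) \<in> A} \<in> sets borel" by (simp add: vimage_def)
    then show "N \<omega> \<inter> {x. (\<omega>, x) \<in> A} \<in> sets borel"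
      using compact_route[OF N that(1)] by (intro sets.Int) (auto intro: borel_compact)
  qed
  have "Int_stable ?G"
  proof (rule Int_stableI)
    fix x y :: "('a \<times> complex) set" assume "x \<in> ?G" "y \<in> ?G"
    then obtain a b a' b' where xy: "x = a \<times> b" "y = a' \<times> b'" "a \<in> sets M" "closed b" "a' \<in> sets M" "closed b'"
      by auto
    then have "x \<inter> y = (a \<inter> a') \<times> (b \<inter> b')" "a \<inter> a' \<in> sets M" "b \<inter> b' \<in> Collect closed"
      by auto
    then show "x \<inter> y \<in> ?G" by blast
  qed
  moreover have "?G \<subseteq> Pow ?O" by (auto dest: sets.sets_into_space)
  moreover have "D \<in> sigma_sets ?O ?G" using D by (simp add: sets_eq)
  ultimately show ?thesis
  proof (induction rule: sigma_sets_induct_disjoint)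
    case (basic A)
    then obtain a b where A: "A = a \<times> b" and a [measurable]: "a \<in> sets M" and b: "closed b" by auto
    have [measurable]: "(\<lambda>\<omega>. len (N \<omega> \<inter> b)) \<in> borel_measurable M"
      using measurable_compose[OF N borel_measurable_len_Int_closed[OF b]] .
    have "?f A = (\<lambda>\<omega>. if len (N \<omega>) < \<infinity> then (if \<omega> \<in> a then len (N \<omega> \<inter> b) else 0) else 0)"
      by (auto simp: A fun_eq_iff)
    then show ?case by simp
  next
    case empty
    have "?f {} = (\<lambda>_. 0)" by (auto simp: fun_eq_iff)
    then show ?case by (simp del: empty_iff)
  next
    case (compl A)
    have "?f (?O - A) \<omega> = (if len (N \<omega>) < \<infinity> then len (N \<omega>) - ?f A \<omega> else 0)" if \<omega>: "\<omega> \<in> space M" for \<omega>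
    proof (cases "len (N \<omega>) < \<infinity>")
      case True
      have "len (N \<omega> - (N \<omega> \<inter> {x. (\<omega>, x) \<in> A})) = len (N \<omega>) - len (N \<omega> \<inter> {x. (\<omega>, x) \<in> A})"
        using emeasure_Diff[of len_measure "N \<omega> \<inter> {x. (\<omega>, x) \<in> A}" "N \<omega>"] True sec[OF \<omega> compl.hyps]
          borel_compact[OF compact_route[OF N \<omega>]] len_mono[of "N \<omega> \<inter> {x. (\<omega>, x) \<in> A}" "N \<omega>"]
        by (auto simp: emeasure_len_measure less_top top_unique)
      moreover have "N \<omega> - (N \<omega> \<inter> {x. (\<omega>, x) \<in> A}) = N \<omega> \<inter> {x. (\<omega>, x) \<in> ?O - A}" using \<omega> by auto
      ultimately show ?thesis using True by simp
    qed simp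
    then have "?f (?O - A) \<in> borel_measurable M \<longleftrightarrow>
      (\<lambda>\<omega>. if len (N \<omega>) < \<infinity> then len (N \<omega>) - ?f A \<omega> else 0) \<in> borel_measurable M"
      by (intro measurable_cong) 
    also have \<dots> using compl.IH by measurable
    finally show ?case .
  next
    case (union A)
    have "?f (\<Union>i. A i) \<omega> = (\<Sum>i. ?f (A i) \<omega>)" if \<omega>: "\<omega> \<in> space M" for \<omega>
    proof (cases "len (N \<omega>) < \<infinity>")
      case True
      have "(\<Sum>i. emeasure len_measure (N \<omega> \<inter> {x. (\<omega>, x) \<in> A i})) =
         emeasure len_measure (\<Union>i. N \<omega> \<inter> {x. (\<omega>, x) \<in> A i})"
        using union.hyps sec[OF \<omega>]
        by (intro suminf_emeasure) (auto simp: disjoint_family_on_def)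
      moreover have "(\<Union>i. N \<omega> \<inter> {x. (\<omega>, x) \<in> A i}) = N \<omega> \<inter> {x. (\<omega>, x) \<in> (\<Union>i. A i)}" by auto
      moreover have "N \<omega> \<inter> {x. (\<omega>, x) \<in> A i} \<in> sets borel" for i
        using union.hyps sec[OF \<omega>] by auto
      moreover from this have "(\<Union>i. N \<omega> \<inter> {x. (\<omega>, x) \<in> A i}) \<in> sets borel"
        by (intro sets.countable_UN) auto
      ultimately show ?thesis using True by (simp add: emeasure_len_measure)
    qed simp
    then have "?f (\<Union>i. A i) \<in> borel_measurable M \<longleftrightarrow> (\<lambda>\<omega>. \<Sum>i. ?f (A i) \<omega>) \<in> borel_measurable M"
      by (intro measurable_cong)
    also have \<dots> using union.IH by (intro borel_measurable_suminf_order) auto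
    finally show ?case .
  qed
qed

section \<open>The Poisson process in a window\<close>

subsection \<open>Tuples of distinct points\<close>

text \<open>
  Tuples of \<open>k\<close> points are extensional functions on \<open>{..<k}\<close>, to match the product measures.
\<close>

definition distinct_tuples :: "nat \<Rightarrow> (nat \<Rightarrow> complex) set" where
  "distinct_tuples k = {z \<in> {..<k} \<rightarrow>\<^sub>E UNIV. inj_on z {..<k}}"

text \<open>
  The square of side \<open>1 / n\<close> that contains \<open>z\<close>, given by its integer coordinates. Distinct points lie in
  distinct squares once the grid is fine enough.
\<close>

definition grid_cell :: "nat \<Rightarrow> complex \<Rightarrow> int \<times> int" where
  "grid_cell n z = (\<lfloor>real n * Re z\<rfloor>, \<lfloor>real n * Im z\<rfloor>)"

lemma sets_grid_cell: "grid_cell n -` {p} \<in> sets borel"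
proof -
  have "{z. \<lfloor>real n * Re z\<rfloor> = fst p \<and> \<lfloor>real n * Im z\<rfloor> = snd p} \<in> sets borel" by measurable
  then show ?thesis
    by (rule back_subst[of "\<lambda>A. A \<in> sets borel"]) (auto simp: grid_cell_def prod_eq_iff)
qed

lemma eventually_grid_cell_neq:
  assumes "u \<noteq> v"
  shows "eventually (\<lambda>n. grid_cell n u \<noteq> grid_cell n v) sequentially"
proof -
  have floors: "\<lfloor>real n * x\<rfloor> \<noteq> \<lfloor>real n * y\<rfloor>" if "1 \<le> real n * \<bar>x - y\<bar>" for n and x y :: real
  proof
    assume "\<lfloor>real n * x\<rfloor> = \<lfloor>real n * y\<rfloor>"
    then have "\<bar>real n * x - real n * y\<bar> < 1" by linarith
    also have "\<bar>real n * x - real n * y\<bar> = real n * \<bar>x - y\<bar>"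
      by (simp add: abs_mult right_diff_distrib[symmetric])
    finally show False using that by simp
  qed
  have ev: "eventually (\<lambda>n. \<lfloor>real n * x\<rfloor> \<noteq> \<lfloor>real n * y\<rfloor>) sequentially" if "x \<noteq> y" for x y :: real
    using eventually_ge_at_top[of "nat \<lceil>1 / \<bar>x - y\<bar>\<rceil>"]
  proof eventually_elim
    case (elim n)
    then have "1 / \<bar>x - y\<bar> \<le> real n" by linarith
    then have "1 \<le> real n * \<bar>x - y\<bar>" using that by (simp add: field_simps)
    then show ?case by (rule floors)
  qed
  from assms consider "Re u \<noteq> Re v" | "Im u \<noteq> Im v" by (auto simp: complex_eq_iff)
  then show ?thesis
    by cases (auto simp: grid_cell_def dest!: ev elim: eventually_mono)
qed

lemma distinct_tuples_cells:
  assumes "z \<in> distinct_tuples k"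
  obtains n c where "c \<in> {..<k} \<rightarrow>\<^sub>E UNIV" "inj_on c {..<k}" "\<And>a. a < k \<Longrightarrow> z a \<in> grid_cell n -` {c a}"
proof -
  have "\<forall>a\<in>{..<k}. \<forall>b\<in>{..<k}. a \<noteq> b \<longrightarrow> z a \<noteq> z b"
    using assms by (auto simp: distinct_tuples_def inj_on_def)
  then have "\<forall>a\<in>{..<k}. \<forall>b\<in>{..<k}. \<forall>\<^sub>F n in sequentially. a \<noteq> b \<longrightarrow> grid_cell n (z a) \<noteq> grid_cell n (z b)"
    by (auto intro: eventually_grid_cell_neq eventually_mono)
  then have "\<forall>\<^sub>F n in sequentially. \<forall>a\<in>{..<k}. \<forall>b\<in>{..<k}. a \<noteq> b \<longrightarrow> grid_cell n (z a) \<noteq> grid_cell n (z b)"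
    by (simp add: eventually_ball_finite_distrib)
  then obtain n where "\<forall>a\<in>{..<k}. \<forall>b\<in>{..<k}. a \<noteq> b \<longrightarrow> grid_cell n (z a) \<noteq> grid_cell n (z b)"
    using eventually_happens sequentially_bot by blast
  then show ?thesis
    by (intro that[of "\<lambda>a\<in>{..<k}. grid_cell n (z a)" n]) (auto simp: inj_on_def)
qed

text \<open>Products of disjoint sets form a \<open>\<pi>\<close>-system that generates the Borel sets of distinct tuples.\<close>

definition disjoint_boxes :: "nat \<Rightarrow> (nat \<Rightarrow> complex) set set" where
  "disjoint_boxes k =
     {Pi\<^sub>E {..<k} C | C. (\<forall>a<k. C a \<in> sets borel) \<and> disjoint_family_on C {..<k}}"

lemma disjoint_boxes_subset: "disjoint_boxes k \<subseteq> Pow (distinct_tuples k)"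
  unfolding disjoint_boxes_def distinct_tuples_def
  by (force simp: disjoint_family_on_def inj_on_def PiE_iff extensional_def)

lemma Int_stable_disjoint_boxes: "Int_stable (disjoint_boxes k)"
proof (rule Int_stableI)
  fix x y assume "x \<in> disjoint_boxes k" "y \<in> disjoint_boxes k"
  then obtain C D where x: "x = Pi\<^sub>E {..<k} C" "\<forall>a<k. C a \<in> sets borel" "disjoint_family_on C {..<k}"
    and y: "y = Pi\<^sub>E {..<k} D" "\<forall>a<k. D a \<in> sets borel"
    unfolding disjoint_boxes_def by blast
  have "x \<inter> y = Pi\<^sub>E {..<k} (\<lambda>a. C a \<inter> D a)" unfolding x y by (rule PiE_Int)
  moreover have "disjoint_family_on (\<lambda>a. C a \<inter> D a) {..<k}"
    using x(3) by (auto simp: disjoint_family_on_def)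
  ultimately show "x \<inter> y \<in> disjoint_boxes k"
    using x(2) y(2) unfolding disjoint_boxes_def
    by (intro CollectI exI[of _ "\<lambda>a. C a \<inter> D a"]) auto
qed

text \<open>
  Countably many products of disjoint sets that cover the distinct tuples.
\<close>

definition grid_boxes :: "nat \<Rightarrow> (nat \<Rightarrow> complex) set set" where
  "grid_boxes k = (\<lambda>(n, c). \<Pi>\<^sub>E a\<in>{..<k}. grid_cell n -` {c a}) `
     (UNIV \<times> {c \<in> {..<k} \<rightarrow>\<^sub>E UNIV. inj_on c {..<k}})"

lemma countable_grid_boxes: "countable (grid_boxes k)"
proof -
  have "countable (({..<k} \<rightarrow>\<^sub>E UNIV) :: (nat \<Rightarrow> int \<times> int) set)"
    by (intro countable_PiE) auto
  then have "countable {c \<in> {..<k} \<rightarrow>\<^sub>E (UNIV :: (int \<times> int) set). inj_on c {..<k}}"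
    by (rule countable_subset[rotated]) auto
  then show ?thesis unfolding grid_boxes_def by (intro countable_image countable_SIGMA) auto
qed

lemma grid_boxes_subset: "grid_boxes k \<subseteq> disjoint_boxes k"
proof
  fix G assume "G \<in> grid_boxes k"
  then obtain n c where G: "G = (\<Pi>\<^sub>E a\<in>{..<k}. grid_cell n -` {c a})" and c: "inj_on c {..<k}"
    unfolding grid_boxes_def by auto
  have "disjoint_family_on (\<lambda>a. grid_cell n -` {c a}) {..<k}"
    using c by (auto simp: disjoint_family_on_def inj_on_def)
  then show "G \<in> disjoint_boxes k"
    unfolding disjoint_boxes_def G by (blast intro: sets_grid_cell)
qed

lemma Union_grid_boxes: "\<Union>(grid_boxes k) = distinct_tuples k"
proof
  show "\<Union>(grid_boxes k) \<subseteq> distinct_tuples k"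
    using grid_boxes_subset disjoint_boxes_subset by blast
  show "distinct_tuples k \<subseteq> \<Union>(grid_boxes k)"
  proof
    fix z assume z: "z \<in> distinct_tuples k"
    then obtain c n where c: "c \<in> {..<k} \<rightarrow>\<^sub>E UNIV" "inj_on c {..<k}"
      "\<And>a. a < k \<Longrightarrow> z a \<in> grid_cell n -` {c a}"
      using distinct_tuples_cells[OF z] by metis
    have "z \<in> (\<Pi>\<^sub>E a\<in>{..<k}. grid_cell n -` {c a})"
      using z c(3) by (auto simp: distinct_tuples_def PiE_iff)
    then show "z \<in> \<Union>(grid_boxes k)"
      unfolding grid_boxes_def using c(1,2) by blast
  qed
qed

lemma sigma_sets_disjoint_boxes_Int:
  assumes "A \<in> sets (\<Pi>\<^sub>M i\<in>{..<k}. borel)"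
  shows "distinct_tuples k \<inter> A \<in> sigma_sets (distinct_tuples k) (disjoint_boxes k)"
proof -
  let ?\<Omega> = "distinct_tuples k" and ?P = "\<Pi>\<^sub>M i\<in>{..<k}. (borel :: complex measure)"
  have "A \<in> sigma_sets (space ?P) {\<Pi>\<^sub>E i\<in>{..<k}. X i | X. X \<in> (\<Pi> j\<in>{..<k}. sets borel)}"
    using assms by (simp add: sets_PiM prod_algebra_eq_finite space_PiM)
  then show ?thesis
  proof induction
    case (Basic A)
    then obtain Y where A: "A = Pi\<^sub>E {..<k} Y" and Y: "\<And>a. a < k \<Longrightarrow> Y a \<in> sets borel" by auto
    have "?\<Omega> \<inter> A = \<Union>((\<lambda>G. G \<inter> A) ` grid_boxes k)"
      using Union_grid_boxes by auto
    also have "\<dots> \<in> sigma_sets ?\<Omega> (disjoint_boxes k)"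
    proof (rule sigma_sets_UNION)
      show "countable ((\<lambda>G. G \<inter> A) ` grid_boxes k)" by (intro countable_image countable_grid_boxes)
      fix b assume "b \<in> (\<lambda>G. G \<inter> A) ` grid_boxes k"
      then obtain G where G: "G \<in> disjoint_boxes k" "b = G \<inter> A" using grid_boxes_subset by auto
      then obtain C where C: "G = Pi\<^sub>E {..<k} C" "\<forall>a<k. C a \<in> sets borel" "disjoint_family_on C {..<k}"
        unfolding disjoint_boxes_def by blast
      have "b = Pi\<^sub>E {..<k} (\<lambda>a. C a \<inter> Y a)" unfolding G C A by (rule PiE_Int)
      moreover have "disjoint_family_on (\<lambda>a. C a \<inter> Y a) {..<k}"
        using C(3) by (auto simp: disjoint_family_on_def)
      ultimately have "b \<in> disjoint_boxes k"
        unfolding disjoint_boxes_def using C(2) Y by (intro CollectI exI[of _ "\<lambda>a. C a \<inter> Y a"]) auto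
      then show "b \<in> sigma_sets ?\<Omega> (disjoint_boxes k)" by (rule sigma_sets.Basic)
    qed
    finally show ?case .
  next
    case Empty
    then show ?case by (simp add: sigma_sets.Empty)
  next
    case (Compl A)
    have "?\<Omega> \<inter> (space ?P - A) = ?\<Omega> - (?\<Omega> \<inter> A)" by (auto simp: distinct_tuples_def space_PiM)
    then show ?case using sigma_sets.Compl[OF Compl.IH] by simp
  next
    case (Union A)
    have "?\<Omega> \<inter> (\<Union>i. A i) = (\<Union>i. ?\<Omega> \<inter> A i)" by auto
    then show ?case using sigma_sets.Union[of "\<lambda>i. ?\<Omega> \<inter> A i"] Union.IH by simp
  qed
qed

lemma sets_disjoint_box:
  assumes "x \<in> disjoint_boxes k"
  shows "x \<in> sets (\<Pi>\<^sub>M i\<in>{..<k}. borel)"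
  using assms by (auto simp: disjoint_boxes_def intro!: sets_PiM_I_finite)

lemma sets_distinct_tuples [measurable]: "distinct_tuples k \<in> sets (\<Pi>\<^sub>M i\<in>{..<k}. borel)"
proof -
  have "\<Union>(grid_boxes k) \<in> sets (\<Pi>\<^sub>M i\<in>{..<k}. borel)"
    using grid_boxes_subset by (intro sets.countable_Union countable_grid_boxes) (auto intro: sets_disjoint_box)
  then show ?thesis by (simp add: Union_grid_boxes)
qed

lemma sets_restrict_distinct_tuples:
  assumes "sets N = sets (\<Pi>\<^sub>M i\<in>{..<k}. (borel :: complex measure))"
  shows "sets (restrict_space N (distinct_tuples k)) = sigma_sets (distinct_tuples k) (disjoint_boxes k)"
proof
  have "distinct_tuples k \<in> sets N" by (simp add: assms)
  then have sp: "space (restrict_space N (distinct_tuples k)) = distinct_tuples k"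
    using sets.sets_into_space by (auto simp: space_restrict_space)
  show "sets (restrict_space N (distinct_tuples k)) \<subseteq> sigma_sets (distinct_tuples k) (disjoint_boxes k)"
    by (auto simp: sets_restrict_space assms intro: sigma_sets_disjoint_boxes_Int)
  have "disjoint_boxes k \<subseteq> sets (restrict_space N (distinct_tuples k))"
  proof
    fix x assume x: "x \<in> disjoint_boxes k"
    then have "x = distinct_tuples k \<inter> x" "x \<in> sets N"
      using disjoint_boxes_subset by (auto simp: assms intro: sets_disjoint_box)
    then show "x \<in> sets (restrict_space N (distinct_tuples k))"
      unfolding sets_restrict_space by (metis imageI)
  qed
  then show "sigma_sets (distinct_tuples k) (disjoint_boxes k) \<subseteq> sets (restrict_space N (distinct_tuples k))"
    using sets.sigma_sets_subset[of "disjoint_boxes k" "restrict_space N (distinct_tuples k)"] by (simp add: sp)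
qed


subsection \<open>Enumerations of the points in a window\<close>

text \<open>
  The indices of the points that have arrived in \<open>B\<close> by time \<open>t\<close>.
\<close>

definition window :: "(nat \<Rightarrow> 'w \<Rightarrow> complex \<times> real) \<Rightarrow> complex set \<Rightarrow> real \<Rightarrow> 'w \<Rightarrow> nat set" where
  "window X B t \<omega> = {i. fst (X i \<omega>) \<in> B \<and> snd (X i \<omega>) \<le> t}"

text \<open>
  The positions of the first \<open>k\<close> points listed in \<open>is\<close>.
\<close>

definition positions :: "(nat \<Rightarrow> 'w \<Rightarrow> complex \<times> real) \<Rightarrow> nat \<Rightarrow> nat list \<Rightarrow> 'w \<Rightarrow> nat \<Rightarrow> complex" where
  "positions X k is \<omega> = (\<lambda>a\<in>{..<k}. fst (X (is ! a) \<omega>))"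

text \<open>
  \<open>is\<close> lists the points of the window without repetition, and \<open>S\<close> is the set of places at which it
  lists a point that has arrived by the earlier time \<open>s\<close>.
\<close>

definition enumerates ::
    "(nat \<Rightarrow> 'w \<Rightarrow> complex \<times> real) \<Rightarrow> complex set \<Rightarrow> real \<Rightarrow> real \<Rightarrow> nat \<Rightarrow> nat set \<Rightarrow> nat list \<Rightarrow> 'w \<Rightarrow> bool" where
  "enumerates X B t s k S is \<omega> \<longleftrightarrow>
     length is = k \<and> distinct is \<and> set is = window X B t \<omega> \<and>
     (\<forall>a<k. a \<in> S \<longleftrightarrow> snd (X (is ! a) \<omega>) \<le> s)"

lemma poisson_points_measurable: "poisson_points M X \<Longrightarrow> X i \<in> borel_measurable M"
  by (simp add: poisson_points_def)

lemma measurable_fst_X: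
  fixes X :: "nat \<Rightarrow> 'w \<Rightarrow> complex \<times> real"
  assumes "\<And>i. X i \<in> borel_measurable M"
  shows "(\<lambda>\<omega>. fst (X i \<omega>)) \<in> borel_measurable M" "(\<lambda>\<omega>. snd (X i \<omega>)) \<in> borel_measurable M"
  using measurable_compose[OF assms, of fst borel i] measurable_compose[OF assms, of snd borel i]
  by (auto simp: borel_prod[symmetric])

lemma pred_window:
  assumes "\<And>i. X i \<in> borel_measurable M" "B \<in> sets borel"
  shows "Measurable.pred M (\<lambda>\<omega>. i \<in> window X B t \<omega>)"
proof -
  note [measurable] = measurable_fst_X[OF assms(1)] assms(2)
  show ?thesis unfolding window_def by measurable
qed

lemma pred_enumerates:
  assumes "\<And>i. X i \<in> borel_measurable M" "B \<in> sets borel"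
  shows "Measurable.pred M (enumerates X B t s k S is)"
proof -
  note [measurable] = measurable_fst_X[OF assms(1)] pred_window[OF assms]
  show ?thesis unfolding enumerates_def set_eq_iff by measurable
qed

lemma measurable_positions:
  assumes "\<And>i. X i \<in> borel_measurable M"
  shows "positions X k is \<in> M \<rightarrow>\<^sub>M (\<Pi>\<^sub>M i\<in>{..<k}. borel)"
proof -
  note [measurable] = measurable_fst_X[OF assms(1)]
  show ?thesis unfolding positions_def by measurable
qed

lemma window_finite:
  assumes X: "poisson_points M X" and B: "B \<in> sets borel" "emeasure lborel B < \<infinity>"
  shows "AE \<omega> in M. finite (window X B t \<omega>)"
proof -
  have "emeasure lborel (B \<times> {0..t}) = emeasure lborel B * emeasure lborel {0..t}"
    using B(1) by (simp add: lborel_prod[symmetric] lborel.emeasure_pair_measure_Times)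
  also have "\<dots> < \<infinity>"
    using B(2) by (simp only: emeasure_lborel_Icc_eq) (simp add: ennreal_mult_less_top)
  finally have "B \<times> {0..t} \<in> {B \<in> sets borel. B \<subseteq> UNIV \<times> {0..} \<and> emeasure lborel B < \<infinity>}"
    using B(1) by (auto simp: borel_prod[symmetric])
  then have "AE \<omega> in M. finite {i. X i \<omega> \<in> B \<times> {0..t}}"
    using X unfolding poisson_points_def Let_def by blast
  moreover have "AE \<omega> in M. \<forall>i. 0 \<le> snd (X i \<omega>)"
    using X by (auto simp: poisson_points_def)
  ultimately show ?thesis
  proof eventually_elim
    case (elim \<omega>)
    have "{i. X i \<omega> \<in> B \<times> {0..t}} = window X B t \<omega>"
      using elim(2) by (auto simp: window_def mem_Times_iff)
    then show ?case using elim(1) by simp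
  qed
qed

text \<open>
  The probability that a region \<open>W\<close> of space-time contains exactly \<open>k\<close> points, one in each of \<open>k\<close>
  disjoint subsets, is a product by independence.
\<close>

lemma prob_one_in_each:
  fixes D :: "nat \<Rightarrow> (complex \<times> real) set"
  assumes M: "prob_space M" and X: "poisson_points M X"
    and W: "W \<in> sets borel" "W \<subseteq> UNIV \<times> {0..}" "emeasure lborel W < \<infinity>"
    and D: "\<And>a. a < k \<Longrightarrow> D a \<in> sets borel" "\<And>a. a < k \<Longrightarrow> D a \<subseteq> W" "disjoint_family_on D {..<k}"
  shows "measure M {\<omega>\<in>space M. (\<forall>a<k. card {i. X i \<omega> \<in> D a} = 1) \<and>
           card {i. X i \<omega> \<in> W - (\<Union>a<k. D a)} = 0} =
         (\<Prod>a<k. measure lborel (D a)) * exp (- measure lborel W)"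
proof (cases "\<exists>a<k. D a = {}")
  case True
  then obtain a where a: "a < k" "D a = {}" by blast
  have "(\<Prod>a<k. measure lborel (D a)) = 0" using a by (intro prod_zero bexI[of _ a]) auto
  moreover have "{\<omega>\<in>space M. (\<forall>a<k. card {i. X i \<omega> \<in> D a} = 1) \<and>
           card {i. X i \<omega> \<in> W - (\<Union>a<k. D a)} = 0} = {}"
    using a by force
  ultimately show ?thesis by (simp only: measure_empty mult_zero_left)
next
  case False
  interpret prob_space M by (rule M)
  let ?F = "{B \<in> sets borel. B \<subseteq> UNIV \<times> {0..} \<and> emeasure lborel B < \<infinity>} :: (complex \<times> real) set set"
  let ?N = "\<lambda>B \<omega>. card {i. X i \<omega> \<in> B}"
  define D0 where "D0 = W - (\<Union>a<k. D a)"
  let ?\<B> = "insert D0 (D ` {..<k})"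
  have inj: "inj_on D {..<k}"
    using D(3) False by (fastforce simp: inj_on_def disjoint_family_on_def)
  have D0: "D0 \<notin> D ` {..<k}" using False by (auto simp: D0_def)
  have small: "emeasure lborel C < \<infinity>" if "C \<subseteq> W" "C \<in> sets borel" for C
    using emeasure_mono[of C W lborel] that W by (auto simp: less_top[symmetric] top_unique)
  have UN: "(\<Union>a<k. D a) \<in> sets borel" using D(1) by (intro sets.finite_UN) auto
  then have D0s: "D0 \<in> sets borel" using W(1) by (simp add: D0_def)
  have F: "D0 \<in> ?F" "\<And>a. a < k \<Longrightarrow> D a \<in> ?F"
    using D W small D0s by (auto simp: D0_def)
  have disj: "disjoint ?\<B>"
  proof (rule disjointI)
    fix A B assume AB: "A \<in> ?\<B>" "B \<in> ?\<B>" "A \<noteq> B"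
    have "D a \<inter> D b = {}" if "a < k" "b < k" "D a \<noteq> D b" for a b
    proof -
      have "a \<noteq> b" using that(3) by auto
      then show ?thesis using D(3) that(1,2) by (auto simp: disjoint_family_on_def)
    qed
    then show "A \<inter> B = {}" using AB by (auto simp: D0_def)
  qed
  have poi: "measure M {\<omega>\<in>space M. ?N B \<omega> = n} = measure lborel B ^ n / fact n * exp (- measure lborel B)"
    if "B \<in> ?F" for B n
    using X that unfolding poisson_points_def Let_def by auto
  have "indep_vars (\<lambda>_. count_space UNIV) ?N ?\<B>"
    using X F disj unfolding poisson_points_def Let_def by (auto simp: image_subset_iff)
  then have "prob (\<Inter>B\<in>?\<B>. ?N B -` {if B = D0 then 0 else 1} \<inter> space M) =
      (\<Prod>B\<in>?\<B>. prob (?N B -` {if B = D0 then 0 else 1} \<inter> space M))"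
    by (rule indep_varsD) auto
  also have "(\<Inter>B\<in>?\<B>. ?N B -` {if B = D0 then 0 else 1} \<inter> space M) =
      {\<omega>\<in>space M. (\<forall>a<k. card {i. X i \<omega> \<in> D a} = 1) \<and> card {i. X i \<omega> \<in> W - (\<Union>a<k. D a)} = 0}"
    using D0 by (auto simp: D0_def[symmetric] split: if_splits)
  also have "(\<Prod>B\<in>?\<B>. prob (?N B -` {if B = D0 then 0 else 1} \<inter> space M)) =
      prob {\<omega>\<in>space M. ?N D0 \<omega> = 0} * (\<Prod>a<k. prob {\<omega>\<in>space M. ?N (D a) \<omega> = 1})"
  proof -
    have ne: "D a \<noteq> D0" if "a < k" for a using D0 that by auto
    have "(\<Prod>B\<in>D ` {..<k}. prob (?N B -` {if B = D0 then 0 else 1} \<inter> space M)) =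
       (\<Prod>a<k. prob (?N (D a) -` {if D a = D0 then 0 else 1} \<inter> space M))"
      by (rule prod.reindex_cong[OF inj]) auto
    also have "\<dots> = (\<Prod>a<k. prob {\<omega>\<in>space M. ?N (D a) \<omega> = 1})"
      using ne by (intro prod.cong refl arg_cong[of _ _ prob]) auto
    finally show ?thesis
      using D0 by (subst prod.insert) (auto intro!: arg_cong2[of _ _ _ _ "(*)"] arg_cong[of _ _ prob])
  qed
  also have "\<dots> = exp (- measure lborel D0) * (\<Prod>a<k. measure lborel (D a) * exp (- measure lborel (D a)))"
    using poi[OF F(1), of 0] poi[OF F(2), of _ 1] by simp
  also have "\<dots> = (\<Prod>a<k. measure lborel (D a)) * exp (- (measure lborel D0 + (\<Sum>a<k. measure lborel (D a))))"
  proof -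
    have "exp (- (measure lborel D0 + (\<Sum>a<k. measure lborel (D a)))) =
        exp (- measure lborel D0) * (\<Prod>a<k. exp (- measure lborel (D a)))"
      by (simp add: exp_sum[symmetric] sum_negf exp_add[symmetric])
    then show ?thesis by (simp add: prod.distrib)
  qed
  also have "measure lborel D0 + (\<Sum>a<k. measure lborel (D a)) = measure lborel W"
  proof -
    have fin: "emeasure lborel (D a) \<noteq> \<infinity>" if "a < k" for a using F(2)[OF that] by auto
    have "(\<Sum>a<k. measure lborel (D a)) = measure lborel (\<Union>a<k. D a)"
      using D(1,3) fin by (intro measure_finite_Union[symmetric]) auto
    moreover have "measure lborel D0 = measure lborel W - measure lborel (\<Union>a<k. D a)"
      unfolding D0_def using W UN D(2) by (intro measure_Diff) auto
    ultimately show ?thesis by simp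
  qed
  finally show ?thesis .
qed


text \<open>
  Summed over all lists, the probability that the list enumerates the window, with marks \<open>S\<close> and with
  the listed positions in given disjoint sets.
\<close>

lemma janossy_box:
  assumes M: "prob_space M" and X: "poisson_points M X"
    and B: "B \<in> sets borel" "emeasure lborel B < \<infinity>" and st: "0 \<le> s" "s \<le> t" and S: "S \<subseteq> {..<k}"
    and C: "\<And>a. a < k \<Longrightarrow> C a \<in> sets borel" "\<And>a. a < k \<Longrightarrow> C a \<subseteq> B" "disjoint_family_on C {..<k}"
  shows "(\<integral>\<^sup>+is. emeasure M {\<omega>\<in>space M. enumerates X B t s k S is \<omega> \<and> positions X k is \<omega> \<in> Pi\<^sub>E {..<k} C}
            \<partial>count_space UNIV) =
         ennreal (s ^ card S * (t - s) ^ (k - card S) * exp (- t * measure lborel B)) *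
           (\<Prod>a<k. emeasure lborel (C a))"
proof -
  interpret prob_space M by (rule M)
  define T where "T a = (if a \<in> S then {0..s} else {s<..t})" for a
  define D where "D a = C a \<times> T a" for a
  define W where "W = B \<times> {0..t}"
  have snd: "0 \<le> snd (X i \<omega>)" if "\<omega> \<in> space M" for i \<omega>
    using X that by (auto simp: poisson_points_def)
  have Ts: "T a \<in> sets borel" "T a \<subseteq> {0..t}" for a using st by (auto simp: T_def)
  have W: "W \<in> sets borel" "W \<subseteq> UNIV \<times> {0..}" using B(1) by (auto simp: W_def borel_prod[symmetric])
  have times: "emeasure lborel (A \<times> T') = emeasure lborel A * emeasure lborel T'"
    if "A \<in> sets borel" "T' \<in> sets borel" for A :: "complex set" and T' :: "real set"
    using that by (simp add: lborel_prod[symmetric] lborel.emeasure_pair_measure_Times)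
  have "emeasure lborel W = emeasure lborel B * ennreal t"
    unfolding W_def using B(1) st by (subst times) auto
  also have "\<dots> < \<infinity>" using B(2) by (simp add: ennreal_mult_less_top)
  finally have Wfin: "emeasure lborel W < \<infinity>" .
  have Wm: "measure lborel W = t * measure lborel B"
    unfolding W_def measure_def using B(1) st by (subst times) (auto simp: enn2real_mult)
  have Ds: "D a \<in> sets borel" "D a \<subseteq> W" if "a < k" for a
    using C(1,2)[OF that] Ts by (auto simp: D_def W_def borel_prod[symmetric])
  have Dd: "disjoint_family_on D {..<k}"
    using C(3) by (auto simp: disjoint_family_on_def D_def)
  define D0 where "D0 = W - (\<Union>a<k. D a)"
  \<comment> \<open>If the list enumerates the window with the \<open>a\<close>-th point in \<open>D a\<close>, then each \<open>D a\<close> contains exactly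
    its listed point and the rest of the window is empty; so at most one list qualifies.\<close>
  define Q where "Q \<omega> is \<longleftrightarrow> length is = k \<and> (\<forall>a<k. {i. X i \<omega> \<in> D a} = {is ! a}) \<and> {i. X i \<omega> \<in> D0} = {}" for \<omega> "is"
  have en_Q: "enumerates X B t s k S is \<omega> \<and> positions X k is \<omega> \<in> Pi\<^sub>E {..<k} C \<longleftrightarrow> Q \<omega> is"
    if \<omega>: "\<omega> \<in> space M" for \<omega> "is"
  proof
    assume asm: "enumerates X B t s k S is \<omega> \<and> positions X k is \<omega> \<in> Pi\<^sub>E {..<k} C"
    then have e: "length is = k" "distinct is" "set is = window X B t \<omega>"
      "\<And>a. a < k \<Longrightarrow> a \<in> S \<longleftrightarrow> snd (X (is ! a) \<omega>) \<le> s"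
      and p: "\<And>a. a < k \<Longrightarrow> fst (X (is ! a) \<omega>) \<in> C a"
      by (auto simp: enumerates_def positions_def PiE_iff)
    have inD: "X (is ! a) \<omega> \<in> D a" if "a < k" for a
    proof -
      have "is ! a \<in> window X B t \<omega>" using e(1,3) that nth_mem by blast
      then show ?thesis
        using e(4)[OF that] p[OF that] snd[OF \<omega>]
        by (auto simp: D_def T_def window_def mem_Times_iff not_le)
    qed
    have list: "\<exists>a<k. i = is ! a" if "X i \<omega> \<in> W" for i
    proof -
      have "i \<in> set is" using that e(3) by (auto simp: W_def window_def mem_Times_iff)
      then show ?thesis using e(1) by (auto simp: in_set_conv_nth)
    qed
    have "{i. X i \<omega> \<in> D a} = {is ! a}" if a: "a < k" for a
    proof -
      have "i = is ! a" if i: "X i \<omega> \<in> D a" for i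
      proof -
        obtain b where b: "b < k" "i = is ! b" using list Ds(2)[OF a] i by blast
        then have "X i \<omega> \<in> D b" using inD by simp
        then have "a = b" using Dd a b(1) i by (auto simp: disjoint_family_on_def)
        then show ?thesis using b by simp
      qed
      then show ?thesis using inD[OF a] by blast
    qed
    moreover have "{i. X i \<omega> \<in> D0} = {}" using list inD by (auto simp: D0_def)
    ultimately show "Q \<omega> is" using e(1) by (simp add: Q_def)
  next
    assume Q: "Q \<omega> is"
    then have len: "length is = k" and D: "\<And>a. a < k \<Longrightarrow> {i. X i \<omega> \<in> D a} = {is ! a}"
      and D0: "{i. X i \<omega> \<in> D0} = {}" by (auto simp: Q_def)
    have inD: "X (is ! a) \<omega> \<in> D a" if "a < k" for a using D[OF that] by blast
    have "distinct is"
      unfolding distinct_conv_nth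
    proof (intro allI impI)
      fix a b assume "a < length is" "b < length is" "a \<noteq> b"
      moreover from this have "D a \<inter> D b = {}" using Dd len by (auto simp: disjoint_family_on_def)
      ultimately show "is ! a \<noteq> is ! b" using inD[of a] inD[of b] len by auto
    qed
    moreover have "set is = window X B t \<omega>"
    proof
      show "set is \<subseteq> window X B t \<omega>"
      proof
        fix i assume "i \<in> set is"
        then obtain a where "a < k" "i = is ! a" using len by (auto simp: in_set_conv_nth)
        then have "X i \<omega> \<in> W" using inD Ds(2) by blast
        then show "i \<in> window X B t \<omega>" by (auto simp: W_def window_def mem_Times_iff)
      qed
      show "window X B t \<omega> \<subseteq> set is"
      proof
        fix i assume "i \<in> window X B t \<omega>"
        then have "X i \<omega> \<in> W" using snd[OF \<omega>] by (auto simp: W_def window_def mem_Times_iff)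
        then obtain a where "a < k" "X i \<omega> \<in> D a" using D0 by (auto simp: D0_def)
        then have "i = is ! a" using D by blast
        then show "i \<in> set is" using \<open>a < k\<close> len by simp
      qed
    qed
    moreover have "a \<in> S \<longleftrightarrow> snd (X (is ! a) \<omega>) \<le> s" if "a < k" for a
      using inD[OF that] by (auto simp: D_def T_def mem_Times_iff split: if_splits)
    moreover have "positions X k is \<omega> \<in> Pi\<^sub>E {..<k} C"
      using inD by (auto simp: positions_def D_def mem_Times_iff)
    ultimately show "enumerates X B t s k S is \<omega> \<and> positions X k is \<omega> \<in> Pi\<^sub>E {..<k} C"
      using len by (simp add: enumerates_def)
  qed
  define G where "G = {\<omega>\<in>space M. (\<forall>a<k. card {i. X i \<omega> \<in> D a} = 1) \<and> card {i. X i \<omega> \<in> D0} = 0}"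
  have AE_card: "AE \<omega> in M. (\<integral>\<^sup>+is. indicator {is. Q \<omega> is} is \<partial>count_space UNIV) = (indicator G \<omega> :: ennreal)"
    using AE_space window_finite[OF X B, of t]
  proof (eventually_elim, goal_cases)
    case (1 \<omega>)
    show ?case
    proof (cases "\<omega> \<in> G")
      case True
      then have G: "\<And>a. a < k \<Longrightarrow> card {i. X i \<omega> \<in> D a} = 1" "card {i. X i \<omega> \<in> D0} = 0" "\<omega> \<in> space M"
        by (auto simp: G_def)
      have "{i. X i \<omega> \<in> D0} \<subseteq> window X B t \<omega>"
        by (auto simp: D0_def W_def window_def mem_Times_iff)
      then have "finite {i. X i \<omega> \<in> D0}" using 1(2) by (rule finite_subset)
      then have D0: "{i. X i \<omega> \<in> D0} = {}" using G(2) by simp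
      have "\<exists>i. {j. X j \<omega> \<in> D a} = {i}" if "a < k" for a
        using G(1)[OF that] by (auto simp: card_1_singleton_iff)
      then obtain f where f: "\<And>a. a < k \<Longrightarrow> {i. X i \<omega> \<in> D a} = {f a}" by metis
      have "{is. Q \<omega> is} = {map f [0..<k]}"
      proof (intro set_eqI iffI)
        fix js assume "js \<in> {is. Q \<omega> is}"
        then have "length js = k" "\<And>a. a < k \<Longrightarrow> js ! a = f a" using f by (auto simp: Q_def)
        then show "js \<in> {map f [0..<k]}" by (auto intro: nth_equalityI)
      qed (use f D0 in \<open>auto simp: Q_def\<close>)
      then show ?thesis using True by simp
    next
      case False
      have "\<not> Q \<omega> is" for "is"
        using False 1(1) by (auto simp: Q_def G_def card_1_singleton_iff)
      then show ?thesis using False by simp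
    qed
  qed
  have meas: "{\<omega>\<in>space M. enumerates X B t s k S is \<omega> \<and> positions X k is \<omega> \<in> Pi\<^sub>E {..<k} C} \<in> sets M" for "is"
  proof -
    have "Pi\<^sub>E {..<k} C \<in> sets (\<Pi>\<^sub>M i\<in>{..<k}. borel)" using C(1) by (intro sets_PiM_I_finite) auto
    note [measurable] = this pred_enumerates[OF poisson_points_measurable[OF X] B(1)]
      measurable_positions[OF poisson_points_measurable[OF X]]
    show ?thesis by measurable
  qed
  have "(\<integral>\<^sup>+is. emeasure M {\<omega>\<in>space M. enumerates X B t s k S is \<omega> \<and> positions X k is \<omega> \<in> Pi\<^sub>E {..<k} C}
            \<partial>count_space UNIV) =
     (\<integral>\<^sup>+is. (\<integral>\<^sup>+\<omega>. indicator {\<omega>\<in>space M. enumerates X B t s k S is \<omega> \<and> positions X k is \<omega> \<in> Pi\<^sub>E {..<k} C} \<omega> \<partial>M)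
            \<partial>count_space UNIV)"
    using meas by simp
  also have "\<dots> = (\<integral>\<^sup>+\<omega>. (\<integral>\<^sup>+is. indicator {\<omega>\<in>space M. enumerates X B t s k S is \<omega> \<and> positions X k is \<omega> \<in> Pi\<^sub>E {..<k} C} \<omega>
            \<partial>count_space UNIV) \<partial>M)"
    using meas by (intro nn_integral_count_space_nn_integral[symmetric]) auto
  also have "\<dots> = (\<integral>\<^sup>+\<omega>. (\<integral>\<^sup>+is. indicator {is. Q \<omega> is} is \<partial>count_space UNIV) \<partial>M)"
    using en_Q by (intro nn_integral_cong) (auto simp: indicator_def)
  also have "\<dots> = (\<integral>\<^sup>+\<omega>. indicator G \<omega> \<partial>M)"
    by (intro nn_integral_cong_AE AE_card)
  also have "\<dots> = emeasure M G"
  proof (rule nn_integral_indicator)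
    have pred: "Measurable.pred M (\<lambda>\<omega>. X i \<omega> \<in> A)" if "A \<in> sets borel" for A i
      using measurable_sets[OF poisson_points_measurable[OF X] that]
      by (simp add: pred_def vimage_def Int_def conj_commute)
    have c1: "card A = 1 \<longleftrightarrow> (\<exists>i. i \<in> A \<and> (\<forall>j. j \<in> A \<longrightarrow> j = i))" for A :: "nat set"
      by (auto simp: card_1_singleton_iff)
    have c0: "card A = 0 \<longleftrightarrow> (\<forall>i. i \<notin> A) \<or> (\<forall>m. \<exists>n>m. n \<in> A)" for A :: "nat set"
      by (auto simp: card_eq_0_iff infinite_nat_iff_unbounded)
    have [measurable]: "Measurable.pred M (\<lambda>\<omega>. card {i. X i \<omega> \<in> A} = 1)"
      "Measurable.pred M (\<lambda>\<omega>. card {i. X i \<omega> \<in> A} = 0)" if "A \<in> sets borel" for A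
      using pred[OF that, measurable] unfolding c1 c0 mem_Collect_eq by measurable
    have "(\<Union>a<k. D a) \<in> sets borel" using Ds(1) by (intro sets.finite_UN) auto
    then have [measurable]: "D0 \<in> sets borel" using W(1) by (simp add: D0_def)
    have "{\<omega>\<in>space M. \<forall>a\<in>{..<k}. card {i. X i \<omega> \<in> D a} = 1} \<in> sets M"
    proof (rule sets.sets_Collect_finite_All)
      fix a assume "a \<in> {..<k}"
      then have [measurable]: "D a \<in> sets borel" using Ds(1) by simp
      show "{\<omega>\<in>space M. card {i. X i \<omega> \<in> D a} = 1} \<in> sets M" by measurable
    qed simp
    moreover have "{\<omega>\<in>space M. card {i. X i \<omega> \<in> D0} = 0} \<in> sets M" by measurable
    moreover have "G = {\<omega>\<in>space M. \<forall>a\<in>{..<k}. card {i. X i \<omega> \<in> D a} = 1} \<inter> {\<omega>\<in>space M. card {i. X i \<omega> \<in> D0} = 0}"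
      by (auto simp: G_def)
    ultimately show "G \<in> sets M" by simp
  qed
  also have "\<dots> = ennreal ((\<Prod>a<k. measure lborel (D a)) * exp (- measure lborel W))"
    unfolding G_def D0_def emeasure_eq_measure
    by (subst prob_one_in_each[OF M X W Wfin Ds Dd]) auto
  also have "(\<Prod>a<k. measure lborel (D a)) = (\<Prod>a<k. measure lborel (C a)) * (s ^ card S * (t - s) ^ (k - card S))"
  proof -
    have "measure lborel (D a) = measure lborel (C a) * (if a \<in> S then s else t - s)" if "a < k" for a
      unfolding D_def measure_def using C(1)[OF that] Ts st
      by (subst times) (auto simp: enn2real_mult T_def)
    then have "(\<Prod>a<k. measure lborel (D a)) = (\<Prod>a<k. measure lborel (C a)) * (\<Prod>a<k. if a \<in> S then s else t - s)"
      by (simp add: prod.distrib)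
    also have "(\<Prod>a<k. if a \<in> S then s else t - s) = s ^ card ({..<k} \<inter> S) * (t - s) ^ card ({..<k} \<inter> - S)"
      by (subst prod.If_cases) auto
    also have "{..<k} \<inter> S = S" using S by auto
    also have "card ({..<k} \<inter> - S) = k - card S"
      using S finite_subset[OF S] by (simp add: Diff_eq[symmetric] card_Diff_subset)
    finally show ?thesis .
  qed
  also have "ennreal ((\<Prod>a<k. measure lborel (C a)) * (s ^ card S * (t - s) ^ (k - card S)) * exp (- measure lborel W)) =
    ennreal (s ^ card S * (t - s) ^ (k - card S) * exp (- t * measure lborel B)) * ennreal (\<Prod>a<k. measure lborel (C a))"
    using st by (subst ennreal_mult[symmetric]) (auto simp: Wm prod_nonneg mult_ac)
  also have "ennreal (\<Prod>a<k. measure lborel (C a)) = (\<Prod>a<k. emeasure lborel (C a))"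
  proof -
    have "emeasure lborel (C a) \<noteq> \<infinity>" if "a < k" for a
      using emeasure_mono[OF C(2)[OF that], of lborel] B by (auto simp: top_unique)
    then show ?thesis
      by (subst prod_ennreal[symmetric]) (auto intro!: prod.cong simp: emeasure_eq_ennreal_measure)
  qed
  finally show ?thesis .
qed


text \<open>
  The measure that counts the enumerations of the window with marks \<open>S\<close> has constant density: given
  their number, the points are independent and uniform, and each of them has arrived by time \<open>s\<close> with
  probability \<open>s / t\<close>, independently of everything else.
\<close>

lemma janossy:
  assumes M: "prob_space M" and X: "poisson_points M X" and inj: "AE \<omega> in M. inj (\<lambda>i. fst (X i \<omega>))"
    and B: "B \<in> sets borel" "emeasure lborel B < \<infinity>" and st: "0 \<le> s" "s \<le> t" and S: "S \<subseteq> {..<k}"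
    and G: "G \<in> borel_measurable (\<Pi>\<^sub>M i\<in>{..<k}. borel)"
  shows "(\<integral>\<^sup>+is. \<integral>\<^sup>+\<omega>. indicator {\<omega>\<in>space M. enumerates X B t s k S is \<omega>} \<omega> * G (positions X k is \<omega>) \<partial>M \<partial>count_space UNIV) =
     ennreal (s ^ card S * (t - s) ^ (k - card S) * exp (- t * measure lborel B)) *
     (\<integral>\<^sup>+z. indicator (({..<k} \<rightarrow>\<^sub>E B) \<inter> distinct_tuples k) z * G z \<partial>(\<Pi>\<^sub>M i\<in>{..<k}. lborel))"
proof -
  interpret prob_space M by (rule M)
  interpret L: product_sigma_finite "\<lambda>_::nat. lborel :: complex measure" ..
  let ?P = "\<Pi>\<^sub>M i\<in>{..<k}. (borel :: complex measure)"
  let ?L = "\<Pi>\<^sub>M i\<in>{..<k}. (lborel :: complex measure)"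
  let ?CM = "count_space (UNIV :: nat list set) \<Otimes>\<^sub>M M"
  define c where "c = ennreal (s ^ card S * (t - s) ^ (k - card S) * exp (- t * measure lborel B))"
  have c_fin: "c < \<infinity>" by (simp add: c_def)
  have sets_L: "sets ?L = sets ?P" by (intro sets_PiM_cong) auto
  note [measurable] = pred_enumerates[OF poisson_points_measurable[OF X] B(1)]
    measurable_positions[OF poisson_points_measurable[OF X]] B(1) G
  have box: "({..<k} \<rightarrow>\<^sub>E B) \<in> sets ?P" by (intro sets_PiM_I_finite) auto
  have \<Omega>: "(({..<k} \<rightarrow>\<^sub>E B) \<inter> distinct_tuples k) \<in> sets ?P" using box by auto
  define en where "en = {w \<in> space ?CM. enumerates X B t s k S (fst w) (snd w)}"
  have en [measurable]: "en \<in> sets ?CM"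
  proof -
    have "(\<lambda>w. enumerates X B t s k S (fst w) (snd w)) \<in> ?CM \<rightarrow>\<^sub>M count_space UNIV"
      by (rule measurable_pair_measure_countable1) auto
    then show ?thesis unfolding en_def by (rule predE)
  qed
  have pos [measurable]: "(\<lambda>w. positions X k (fst w) (snd w)) \<in> ?CM \<rightarrow>\<^sub>M ?P"
    by (rule measurable_pair_measure_countable1) auto
  define \<nu> where "\<nu> = distr (density ?CM (indicator en)) ?P (\<lambda>w. positions X k (fst w) (snd w))"
  define \<nu>' where "\<nu>' = density ?L (\<lambda>z. c * indicator (({..<k} \<rightarrow>\<^sub>E B) \<inter> distinct_tuples k) z)"
  have int_\<nu>: "(\<integral>\<^sup>+z. H z \<partial>\<nu>) = (\<integral>\<^sup>+is. \<integral>\<^sup>+\<omega>. indicator {\<omega>\<in>space M. enumerates X B t s k S is \<omega>} \<omega> * H (positions X k is \<omega>) \<partial>M \<partial>count_space UNIV)"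
    if [measurable]: "H \<in> borel_measurable ?P" for H
  proof -
    have "(\<integral>\<^sup>+z. H z \<partial>\<nu>) = (\<integral>\<^sup>+w. indicator en w * H (positions X k (fst w) (snd w)) \<partial>?CM)"
      unfolding \<nu>_def by (simp add: nn_integral_distr nn_integral_density)
    also have "\<dots> = (\<integral>\<^sup>+is. \<integral>\<^sup>+\<omega>. indicator en (is, \<omega>) * H (positions X k is \<omega>) \<partial>M \<partial>count_space UNIV)"
      by (subst nn_integral_fst[symmetric]) auto
    also have "\<dots> = (\<integral>\<^sup>+is. \<integral>\<^sup>+\<omega>. indicator {\<omega>\<in>space M. enumerates X B t s k S is \<omega>} \<omega> * H (positions X k is \<omega>) \<partial>M \<partial>count_space UNIV)"
      by (intro nn_integral_cong) (auto simp: en_def space_pair_measure indicator_def)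
    finally show ?thesis .
  qed
  have em_\<nu>: "emeasure \<nu> A = (\<integral>\<^sup>+is. emeasure M {\<omega>\<in>space M. enumerates X B t s k S is \<omega> \<and> positions X k is \<omega> \<in> A} \<partial>count_space UNIV)"
    if A [measurable]: "A \<in> sets ?P" for A
  proof -
    have "emeasure \<nu> A = (\<integral>\<^sup>+z. indicator A z \<partial>\<nu>)" using A by (simp add: \<nu>_def)
    also have "\<dots> = (\<integral>\<^sup>+is. \<integral>\<^sup>+\<omega>. indicator {\<omega>\<in>space M. enumerates X B t s k S is \<omega> \<and> positions X k is \<omega> \<in> A} \<omega> \<partial>M \<partial>count_space UNIV)"
    proof (subst int_\<nu>)
      show "indicator A \<in> borel_measurable ?P" by measurable
    qed (intro nn_integral_cong, simp split: split_indicator)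
    also have "\<dots> = (\<integral>\<^sup>+is. emeasure M {\<omega>\<in>space M. enumerates X B t s k S is \<omega> \<and> positions X k is \<omega> \<in> A} \<partial>count_space UNIV)"
      by (intro nn_integral_cong nn_integral_indicator) measurable
    finally show ?thesis .
  qed
  have em_\<nu>': "emeasure \<nu>' A = c * emeasure ?L (A \<inter> (({..<k} \<rightarrow>\<^sub>E B) \<inter> distinct_tuples k))"
    if A: "A \<in> sets ?P" for A
  proof -
    have "emeasure \<nu>' A = (\<integral>\<^sup>+z. c * indicator (A \<inter> (({..<k} \<rightarrow>\<^sub>E B) \<inter> distinct_tuples k)) z \<partial>?L)"
      unfolding \<nu>'_def using A \<Omega>
      by (subst emeasure_density) (auto simp: sets_L intro!: nn_integral_cong borel_measurable_const borel_measurable_indicator borel_measurable_times split: split_indicator)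
    then show ?thesis using A \<Omega> by (simp add: nn_integral_cmult_indicator sets_L sets.Int)
  qed
  have eq: "emeasure \<nu> A = emeasure \<nu>' A" "emeasure \<nu> A < \<infinity>" if "A \<in> disjoint_boxes k" for A
  proof -
    obtain C where A: "A = Pi\<^sub>E {..<k} C" and C: "\<And>a. a < k \<Longrightarrow> C a \<in> sets borel" "disjoint_family_on C {..<k}"
      using \<open>A \<in> disjoint_boxes k\<close> unfolding disjoint_boxes_def by blast
    have As: "A \<in> sets ?P" using that by (rule sets_disjoint_box)
    have iff: "enumerates X B t s k S is \<omega> \<and> positions X k is \<omega> \<in> A \<longleftrightarrow>
      enumerates X B t s k S is \<omega> \<and> positions X k is \<omega> \<in> Pi\<^sub>E {..<k} (\<lambda>a. C a \<inter> B)" for "is" \<omega>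
    proof -
      have "fst (X (is ! a) \<omega>) \<in> B" if "enumerates X B t s k S is \<omega>" "a < k" for a
      proof -
        have "is ! a \<in> window X B t \<omega>" using that by (metis enumerates_def nth_mem)
        then show ?thesis by (simp add: window_def)
      qed
      then show ?thesis by (auto simp: A positions_def PiE_iff)
    qed
    have d: "disjoint_family_on (\<lambda>a. C a \<inter> B) {..<k}" using C(2) by (auto simp: disjoint_family_on_def)
    have "emeasure \<nu> A = c * (\<Prod>a<k. emeasure lborel (C a \<inter> B))"
      unfolding em_\<nu>[OF As] iff c_def
      using C(1) B(1) by (intro janossy_box[OF M X B st S] d) auto
    moreover have "A \<inter> (({..<k} \<rightarrow>\<^sub>E B) \<inter> distinct_tuples k) = Pi\<^sub>E {..<k} (\<lambda>a. C a \<inter> B)"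
    proof -
      have "A \<subseteq> distinct_tuples k" using disjoint_boxes_subset[of k] \<open>A \<in> disjoint_boxes k\<close> by blast
      then have "A \<inter> (({..<k} \<rightarrow>\<^sub>E B) \<inter> distinct_tuples k) = A \<inter> ({..<k} \<rightarrow>\<^sub>E B)" by blast
      then show ?thesis unfolding A PiE_Int .
    qed
    then have "emeasure \<nu>' A = c * (\<Prod>a<k. emeasure lborel (C a \<inter> B))"
      unfolding em_\<nu>'[OF As] using C(1) B(1) by (subst L.emeasure_PiM[symmetric]) auto
    ultimately show "emeasure \<nu> A = emeasure \<nu>' A" by simp
    have "(\<Prod>a<k. emeasure lborel (C a \<inter> B)) \<noteq> \<infinity>"
    proof -
      have "emeasure lborel (C a \<inter> B) < \<infinity>" for a
        using emeasure_mono[of "C a \<inter> B" B lborel] B by (auto intro: order_le_less_trans)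
      then show ?thesis by (auto simp: ennreal_prod_eq_top less_top[symmetric])
    qed
    then show "emeasure \<nu> A < \<infinity>"
      using c_fin \<open>emeasure \<nu> A = c * _\<close> by (simp add: ennreal_mult_less_top less_top)
  qed
  have "\<nu> = \<nu>'"
  proof (rule measure_eqI_restrict_generator[where E="disjoint_boxes k" and \<Omega>="distinct_tuples k" and A="grid_boxes k"])
    show "Int_stable (disjoint_boxes k)" by (rule Int_stable_disjoint_boxes)
    show "disjoint_boxes k \<subseteq> Pow (distinct_tuples k)" by (rule disjoint_boxes_subset)
    show "sets \<nu> = sets \<nu>'" by (simp add: \<nu>_def \<nu>'_def sets_L)
    show "distinct_tuples k \<in> sets \<nu>" by (simp add: \<nu>_def)
    show "sets (restrict_space \<nu> (distinct_tuples k)) = sigma_sets (distinct_tuples k) (disjoint_boxes k)"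
      by (rule sets_restrict_distinct_tuples) (simp add: \<nu>_def)
    show "sets (restrict_space \<nu>' (distinct_tuples k)) = sigma_sets (distinct_tuples k) (disjoint_boxes k)"
      by (rule sets_restrict_distinct_tuples) (simp add: \<nu>'_def sets_L)
    show "AE z in \<nu>. z \<in> distinct_tuples k"
    proof -
      have "emeasure \<nu> (space \<nu> - distinct_tuples k) = 0"
      proof -
        have "emeasure \<nu> (space ?P - distinct_tuples k) = (\<integral>\<^sup>+is. emeasure M {\<omega>\<in>space M. enumerates X B t s k S is \<omega> \<and> positions X k is \<omega> \<in> space ?P - distinct_tuples k} \<partial>count_space UNIV)"
          by (rule em_\<nu>) measurable
        also have "\<dots> = (\<integral>\<^sup>+is. 0 \<partial>count_space (UNIV :: nat list set))"
        proof (intro nn_integral_cong)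
          fix "is" :: "nat list"
          have "AE \<omega> in M. \<not> (enumerates X B t s k S is \<omega> \<and> positions X k is \<omega> \<in> space ?P - distinct_tuples k)"
            using inj
          proof eventually_elim
            case (elim \<omega>)
            have "positions X k is \<omega> \<in> distinct_tuples k" if "enumerates X B t s k S is \<omega>"
            proof -
              have "a = b" if "a < k" "b < k" "fst (X (is ! a) \<omega>) = fst (X (is ! b) \<omega>)" for a b
              proof -
                have "is ! a = is ! b" using elim that(3) by (rule injD)
                then show ?thesis
                  using that \<open>enumerates X B t s k S is \<omega>\<close> by (simp add: enumerates_def nth_eq_iff_index_eq)
              qed
              then show ?thesis by (auto simp: positions_def distinct_tuples_def inj_on_def)
            qed
            then show ?case by blast
          qed
          moreover have "{\<omega>\<in>space M. enumerates X B t s k S is \<omega> \<and> positions X k is \<omega> \<in> space ?P - distinct_tuples k} \<in> sets M"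
            by measurable
          ultimately show "emeasure M {\<omega>\<in>space M. enumerates X B t s k S is \<omega> \<and> positions X k is \<omega> \<in> space ?P - distinct_tuples k} = 0"
            by (subst (asm) AE_iff_measurable) (auto simp only: not_not)
        qed
        finally show ?thesis by (simp add: \<nu>_def)
      qed
      then show ?thesis
        by (intro AE_I[of _ _ "space \<nu> - distinct_tuples k"]) (auto simp: \<nu>_def)
    qed
    show "AE z in \<nu>'. z \<in> distinct_tuples k"
      unfolding \<nu>'_def using \<Omega> by (subst AE_density) (auto simp: sets_L split: split_indicator intro!: AE_I2 borel_measurable_times_ennreal borel_measurable_indicator)
    show "countable (grid_boxes k)" by (rule countable_grid_boxes)
    show "grid_boxes k \<subseteq> disjoint_boxes k" by (rule grid_boxes_subset)
    show "\<Union>(grid_boxes k) = distinct_tuples k" by (rule Union_grid_boxes)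
    show "grid_boxes k \<noteq> {}"
    proof -
      have "(\<lambda>a\<in>{..<k}. (int a, 0::int)) \<in> {c \<in> {..<k} \<rightarrow>\<^sub>E UNIV. inj_on c {..<k}}" by (auto simp: inj_on_def)
      then show ?thesis unfolding grid_boxes_def by blast
    qed
    show "emeasure \<nu> A = emeasure \<nu>' A" if "A \<in> disjoint_boxes k" for A by (rule eq(1)[OF that])
    show "emeasure \<nu> A \<noteq> \<infinity>" if "A \<in> grid_boxes k" for A
      using eq(2)[OF subsetD[OF grid_boxes_subset that]] by simp
  qed
  then have "(\<integral>\<^sup>+z. G z \<partial>\<nu>) = (\<integral>\<^sup>+z. G z \<partial>\<nu>')" by simp
  also have "\<dots> = (\<integral>\<^sup>+z. c * (indicator (({..<k} \<rightarrow>\<^sub>E B) \<inter> distinct_tuples k) z * G z) \<partial>?L)"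
    unfolding \<nu>'_def using \<Omega> G
    by (subst nn_integral_density) (auto simp: sets_L mult_ac intro!: borel_measurable_times_ennreal borel_measurable_indicator cong: measurable_cong_sets)
  also have "\<dots> = c * (\<integral>\<^sup>+z. indicator (({..<k} \<rightarrow>\<^sub>E B) \<inter> distinct_tuples k) z * G z \<partial>?L)"
    using \<Omega> G by (intro nn_integral_cmult borel_measurable_times_ennreal borel_measurable_indicator)
      (auto simp: sets_L cong: measurable_cong_sets)
  finally show ?thesis using int_\<nu>[OF G] by (simp add: c_def)
qed

section \<open>Routes between listed points\<close>

text \<open>
  The routes between the first \<open>k\<close> points listed in \<open>is\<close>, indexed by places in the list.
\<close>

definition route_tuple ::
    "(nat \<times> nat \<Rightarrow> 'w \<Rightarrow> complex set) \<Rightarrow> nat \<Rightarrow> nat list \<Rightarrow> 'w \<Rightarrow> nat \<times> nat \<Rightarrow> complex set" where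
  "route_tuple R k is \<omega> = (\<lambda>(a, b)\<in>offdiag {..<k}. R (is ! a, is ! b) \<omega>)"

text \<open>
  The law of the routes between \<open>k\<close> points as a measurable kernel. On tuples with repetitions, where
  \<open>\<mu>\<close> is not constrained, it is the null measure.
\<close>

definition fdd_kernel ::
    "(complex list \<Rightarrow> (nat \<times> nat \<Rightarrow> complex set) measure) \<Rightarrow> nat \<Rightarrow> (nat \<Rightarrow> complex) \<Rightarrow>
     (nat \<times> nat \<Rightarrow> complex set) measure" where
  "fdd_kernel \<mu> k z =
     (if inj_on z {..<k} then \<mu> (map z [0..<k]) else null_measure (span_space k))"

lemma (in random_routes) measurable_fdd_kernel:
  "fdd_kernel \<mu> k \<in> (\<Pi>\<^sub>M i\<in>{..<k}. borel) \<rightarrow>\<^sub>M subprob_algebra (span_space k)"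
proof -
  let ?P = "\<Pi>\<^sub>M i\<in>{..<k}. (borel :: complex measure)"
  have "{z \<in> space ?P. inj_on z {..<k}} = distinct_tuples k"
    by (auto simp: distinct_tuples_def space_PiM)
  then have s: "{z \<in> space ?P. inj_on z {..<k}} \<in> sets ?P" by simp
  have "space (span_space k) \<noteq> {}"
  proof -
    have "(\<lambda>p\<in>offdiag {..<k}. {}) \<in> space (span_space k)" by (auto simp: space_PiM space_route_space)
    then show ?thesis by blast
  qed
  then have "null_measure (span_space k) \<in> space (subprob_algebra (span_space k))"
    by (auto simp: space_subprob_algebra intro!: subprob_spaceI)
  then show ?thesis
    unfolding fdd_kernel_def using measurable_fdd[of k]
    by (subst measurable_If_restrict_space_iff[OF s]) auto
qed

lemma (in random_routes) sets_fdd_kernel: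
  "z \<in> space (\<Pi>\<^sub>M i\<in>{..<k}. borel) \<Longrightarrow> sets (fdd_kernel \<mu> k z) = sets (span_space k)"
  using measurable_space[OF measurable_fdd_kernel] sets_eq_imp_space_eq by (auto simp: space_subprob_algebra)

context poisson_sampled_routes
begin

lemma measurable_X: "X i \<in> borel_measurable M"
  using poisson by (rule poisson_points_measurable)

lemma distinct_positions: "AE \<omega> in M. inj (\<lambda>i. fst (X i \<omega>))"
  using sampled_compatible
  by eventually_elim (force simp: compatible_routes_def route_def offdiag_def inj_def)

lemma measurable_route_tuple:
  assumes "distinct is" "length is = k"
  shows "route_tuple R k is \<in> M \<rightarrow>\<^sub>M span_space k"
  unfolding route_tuple_def
proof (rule measurable_restrict)
  fix p assume "p \<in> offdiag {..<k}"
  then obtain a b where p: "p = (a, b)" "a < k" "b < k" "a \<noteq> b" by (auto simp: offdiag_def)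
  then have "is ! a \<noteq> is ! b" using assms by (simp add: nth_eq_iff_index_eq)
  then have "(is ! a, is ! b) \<in> offdiag UNIV" by (simp add: offdiag_def)
  then show "(\<lambda>\<omega>. case p of (a, b) \<Rightarrow> R (is ! a, is ! b) \<omega>) \<in> M \<rightarrow>\<^sub>M route_space"
    unfolding p by (simp add: measurable_routes)
qed

text \<open>
  The routes between listed points have the law given by \<open>\<mu>\<close>, conditionally on the Poisson points: they
  are a reindexed part of the routes between the first \<open>n\<close> points for some \<open>n\<close>, and \<open>\<mu>\<close> is consistent.
\<close>

lemma conditional_law_tuple:
  assumes "is": "distinct is" "length is = k"
    and A: "A \<in> sets (\<Pi>\<^sub>M i\<in>UNIV. borel)" and B: "B \<in> sets (span_space k)"
  shows "emeasure M {\<omega>\<in>space M. (\<lambda>i. X i \<omega>) \<in> A \<and> route_tuple R k is \<omega> \<in> B} =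
    (\<integral>\<^sup>+\<omega>. indicator A (\<lambda>i. X i \<omega>) * emeasure (fdd_kernel \<mu> k (positions X k is \<omega>)) B \<partial>M)"
proof -
  obtain n where n: "set is \<subseteq> {..<n}"
    using finite_nat_set_iff_bounded[of "set is"] by auto
  define f where "f \<rho> = (\<lambda>(a, b)\<in>offdiag {..<k}. \<rho> (is ! a, is ! b))" for \<rho> :: "nat \<times> nat \<Rightarrow> complex set"
  have off: "(is ! a, is ! b) \<in> offdiag {..<n}" if "(a, b) \<in> offdiag {..<k}" for a b
  proof -
    have "a < k" "b < k" "a \<noteq> b" using that by (auto simp: offdiag_def)
    then have "is ! a \<noteq> is ! b" "is ! a \<in> set is" "is ! b \<in> set is"
      using "is" by (auto simp: nth_eq_iff_index_eq)
    then show ?thesis using n by (auto simp: offdiag_def)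
  qed
  have f: "f \<in> span_space n \<rightarrow>\<^sub>M span_space k"
    unfolding f_def
  proof (rule measurable_restrict)
    fix p assume "p \<in> offdiag {..<k}"
    then show "(\<lambda>\<rho>. case p of (a, b) \<Rightarrow> \<rho> (is ! a, is ! b)) \<in> span_space n \<rightarrow>\<^sub>M route_space"
      using off by (cases p) (auto intro: measurable_component_singleton)
  qed
  define B' where "B' = f -` B \<inter> space (span_space n)"
  have B': "B' \<in> sets (span_space n)" unfolding B'_def using f B by (rule measurable_sets)
  let ?R = "\<lambda>\<omega>. \<lambda>p\<in>offdiag {..<n}. R p \<omega>"
  have R_space: "?R \<omega> \<in> space (span_space n)" if "\<omega> \<in> space M" for \<omega>
    using measurable_space[OF measurable_routes that]
    by (auto simp: space_PiM offdiag_def)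
  have fR: "f (?R \<omega>) = route_tuple R k is \<omega>" for \<omega>
    unfolding f_def route_tuple_def using off by (intro restrict_ext) auto
  have "{\<omega>\<in>space M. (\<lambda>i. X i \<omega>) \<in> A \<and> route_tuple R k is \<omega> \<in> B} =
     {\<omega>\<in>space M. (\<lambda>i. X i \<omega>) \<in> A \<and> ?R \<omega> \<in> B'}"
    using R_space fR by (auto simp: B'_def)
  then have "emeasure M {\<omega>\<in>space M. (\<lambda>i. X i \<omega>) \<in> A \<and> route_tuple R k is \<omega> \<in> B} =
     (\<integral>\<^sup>+\<omega>. indicator A (\<lambda>i. X i \<omega>) * emeasure (\<mu> (map (\<lambda>i. fst (X i \<omega>)) [0..<n])) B' \<partial>M)"
    using conditional_law[OF A B'] by simp
  also have "\<dots> = (\<integral>\<^sup>+\<omega>. indicator A (\<lambda>i. X i \<omega>) * emeasure (fdd_kernel \<mu> k (positions X k is \<omega>)) B \<partial>M)"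
  proof (rule nn_integral_cong_AE, use distinct_positions in eventually_elim)
    case (elim \<omega>)
    let ?zs = "map (\<lambda>i. fst (X i \<omega>)) [0..<n]"
    have d: "distinct ?zs" using elim by (auto simp: distinct_map inj_on_def inj_def)
    have nth: "is ! a < n" if "a < k" for a
      using subsetD[OF n nth_mem[of a "is"]] that "is" by auto
    have "map (\<lambda>k. ?zs ! k) is = map (positions X k is \<omega>) [0..<k]"
      using "is"(2) nth by (intro nth_equalityI) (auto simp: positions_def)
    moreover have "inj_on (positions X k is \<omega>) {..<k}"
    proof (rule inj_onI)
      fix a b assume ab: "a \<in> {..<k}" "b \<in> {..<k}" "positions X k is \<omega> a = positions X k is \<omega> b"
      then have "is ! a = is ! b" using injD[OF elim, of "is ! a" "is ! b"] by (simp add: positions_def)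
      then show "a = b" using ab "is" by (simp add: nth_eq_iff_index_eq)
    qed
    ultimately have "fdd_kernel \<mu> k (positions X k is \<omega>) = \<mu> (map (\<lambda>k. ?zs ! k) is)"
      by (simp add: fdd_kernel_def)
    also have "\<dots> = distr (\<mu> ?zs) (span_space k) f"
      using consistent[OF d "is"(1)] n "is"(2) by (simp add: f_def[abs_def])
    finally have "emeasure (fdd_kernel \<mu> k (positions X k is \<omega>)) B = emeasure (distr (\<mu> ?zs) (span_space k) f) B"
      by simp
    also have "\<dots> = emeasure (\<mu> ?zs) B'"
    proof -
      have s: "sets (\<mu> ?zs) = sets (span_space n)" using sets_fdd[OF d] by simp
      then have "f \<in> \<mu> ?zs \<rightarrow>\<^sub>M span_space k" using f by (simp cong: measurable_cong_sets)
      then show ?thesis using B sets_eq_imp_space_eq[OF s] by (simp add: emeasure_distr B'_def)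
    qed
    finally show ?case by simp
  qed
  finally show ?thesis .
qed

text \<open>
  The conditional law for functions of positions and routes jointly.
\<close>

lemma nn_integral_route_tuple:
  assumes "is": "distinct is" "length is = k" and B: "B \<in> sets borel"
    and g: "g \<in> borel_measurable ((\<Pi>\<^sub>M i\<in>{..<k}. borel) \<Otimes>\<^sub>M span_space k)"
  shows "(\<integral>\<^sup>+\<omega>. indicator {\<omega>\<in>space M. enumerates X B t s k S is \<omega>} \<omega> *
              g (positions X k is \<omega>, route_tuple R k is \<omega>) \<partial>M) =
         (\<integral>\<^sup>+\<omega>. indicator {\<omega>\<in>space M. enumerates X B t s k S is \<omega>} \<omega> *
              (\<integral>\<^sup>+\<rho>. g (positions X k is \<omega>, \<rho>) \<partial>fdd_kernel \<mu> k (positions X k is \<omega>)) \<partial>M)"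
proof -
  let ?P = "\<Pi>\<^sub>M i\<in>{..<k}. (borel :: complex measure)" and ?S = "span_space k"
  let ?Q = "\<Pi>\<^sub>M i\<in>(UNIV::nat set). (borel :: (complex \<times> real) measure)"
  define E where "E = {\<omega>\<in>space M. enumerates X B t s k S is \<omega>}"
  note [measurable] = measurable_X measurable_route_tuple[OF "is"] g B measurable_fdd_kernel
    measurable_positions[OF measurable_X]
  have [measurable]: "E \<in> sets M"
    unfolding E_def using pred_enumerates[OF measurable_X B] by (rule predE)
  define \<nu>1 where "\<nu>1 = distr (density M (indicator E)) (?P \<Otimes>\<^sub>M ?S) (\<lambda>\<omega>. (positions X k is \<omega>, route_tuple R k is \<omega>))"
  define K where "K \<omega> = distr (fdd_kernel \<mu> k (positions X k is \<omega>)) (?P \<Otimes>\<^sub>M ?S) (\<lambda>\<rho>. (positions X k is \<omega>, \<rho>))" for \<omega>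
  have K [measurable]: "K \<in> M \<rightarrow>\<^sub>M subprob_algebra (?P \<Otimes>\<^sub>M ?S)"
    unfolding K_def
  proof (rule measurable_distr2)
    show "(\<lambda>\<omega>. fdd_kernel \<mu> k (positions X k is \<omega>)) \<in> M \<rightarrow>\<^sub>M subprob_algebra ?S" by measurable
    show "(\<lambda>(\<omega>, \<rho>). (positions X k is \<omega>, \<rho>)) \<in> M \<Otimes>\<^sub>M ?S \<rightarrow>\<^sub>M ?P \<Otimes>\<^sub>M ?S" by measurable
  qed
  then have K': "K \<in> density M (indicator E) \<rightarrow>\<^sub>M subprob_algebra (?P \<Otimes>\<^sub>M ?S)" by simp
  have pos_space: "positions X k is \<omega> \<in> space ?P" for \<omega> by (simp add: positions_def space_PiM)
  have int_K: "(\<integral>\<^sup>+w. h w \<partial>K \<omega>) = (\<integral>\<^sup>+\<rho>. h (positions X k is \<omega>, \<rho>) \<partial>fdd_kernel \<mu> k (positions X k is \<omega>))"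
    if [measurable]: "h \<in> borel_measurable (?P \<Otimes>\<^sub>M ?S)" for h \<omega>
  proof -
    note [measurable_cong] = sets_fdd_kernel[OF pos_space]
    have [measurable]: "(\<lambda>\<rho>. (positions X k is \<omega>, \<rho>)) \<in> fdd_kernel \<mu> k (positions X k is \<omega>) \<rightarrow>\<^sub>M ?P \<Otimes>\<^sub>M ?S"
      using pos_space by (intro measurable_Pair measurable_const) measurable
    show ?thesis unfolding K_def by (intro nn_integral_distr) measurable
  qed
  define \<nu>2 where "\<nu>2 = density M (indicator E) \<bind> K"
  have int2: "(\<integral>\<^sup>+w. h w \<partial>\<nu>2) = (\<integral>\<^sup>+\<omega>. indicator E \<omega> * (\<integral>\<^sup>+\<rho>. h (positions X k is \<omega>, \<rho>) \<partial>fdd_kernel \<mu> k (positions X k is \<omega>)) \<partial>M)"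
    if h [measurable]: "h \<in> borel_measurable (?P \<Otimes>\<^sub>M ?S)" for h
  proof -
    have [measurable]: "(\<lambda>\<omega>. \<integral>\<^sup>+w. h w \<partial>K \<omega>) \<in> borel_measurable M"
      by (rule measurable_compose[OF K nn_integral_measurable_subprob_algebra[OF h]])
    have "(\<integral>\<^sup>+w. h w \<partial>\<nu>2) = (\<integral>\<^sup>+\<omega>. (\<integral>\<^sup>+w. h w \<partial>K \<omega>) \<partial>density M (indicator E))"
      unfolding \<nu>2_def by (rule nn_integral_bind[OF h K'])
    also have "\<dots> = (\<integral>\<^sup>+\<omega>. indicator E \<omega> * (\<integral>\<^sup>+w. h w \<partial>K \<omega>) \<partial>M)"
      by (rule nn_integral_density) measurable
    finally show ?thesis by (simp add: int_K[OF h])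
  qed
  have int1: "(\<integral>\<^sup>+w. h w \<partial>\<nu>1) = (\<integral>\<^sup>+\<omega>. indicator E \<omega> * h (positions X k is \<omega>, route_tuple R k is \<omega>) \<partial>M)"
    if [measurable]: "h \<in> borel_measurable (?P \<Otimes>\<^sub>M ?S)" for h
    unfolding \<nu>1_def by (simp add: nn_integral_distr nn_integral_density)
  have sets2: "sets \<nu>2 = sets (?P \<Otimes>\<^sub>M ?S)"
    unfolding \<nu>2_def by (rule sets_bind[OF sets_kernel[OF K']]) (auto simp: not_empty)
  let ?G = "{a \<times> b | a b. a \<in> sets ?P \<and> b \<in> sets ?S}"
  have "\<nu>1 = \<nu>2"
  proof (rule measure_eqI_generator_eq)
    show "Int_stable ?G" by (rule Int_stable_pair_measure_generator)
    show "?G \<subseteq> Pow (space ?P \<times> space ?S)" by (auto dest: sets.sets_into_space)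
    show "sets \<nu>1 = sigma_sets (space ?P \<times> space ?S) ?G" by (simp add: \<nu>1_def sets_pair_measure)
    show "sets \<nu>2 = sigma_sets (space ?P \<times> space ?S) ?G" by (simp add: sets2 sets_pair_measure)
    show "range (\<lambda>i::nat. space ?P \<times> space ?S) \<subseteq> ?G" by blast
    show "(\<Union>i::nat. space ?P \<times> space ?S) = space ?P \<times> space ?S" by simp
    have "emeasure \<nu>1 (space ?P \<times> space ?S) = (\<integral>\<^sup>+w. indicator (space ?P \<times> space ?S) w \<partial>\<nu>1)"
      by (simp add: \<nu>1_def)
    also have "\<dots> \<le> (\<integral>\<^sup>+\<omega>. 1 \<partial>M)"
    proof (subst int1)
      show "indicator (space ?P \<times> space ?S) \<in> borel_measurable (?P \<Otimes>\<^sub>M ?S)" by simp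
    qed (intro nn_integral_mono, simp split: split_indicator)
    also have "\<dots> = 1" by (simp add: emeasure_space_1)
    finally show "emeasure \<nu>1 (space ?P \<times> space ?S) \<noteq> \<infinity>" by (auto simp: top_unique)
  next
    fix Z assume "Z \<in> ?G"
    then obtain C D where Z: "Z = C \<times> D" and [measurable]: "C \<in> sets ?P" "D \<in> sets ?S" by blast
    let ?c = "\<lambda>x. \<lambda>a\<in>{..<k}. fst (x (is ! a) :: complex \<times> real)"
    define A where "A = {x \<in> space ?Q. enumerates (\<lambda>i x. x i) B t s k S is x \<and> ?c x \<in> C}"
    have comp [measurable]: "(\<lambda>x. x i) \<in> ?Q \<rightarrow>\<^sub>M borel" for i by measurable
    have A: "A \<in> sets ?Q"
    proof -
      note [measurable] = pred_enumerates[OF comp B] measurable_fst_X(1)[OF comp]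
      show ?thesis unfolding A_def by measurable
    qed
    have iA: "(\<lambda>i. X i \<omega>) \<in> A \<longleftrightarrow> enumerates X B t s k S is \<omega> \<and> positions X k is \<omega> \<in> C" for \<omega>
      by (simp add: A_def space_PiM enumerates_def positions_def window_def)
    have "emeasure \<nu>1 Z = (\<integral>\<^sup>+w. indicator Z w \<partial>\<nu>1)" by (simp add: \<nu>1_def Z)
    also have "\<dots> = (\<integral>\<^sup>+\<omega>. indicator {\<omega>\<in>space M. (\<lambda>i. X i \<omega>) \<in> A \<and> route_tuple R k is \<omega> \<in> D} \<omega> \<partial>M)"
      by (subst int1) (auto intro!: nn_integral_cong simp: Z E_def iA indicator_def)
    also have "\<dots> = emeasure M {\<omega>\<in>space M. (\<lambda>i. X i \<omega>) \<in> A \<and> route_tuple R k is \<omega> \<in> D}"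
    proof (rule nn_integral_indicator)
      have "{\<omega>\<in>space M. (\<lambda>i. X i \<omega>) \<in> A \<and> route_tuple R k is \<omega> \<in> D} =
          ((\<lambda>\<omega> i. X i \<omega>) -` A \<inter> space M) \<inter> (route_tuple R k is -` D \<inter> space M)" by auto
      moreover have "(\<lambda>\<omega> i. X i \<omega>) \<in> M \<rightarrow>\<^sub>M ?Q" by (intro measurable_PiM_single') (auto simp: measurable_X)
      ultimately show "{\<omega>\<in>space M. (\<lambda>i. X i \<omega>) \<in> A \<and> route_tuple R k is \<omega> \<in> D} \<in> sets M"
        using A by (auto intro!: sets.Int measurable_sets)
    qed
    also have "\<dots> = (\<integral>\<^sup>+\<omega>. indicator A (\<lambda>i. X i \<omega>) * emeasure (fdd_kernel \<mu> k (positions X k is \<omega>)) D \<partial>M)"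
      by (rule conditional_law_tuple[OF "is" A]) measurable
    also have "\<dots> = (\<integral>\<^sup>+\<omega>. indicator E \<omega> * (\<integral>\<^sup>+\<rho>. indicator Z (positions X k is \<omega>, \<rho>) \<partial>fdd_kernel \<mu> k (positions X k is \<omega>)) \<partial>M)"
    proof (rule nn_integral_cong)
      fix \<omega> assume \<omega>: "\<omega> \<in> space M"
      have "(\<integral>\<^sup>+\<rho>. indicator Z (positions X k is \<omega>, \<rho>) \<partial>fdd_kernel \<mu> k (positions X k is \<omega>)) =
        (\<integral>\<^sup>+\<rho>. indicator C (positions X k is \<omega>) * indicator D \<rho> \<partial>fdd_kernel \<mu> k (positions X k is \<omega>))"
        by (intro nn_integral_cong) (auto simp: Z indicator_def)
      also have "\<dots> = indicator C (positions X k is \<omega>) * emeasure (fdd_kernel \<mu> k (positions X k is \<omega>)) D"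
        by (intro nn_integral_cmult_indicator) (simp add: sets_fdd_kernel[OF pos_space])
      finally show "indicator A (\<lambda>i. X i \<omega>) * emeasure (fdd_kernel \<mu> k (positions X k is \<omega>)) D =
         indicator E \<omega> * (\<integral>\<^sup>+\<rho>. indicator Z (positions X k is \<omega>, \<rho>) \<partial>fdd_kernel \<mu> k (positions X k is \<omega>))"
        using \<omega> by (auto simp: E_def iA indicator_def)
    qed
    also have "\<dots> = (\<integral>\<^sup>+w. indicator Z w \<partial>\<nu>2)"
      by (rule int2[symmetric]) (simp add: Z)
    also have "\<dots> = emeasure \<nu>2 Z" by (intro nn_integral_indicator) (simp add: sets2 Z)
    finally show "emeasure \<nu>1 Z = emeasure \<nu>2 Z" .
  qed
  then show ?thesis using int1[OF g] int2[OF g] by (simp add: E_def)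
qed

end

section \<open>Points covered by many disjoint pairs\<close>

text \<open>
  The points \<open>x\<close> such that the routes between \<open>m\<close> pairwise disjoint pairs of indices in \<open>J\<close> pass
  through \<open>x\<close>, all endpoints being at distance more than \<open>r\<close> from \<open>x\<close>.
\<close>

definition many_far ::
    "nat \<Rightarrow> 'i set \<Rightarrow> ('i \<Rightarrow> complex) \<Rightarrow> ('i \<times> 'i \<Rightarrow> complex set) \<Rightarrow> real \<Rightarrow> complex set" where
  "many_far m J z \<rho> r = {x. \<exists>Q. Q \<subseteq> offdiag J \<and> finite Q \<and> card Q = m \<and>
     (\<forall>p\<in>Q. \<forall>q\<in>Q. p \<noteq> q \<longrightarrow> {fst p, snd p} \<inter> {fst q, snd q} = {}) \<and>
     (\<forall>(i, j)\<in>Q. x \<in> \<rho> (i, j) \<and> r < dist x (z i) \<and> r < dist x (z j))}"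

lemma many_farI:
  assumes "Q \<subseteq> offdiag J" "finite Q" "card Q = m"
    "\<And>p q. p \<in> Q \<Longrightarrow> q \<in> Q \<Longrightarrow> p \<noteq> q \<Longrightarrow> {fst p, snd p} \<inter> {fst q, snd q} = {}"
    "\<And>i j. (i, j) \<in> Q \<Longrightarrow> x \<in> \<rho> (i, j) \<and> r < dist x (z i) \<and> r < dist x (z j)"
  shows "x \<in> many_far m J z \<rho> r"
  unfolding many_far_def
proof (intro CollectI exI[of _ Q] conjI ballI impI)
  fix p q assume "p \<in> Q" "q \<in> Q" "p \<noteq> q"
  then show "{fst p, snd p} \<inter> {fst q, snd q} = {}" by (rule assms(4))
next
  fix p assume "p \<in> Q"
  then show "case p of (i, j) \<Rightarrow> x \<in> \<rho> (i, j) \<and> r < dist x (z i) \<and> r < dist x (z j)"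
    using assms(5) by (cases p) blast
qed (fact assms(1-3))+

lemma many_farE:
  assumes "x \<in> many_far m J z \<rho> r"
  obtains Q where "Q \<subseteq> offdiag J" "finite Q" "card Q = m"
    "\<forall>p q. p \<in> Q \<longrightarrow> q \<in> Q \<longrightarrow> p \<noteq> q \<longrightarrow> {fst p, snd p} \<inter> {fst q, snd q} = {}"
    "\<forall>i j. (i, j) \<in> Q \<longrightarrow> x \<in> \<rho> (i, j) \<and> r < dist x (z i) \<and> r < dist x (z j)"
proof -
  from assms obtain Q where "Q \<subseteq> offdiag J \<and> finite Q \<and> card Q = m \<and>
     (\<forall>p\<in>Q. \<forall>q\<in>Q. p \<noteq> q \<longrightarrow> {fst p, snd p} \<inter> {fst q, snd q} = {}) \<and>
     (\<forall>(i, j)\<in>Q. x \<in> \<rho> (i, j) \<and> r < dist x (z i) \<and> r < dist x (z j))"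
    unfolding many_far_def by (rule CollectE) (erule exE)
  then show thesis by (intro that[of Q]) (blast+)
qed

lemma mem_many_far_1:
  "x \<in> many_far 1 J z \<rho> r \<longleftrightarrow>
     (\<exists>i j. (i, j) \<in> offdiag J \<and> x \<in> \<rho> (i, j) \<and> r < dist x (z i) \<and> r < dist x (z j))"
proof
  assume "x \<in> many_far 1 J z \<rho> r"
  then show "\<exists>i j. (i, j) \<in> offdiag J \<and> x \<in> \<rho> (i, j) \<and> r < dist x (z i) \<and> r < dist x (z j)"
    by (rule many_farE) (metis card_1_singletonE insertI1 subset_iff surj_pair)
next
  assume "\<exists>i j. (i, j) \<in> offdiag J \<and> x \<in> \<rho> (i, j) \<and> r < dist x (z i) \<and> r < dist x (z j)"
  then obtain i j where "(i, j) \<in> offdiag J \<and> x \<in> \<rho> (i, j) \<and> r < dist x (z i) \<and> r < dist x (z j)" by blast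
  then show "x \<in> many_far 1 J z \<rho> r" by (intro many_farI[of "{(i, j)}"]) auto
qed

lemma far_edges_eq_many_far:
  "far_edges X R t r \<omega> = many_far 1 (arrived X t \<omega>) (\<lambda>i. fst (X i \<omega>)) (\<lambda>p. R p \<omega>) r"
proof (rule set_eqI)
  fix x
  have "x \<in> far_edges X R t r \<omega> \<longleftrightarrow> (\<exists>i j. (i, j) \<in> offdiag (arrived X t \<omega>) \<and> x \<in> R (i, j) \<omega> \<and>
      r < dist x (fst (X i \<omega>)) \<and> r < dist x (fst (X j \<omega>)))"
    unfolding far_edges_def by (force simp: dist_commute not_le)
  then show "x \<in> far_edges X R t r \<omega> \<longleftrightarrow>
      x \<in> many_far 1 (arrived X t \<omega>) (\<lambda>i. fst (X i \<omega>)) (\<lambda>p. R p \<omega>) r"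
    unfolding mem_many_far_1 .
qed

lemma many_far_mono: "J \<subseteq> J' \<Longrightarrow> r' \<le> r \<Longrightarrow> many_far m J z \<rho> r \<subseteq> many_far m J' z \<rho> r'"
proof
  fix x assume J: "J \<subseteq> J'" "r' \<le> r" and "x \<in> many_far m J z \<rho> r"
  then obtain Q where Q: "Q \<subseteq> offdiag J" "finite Q" "card Q = m"
    "\<forall>p q. p \<in> Q \<longrightarrow> q \<in> Q \<longrightarrow> p \<noteq> q \<longrightarrow> {fst p, snd p} \<inter> {fst q, snd q} = {}"
    "\<forall>i j. (i, j) \<in> Q \<longrightarrow> x \<in> \<rho> (i, j) \<and> r < dist x (z i) \<and> r < dist x (z j)"
    by (elim many_farE)
  note Q = Q(1-3) Q(4,5)[rule_format]
  have "offdiag J \<subseteq> offdiag J'" using J(1) by (auto simp: offdiag_def)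
  then show "x \<in> many_far m J' z \<rho> r'"
    using Q J(2) by (intro many_farI[of Q]) (auto dest: Q(5))
qed

lemma many_far_subset: "0 < m \<Longrightarrow> many_far m J z \<rho> r \<subseteq> (\<Union>p\<in>offdiag J. \<rho> p)"
proof
  fix x assume "0 < m" "x \<in> many_far m J z \<rho> r"
  then obtain Q where Q: "Q \<subseteq> offdiag J" "card Q = m"
    "\<forall>i j. (i, j) \<in> Q \<longrightarrow> x \<in> \<rho> (i, j) \<and> r < dist x (z i) \<and> r < dist x (z j)"
    by (elim many_farE)
  note Q = Q(1,2) Q(3)[rule_format]
  obtain i j where "(i, j) \<in> Q" using \<open>0 < m\<close> Q(2) by (metis card.empty equals0I less_irrefl surj_pair)
  then show "x \<in> (\<Union>p\<in>offdiag J. \<rho> p)" using Q by blast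
qed

text \<open>
  A point covered by routes with arbitrarily distant endpoints is covered by arbitrarily many
  routes between disjoint pairs.
\<close>

lemma many_far_of_all_far:
  assumes x: "\<And>n::nat. x \<in> many_far 1 J z \<rho> (real n)"
  shows "x \<in> many_far m J z \<rho> r"
proof (induction m)
  case 0
  show ?case by (rule many_farI[of "{}"]) auto
next
  case (Suc m)
  then obtain Q where Q: "Q \<subseteq> offdiag J" "finite Q" "card Q = m"
    "\<forall>p q. p \<in> Q \<longrightarrow> q \<in> Q \<longrightarrow> p \<noteq> q \<longrightarrow> {fst p, snd p} \<inter> {fst q, snd q} = {}"
    "\<forall>i j. (i, j) \<in> Q \<longrightarrow> x \<in> \<rho> (i, j) \<and> r < dist x (z i) \<and> r < dist x (z j)"
    by (rule many_farE)
  \<comment> \<open>Endpoints farther from \<open>x\<close> than all previous ones are new points.\<close>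
  define D where "D = insert r ((\<lambda>p. dist x (z (fst p))) ` Q \<union> (\<lambda>p. dist x (z (snd p))) ` Q)"
  have fin: "finite D" using Q(2) by (simp add: D_def)
  obtain n :: nat where "Max D \<le> real n" using real_arch_simple by blast
  then have n: "d \<le> real n" if "d \<in> D" for d using Max_ge[OF fin that] by linarith
  obtain i j where ij: "(i, j) \<in> offdiag J" "x \<in> \<rho> (i, j)" "real n < dist x (z i)" "real n < dist x (z j)"
    using x[of n] unfolding mem_many_far_1 by blast
  have new: "{i, j} \<inter> {fst q, snd q} = {}" if "q \<in> Q" for q
  proof -
    have "dist x (z (fst q)) \<le> real n" "dist x (z (snd q)) \<le> real n"
      using that by (intro n; simp add: D_def)+
    then show ?thesis using ij by auto
  qed
  have "(i, j) \<notin> Q" using new[of "(i, j)"] by auto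
  have r: "r \<le> real n" by (rule n) (simp add: D_def)
  show ?case
  proof (rule many_farI[of "insert (i, j) Q"])
    show "{fst p, snd p} \<inter> {fst q, snd q} = {}" if pq: "p \<in> insert (i, j) Q" "q \<in> insert (i, j) Q" "p \<noteq> q" for p q
    proof -
      consider "p = (i, j)" "q \<in> Q" | "q = (i, j)" "p \<in> Q" | "p \<in> Q" "q \<in> Q" using pq by blast
      then show ?thesis
      proof cases
        case 1 then show ?thesis using new[of q] by simp
      next
        case 2 then show ?thesis using new[of p] by (simp add: Int_commute)
      next
        case 3 then show ?thesis using Q(4) pq(3) by blast
      qed
    qed
    show "x \<in> \<rho> (a, b) \<and> r < dist x (z a) \<and> r < dist x (z b)" if "(a, b) \<in> insert (i, j) Q" for a b
      using that ij Q(5) r by auto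
  qed (use Q ij \<open>(i, j) \<notin> Q\<close> in auto)
qed

lemma many_far_reindex:
  assumes f: "bij_betw f K J"
    and z: "\<And>a. a \<in> K \<Longrightarrow> z' a = z (f a)"
    and \<rho>: "\<And>a b. (a, b) \<in> offdiag K \<Longrightarrow> \<rho>' (a, b) = \<rho> (f a, f b)"
  shows "many_far m K z' \<rho>' r = many_far m J z \<rho> r"
proof
  let ?F = "map_prod f f"
  have inj: "inj_on f K" and img: "f ` K = J" using f by (auto simp: bij_betw_def)
  have injF: "inj_on ?F (offdiag K)"
    using inj by (auto simp: inj_on_def offdiag_def)
  have imgF: "?F ` offdiag K = offdiag J"
    using inj img by (force simp: offdiag_def inj_on_def image_iff)
  show "many_far m K z' \<rho>' r \<subseteq> many_far m J z \<rho> r"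
  proof
    fix x assume "x \<in> many_far m K z' \<rho>' r"
    then obtain Q where Q: "Q \<subseteq> offdiag K" "finite Q" "card Q = m"
      "\<forall>p q. p \<in> Q \<longrightarrow> q \<in> Q \<longrightarrow> p \<noteq> q \<longrightarrow> {fst p, snd p} \<inter> {fst q, snd q} = {}"
      "\<forall>i j. (i, j) \<in> Q \<longrightarrow> x \<in> \<rho>' (i, j) \<and> r < dist x (z' i) \<and> r < dist x (z' j)"
      by (rule many_farE)
    note Q = Q(1-3) Q(4,5)[rule_format]
    have K: "fst p \<in> K \<and> snd p \<in> K" if "p \<in> Q" for p using Q(1) that by (auto simp: offdiag_def)
    show "x \<in> many_far m J z \<rho> r"
    proof (rule many_farI[of "?F ` Q"])
      show "?F ` Q \<subseteq> offdiag J" using Q(1) imgF by blast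
      show "finite (?F ` Q)" using Q(2) by simp
      show "card (?F ` Q) = m" using Q(1,3) inj_on_subset[OF injF] by (simp add: card_image)
      show "{fst p, snd p} \<inter> {fst q, snd q} = {}" if pq_in: "p \<in> ?F ` Q" "q \<in> ?F ` Q" and "p \<noteq> q" for p q
      proof -
        obtain p' q' where pq: "p = ?F p'" "q = ?F q'" "p' \<in> Q" "q' \<in> Q"
          using pq_in by (elim imageE) simp
        then have "{fst p', snd p'} \<inter> {fst q', snd q'} = {}" using Q(4) \<open>p \<noteq> q\<close> by blast
        then have "f ` {fst p', snd p'} \<inter> f ` {fst q', snd q'} = {}"
          using K[OF pq(3)] K[OF pq(4)] inj by (subst inj_on_image_Int[OF inj, symmetric]) auto
        then show ?thesis unfolding pq by simp
      qed
      show "x \<in> \<rho> (i, j) \<and> r < dist x (z i) \<and> r < dist x (z j)" if ij: "(i, j) \<in> ?F ` Q" for i j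
      proof -
        obtain a b where ab: "(a, b) \<in> Q" "i = f a" "j = f b" using ij by auto
        then have "(a, b) \<in> offdiag K" using Q(1) by blast
        then show ?thesis using Q(5)[OF ab(1)] ab \<rho> z K[OF ab(1)] by auto
      qed
    qed
  qed
  show "many_far m J z \<rho> r \<subseteq> many_far m K z' \<rho>' r"
  proof
    fix x assume "x \<in> many_far m J z \<rho> r"
    then obtain Q where Q: "Q \<subseteq> offdiag J" "finite Q" "card Q = m"
      "\<forall>p q. p \<in> Q \<longrightarrow> q \<in> Q \<longrightarrow> p \<noteq> q \<longrightarrow> {fst p, snd p} \<inter> {fst q, snd q} = {}"
      "\<forall>i j. (i, j) \<in> Q \<longrightarrow> x \<in> \<rho> (i, j) \<and> r < dist x (z i) \<and> r < dist x (z j)"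
      by (rule many_farE)
    note Q = Q(1-3) Q(4,5)[rule_format]
    define Q' where "Q' = {p \<in> offdiag K. ?F p \<in> Q}"
    have FQ': "?F ` Q' = Q"
    proof
      show "?F ` Q' \<subseteq> Q" by (auto simp: Q'_def)
      show "Q \<subseteq> ?F ` Q'"
      proof
        fix q assume q: "q \<in> Q"
        then have "q \<in> ?F ` offdiag K" using Q(1) unfolding imgF by (rule subsetD[rotated])
        then obtain p where "p \<in> offdiag K" "q = ?F p" by (elim imageE)
        then show "q \<in> ?F ` Q'" using q by (intro image_eqI[of _ _ p]) (simp_all add: Q'_def)
      qed
    qed
    have injQ': "inj_on ?F Q'" by (rule inj_on_subset[OF injF]) (auto simp: Q'_def)
    show "x \<in> many_far m K z' \<rho>' r"
    proof (rule many_farI[of Q'])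
      show "Q' \<subseteq> offdiag K" by (auto simp: Q'_def)
      show "finite Q'" using injQ' FQ' Q(2) by (metis finite_imageD)
      show "card Q' = m" using injQ' FQ' Q(3) by (metis card_image)
      show "{fst p, snd p} \<inter> {fst q, snd q} = {}" if "p \<in> Q'" "q \<in> Q'" "p \<noteq> q" for p q
      proof -
        have "?F p \<noteq> ?F q" using injQ' that by (auto dest: inj_onD)
        then have "{fst (?F p), snd (?F p)} \<inter> {fst (?F q), snd (?F q)} = {}"
          using that by (intro Q(4)) (auto simp: Q'_def)
        then show ?thesis by auto
      qed
      show "x \<in> \<rho>' (i, j) \<and> r < dist x (z' i) \<and> r < dist x (z' j)" if "(i, j) \<in> Q'" for i j
      proof -
        have "(i, j) \<in> offdiag K" "(f i, f j) \<in> Q" using that by (auto simp: Q'_def)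
        then show ?thesis using Q(5)[of "f i" "f j"] \<rho> z by (auto simp: offdiag_def)
      qed
    qed
  qed
qed

text \<open>
  Reading the routes along an enumeration of the window does not change the points covered, the places
  in \<open>S\<close> corresponding to the points that have arrived by time \<open>s\<close>.
\<close>

lemma many_far_enumerates:
  assumes en: "enumerates X B t s k S is \<omega>" and S: "S \<subseteq> {..<k}" and st: "s \<le> t"
  shows "many_far m S (positions X k is \<omega>) (route_tuple R k is \<omega>) r =
    many_far m (window X B s \<omega>) (\<lambda>i. fst (X i \<omega>)) (\<lambda>p. R p \<omega>) r"
proof (rule many_far_reindex[where f="(!) is"])
  have e: "length is = k" "distinct is" "set is = window X B t \<omega>"
    "\<And>a. a < k \<Longrightarrow> a \<in> S \<longleftrightarrow> snd (X (is ! a) \<omega>) \<le> s"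
    using en by (auto simp: enumerates_def)
  have "inj_on ((!) is) S"
    using e(1,2) S by (auto simp: inj_on_def nth_eq_iff_index_eq subset_iff)
  moreover have "(!) is ` S = window X B s \<omega>"
  proof
    show "(!) is ` S \<subseteq> window X B s \<omega>"
    proof
      fix i assume "i \<in> (!) is ` S"
      then obtain a where a: "a \<in> S" "i = is ! a" by blast
      then have "a < k" using S by auto
      moreover from this have "i \<in> window X B t \<omega>" using a e(1,3) by (metis nth_mem)
      ultimately show "i \<in> window X B s \<omega>" using a e(4) by (auto simp: window_def)
    qed
    show "window X B s \<omega> \<subseteq> (!) is ` S"
    proof
      fix i assume i: "i \<in> window X B s \<omega>"
      then have "i \<in> set is" using st unfolding e(3) by (auto simp: window_def)
      then obtain a where "a < k" "i = is ! a" using e(1) by (auto simp: in_set_conv_nth)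
      then show "i \<in> (!) is ` S" using i e(4) by (auto simp: window_def)
    qed
  qed
  ultimately show "bij_betw ((!) is) S (window X B s \<omega>)" by (simp add: bij_betw_def)
qed (use S in \<open>auto simp: positions_def route_tuple_def offdiag_def subset_iff\<close>)

text \<open>
  The length of the part of these points in \<open>A\<close>, as a function of \<open>k\<close> positions and the routes
  between them; it is set to \<open>0\<close> on the null event that the total length is infinite.
\<close>

definition far_len ::
    "nat \<Rightarrow> nat \<Rightarrow> nat set \<Rightarrow> real \<Rightarrow> complex set \<Rightarrow> (nat \<Rightarrow> complex) \<times> (nat \<times> nat \<Rightarrow> complex set) \<Rightarrow> ennreal" where
  "far_len k m S r A w =
     (if len (\<Union>p\<in>offdiag {..<k}. snd w p) < \<infinity> then len (many_far m S (fst w) (snd w) r \<inter> A) else 0)"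

lemma finite_offdiag [simp]: "finite J \<Longrightarrow> finite (offdiag J)"
  by (rule finite_subset[of _ "J \<times> J"]) (auto simp: offdiag_def)

lemma many_far_eq_UN:
  "many_far m J z \<rho> r = (\<Union>Q\<in>{Q. Q \<subseteq> offdiag J \<and> finite Q \<and> card Q = m \<and>
     (\<forall>p\<in>Q. \<forall>q\<in>Q. p \<noteq> q \<longrightarrow> {fst p, snd p} \<inter> {fst q, snd q} = {})}.
     {x. \<forall>p\<in>Q. x \<in> \<rho> p \<and> r < dist x (z (fst p)) \<and> r < dist x (z (snd p))})"
  unfolding many_far_def by (auto simp: case_prod_beta)

lemma sets_many_far_graph:
  assumes S: "S \<subseteq> {..<k::nat}"
    and z: "\<And>i. i < k \<Longrightarrow> z i \<in> M \<rightarrow>\<^sub>M borel"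
    and \<rho>: "\<And>p. p \<in> offdiag {..<k} \<Longrightarrow> \<rho> p \<in> M \<rightarrow>\<^sub>M route_space"
  shows "{w \<in> space (M \<Otimes>\<^sub>M borel). snd w \<in> many_far m S (\<lambda>i. z i (fst w)) (\<lambda>p. \<rho> p (fst w)) r} \<in> sets (M \<Otimes>\<^sub>M borel)"
proof -
  define \<Q> where "\<Q> = {Q. Q \<subseteq> offdiag S \<and> finite Q \<and> card Q = m \<and>
     (\<forall>p\<in>Q. \<forall>q\<in>Q. p \<noteq> q \<longrightarrow> {fst p, snd p} \<inter> {fst q, snd q} = {})}"
  have off: "offdiag S \<subseteq> offdiag {..<k}" using S by (auto simp: offdiag_def)
  have \<Q>: "\<Q> \<subseteq> Pow (offdiag {..<k})" using off by (auto simp: \<Q>_def)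
  then have fin: "finite \<Q>" by (rule finite_subset) simp
  let ?D = "\<lambda>p. {w \<in> space (M \<Otimes>\<^sub>M borel). snd w \<in> \<rho> p (fst w)} \<inter>
     {w \<in> space (M \<Otimes>\<^sub>M borel). r < dist (snd w) (z (fst p) (fst w)) \<and> r < dist (snd w) (z (snd p) (fst w))}"
  have D: "?D p \<in> sets (M \<Otimes>\<^sub>M borel)" if "p \<in> offdiag {..<k}" for p
  proof -
    have [measurable]: "z (fst p) \<in> M \<rightarrow>\<^sub>M borel" "z (snd p) \<in> M \<rightarrow>\<^sub>M borel"
      using that z by (auto simp: offdiag_def)
    have "{w \<in> space (M \<Otimes>\<^sub>M borel). r < dist (snd w) (z (fst p) (fst w)) \<and> r < dist (snd w) (z (snd p) (fst w))} \<in> sets (M \<Otimes>\<^sub>M borel)"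
      by measurable
    then show ?thesis using sets_route_graph[OF \<rho>[OF that]] by (intro sets.Int)
  qed
  have "{w \<in> space (M \<Otimes>\<^sub>M borel). snd w \<in> many_far m S (\<lambda>i. z i (fst w)) (\<lambda>p. \<rho> p (fst w)) r} =
    (\<Union>Q\<in>\<Q>. {w \<in> space (M \<Otimes>\<^sub>M borel). \<forall>p\<in>Q. w \<in> ?D p})"
    unfolding many_far_eq_UN \<Q>_def[symmetric] by auto
  also have "\<dots> \<in> sets (M \<Otimes>\<^sub>M borel)"
  proof (intro sets.finite_UN fin sets.sets_Collect_finite_All)
    fix Q p assume "Q \<in> \<Q>" "p \<in> Q"
    then have "p \<in> offdiag {..<k}" using \<Q> by blast
    from D[OF this] show "{w \<in> space (M \<Otimes>\<^sub>M borel). w \<in> ?D p} \<in> sets (M \<Otimes>\<^sub>M borel)"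
      by (rule back_subst[of "\<lambda>A. A \<in> sets (M \<Otimes>\<^sub>M borel)"]) auto
  qed (simp add: \<Q>_def)
  finally show ?thesis .
qed

lemma measurable_far_len:
  assumes S: "S \<subseteq> {..<k}" and A: "A \<in> sets borel" and m: "0 < m"
  shows "far_len k m S r A \<in> borel_measurable ((\<Pi>\<^sub>M i\<in>{..<k}. borel) \<Otimes>\<^sub>M span_space k)"
proof -
  let ?M = "(\<Pi>\<^sub>M i\<in>{..<k}. (borel :: complex measure)) \<Otimes>\<^sub>M span_space k"
  have z: "(\<lambda>w. fst w i) \<in> ?M \<rightarrow>\<^sub>M borel" if "i < k" for i
    using measurable_compose[OF measurable_fst measurable_component_singleton[of i "{..<k}"]] that by simp
  have \<rho>: "(\<lambda>w. snd w p) \<in> ?M \<rightarrow>\<^sub>M route_space" if "p \<in> offdiag {..<k}" for p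
    by (rule measurable_compose[OF measurable_snd measurable_component_singleton[OF that]])
  have N: "(\<lambda>w. \<Union>p\<in>offdiag {..<k}. snd w p) \<in> ?M \<rightarrow>\<^sub>M route_space"
    using \<rho> by (intro measurable_route_UN) auto
  define D where "D = {w \<in> space (?M \<Otimes>\<^sub>M borel). snd w \<in> many_far m S (\<lambda>i. fst (fst w) i) (\<lambda>p. snd (fst w) p) r} \<inter>
     (space ?M \<times> A)"
  have "D \<in> sets (?M \<Otimes>\<^sub>M borel)"
    unfolding D_def using A by (intro sets.Int sets_many_far_graph[OF S] z \<rho> pair_measureI) auto
  from borel_measurable_len_section[OF N this]
  have "(\<lambda>w. if len (\<Union>p\<in>offdiag {..<k}. snd w p) < \<infinity>
      then len ((\<Union>p\<in>offdiag {..<k}. snd w p) \<inter> {x. (w, x) \<in> D}) else 0) \<in> borel_measurable ?M" .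
  also have "?this \<longleftrightarrow> ?thesis"
  proof (rule measurable_cong)
    fix w assume w: "w \<in> space ?M"
    have "offdiag S \<subseteq> offdiag {..<k}" using S by (auto simp: offdiag_def)
    then have "many_far m S (fst w) (snd w) r \<subseteq> (\<Union>p\<in>offdiag {..<k}. snd w p)"
      using many_far_subset[OF m, of S "fst w" "snd w" r] by blast
    then have "(\<Union>p\<in>offdiag {..<k}. snd w p) \<inter> {x. (w, x) \<in> D} = many_far m S (fst w) (snd w) r \<inter> A"
      using w by (auto simp: D_def space_pair_measure)
    then show "(if len (\<Union>p\<in>offdiag {..<k}. snd w p) < \<infinity>
      then len ((\<Union>p\<in>offdiag {..<k}. snd w p) \<inter> {x. (w, x) \<in> D}) else 0) = far_len k m S r A w"
      by (simp add: far_len_def)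
  qed
  finally show ?thesis .
qed

section \<open>Mean lengths as integrals over the positions\<close>


text \<open>
  The mean over the random routes, for given positions.
\<close>

definition mean_far_len ::
    "(complex list \<Rightarrow> (nat \<times> nat \<Rightarrow> complex set) measure) \<Rightarrow> nat \<Rightarrow> nat \<Rightarrow> nat set \<Rightarrow> real \<Rightarrow>
     complex set \<Rightarrow> (nat \<Rightarrow> complex) \<Rightarrow> ennreal" where
  "mean_far_len \<mu> k m S r A z = (\<integral>\<^sup>+\<rho>. far_len k m S r A (z, \<rho>) \<partial>fdd_kernel \<mu> k z)"

text \<open>
  The sum over the number \<open>k\<close> of points in \<open>B\<close> by time \<open>t\<close> and over the set \<open>S\<close> of those that have
  arrived by time \<open>s\<close>. The factor \<open>1 / fact k\<close> accounts for the enumerations of the same points. The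
  integral is restricted to distinct positions, the only ones at which \<open>\<mu>\<close> is constrained.
\<close>

definition marked_mean ::
    "(complex list \<Rightarrow> (nat \<times> nat \<Rightarrow> complex set) measure) \<Rightarrow> nat \<Rightarrow> complex set \<Rightarrow> real \<Rightarrow> real \<Rightarrow> real \<Rightarrow>
     complex set \<Rightarrow> ennreal" where
  "marked_mean \<mu> m B t s r A = (\<Sum>k. ennreal (1 / fact k) * (\<Sum>S\<in>Pow {..<k}.
     ennreal (s ^ card S * (t - s) ^ (k - card S) * exp (- t * measure lborel B)) *
     (\<integral>\<^sup>+z. indicator (({..<k} \<rightarrow>\<^sub>E B) \<inter> distinct_tuples k) z * mean_far_len \<mu> k m S r A z
        \<partial>(\<Pi>\<^sub>M i\<in>{..<k}. lborel))))"

lemma card_enumerations: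
  assumes "finite J"
  shows "card {is. distinct is \<and> set is = J} = fact (card J)" "finite {is. distinct is \<and> set is = J}"
  using card_permutations_of_set[OF assms] finite_permutations_of_set[of J]
  by (auto simp: permutations_of_set_def conj_commute)

context poisson_sampled_routes
begin

lemma measurable_mean_far_len:
  assumes "S \<subseteq> {..<k}" "A \<in> sets borel" "0 < m"
  shows "mean_far_len \<mu> k m S r A \<in> borel_measurable (\<Pi>\<^sub>M i\<in>{..<k}. borel)"
  unfolding mean_far_len_def
  by (rule nn_integral_measurable_subprob_algebra2[OF _ measurable_fdd_kernel])
    (use measurable_far_len[OF assms] in \<open>simp add: case_prod_beta\<close>)

text \<open>
  Feasible subnetworks have finite length in discs, and finitely many routes lie in one disc.
\<close>

lemma total_length_finite:
  "AE \<omega> in M. \<forall>n. len (\<Union>p\<in>offdiag {..<n}. R p \<omega>) < \<infinity>"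
  unfolding AE_all_countable
proof
  fix n
  let ?S = "span_space n"
  let ?L = "\<lambda>\<rho>. len (\<Union>p\<in>offdiag {..<n}. \<rho> p)"
  have N: "(\<lambda>\<rho>. \<Union>p\<in>offdiag {..<n}. \<rho> p) \<in> ?S \<rightarrow>\<^sub>M route_space"
    by (intro measurable_route_UN) (auto intro: measurable_component_singleton)
  have [measurable]: "?L \<in> borel_measurable ?S"
    using measurable_compose[OF N borel_measurable_len_route] .
  define G where "G = {\<rho> \<in> space ?S. ?L \<rho> < \<infinity>}"
  have G: "G \<in> sets ?S" unfolding G_def by measurable
  let ?R = "\<lambda>\<omega>. \<lambda>p\<in>offdiag {..<n}. R p \<omega>"
  have R: "?R \<in> M \<rightarrow>\<^sub>M ?S"
    by (intro measurable_restrict measurable_routes) (auto simp: offdiag_def)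
  have "emeasure M {\<omega>\<in>space M. ?R \<omega> \<in> G} = emeasure M {\<omega>\<in>space M. (\<lambda>i. X i \<omega>) \<in> space (\<Pi>\<^sub>M i\<in>UNIV. borel) \<and> ?R \<omega> \<in> G}"
    by (simp add: space_PiM)
  also have "\<dots> = (\<integral>\<^sup>+\<omega>. indicator (space (\<Pi>\<^sub>M i\<in>UNIV. borel)) (\<lambda>i. X i \<omega>) * emeasure (\<mu> (map (\<lambda>i. fst (X i \<omega>)) [0..<n])) G \<partial>M)"
    by (rule conditional_law[OF sets.top G])
  also have "\<dots> = (\<integral>\<^sup>+\<omega>. 1 \<partial>M)"
  proof (rule nn_integral_cong_AE, use distinct_positions in eventually_elim)
    case (elim \<omega>)
    let ?zs = "map (\<lambda>i. fst (X i \<omega>)) [0..<n]"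
    have d: "distinct ?zs" using elim by (auto simp: distinct_map inj_on_def inj_def)
    interpret P: prob_space "\<mu> ?zs" by (rule prob_space_fdd[OF d])
    have s: "sets (\<mu> ?zs) = sets ?S" using sets_fdd[OF d] by simp
    have "AE \<rho> in \<mu> ?zs. \<rho> \<in> G"
      using feasible[OF d] AE_space
    proof eventually_elim
      case (elim \<rho>)
      then have sp: "\<rho> \<in> space ?S" using sets_eq_imp_space_eq[OF s] by simp
      then have "compact (\<rho> p)" if "p \<in> offdiag {..<n}" for p
        using that by (auto simp: space_PiM space_route_space PiE_iff)
      then have "compact (\<Union>p\<in>offdiag {..<n}. \<rho> p)" by (intro compact_UN) auto
      then obtain r where "\<forall>x\<in>(\<Union>p\<in>offdiag {..<n}. \<rho> p). norm x \<le> r"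
        using compact_imp_bounded bounded_iff by metis
      then have "(\<Union>p\<in>offdiag {..<n}. \<rho> p) \<subseteq> cball 0 r" by auto
      then have "(\<Union>p\<in>offdiag {..<n}. \<rho> p) \<inter> cball 0 r = (\<Union>p\<in>offdiag {..<n}. \<rho> p)" by blast
      moreover have "len ((\<Union>p\<in>offdiag {..<n}. \<rho> p) \<inter> cball 0 r) < \<infinity>"
        using elim(1) by (simp add: feasible_subnetwork_def)
      ultimately show ?case using sp by (simp add: G_def)
    qed
    then have "emeasure (\<mu> ?zs) G = 1"
      using G s by (intro P.emeasure_eq_1_AE) auto
    then show ?case by (simp add: space_PiM)
  qed
  also have "\<dots> = 1" by (simp add: emeasure_space_1)
  finally have "emeasure M {\<omega>\<in>space M. ?R \<omega> \<in> G} = 1" .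
  moreover have "{\<omega>\<in>space M. ?R \<omega> \<in> G} \<in> sets M"
    using measurable_sets[OF R G] by (simp add: vimage_def Int_def conj_commute)
  ultimately have "AE \<omega> in M. \<omega> \<in> {\<omega>\<in>space M. ?R \<omega> \<in> G}"
    by (subst AE_in_set_eq_1) (simp_all add: emeasure_eq_measure)
  then show "AE \<omega> in M. len (\<Union>p\<in>offdiag {..<n}. R p \<omega>) < \<infinity>"
    by eventually_elim (simp add: G_def)
qed

text \<open>
  The mean length of the part in \<open>A\<close> of the points covered by \<open>m\<close> disjoint pairs among those
  that have arrived in \<open>B\<close> by time \<open>s\<close>, computed from the points that have arrived by time \<open>t\<close>.
\<close>

lemma window_mean:
  assumes B: "B \<in> sets borel" "emeasure lborel B < \<infinity>" and st: "0 \<le> s" "s \<le> t"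
    and A: "A \<in> sets borel" and m: "0 < m"
  shows "\<exists>H\<in>borel_measurable M.
     (AE \<omega> in M. len (many_far m (window X B s \<omega>) (\<lambda>i. fst (X i \<omega>)) (\<lambda>p. R p \<omega>) r \<inter> A) = H \<omega>) \<and>
     (\<integral>\<^sup>+\<omega>. H \<omega> \<partial>M) = marked_mean \<mu> m B t s r A"
proof -
  let ?F = "\<lambda>\<omega>. len (many_far m (window X B s \<omega>) (\<lambda>i. fst (X i \<omega>)) (\<lambda>p. R p \<omega>) r \<inter> A)"
  \<comment> \<open>The length is read off from every enumeration of the window; there are \<open>fact k\<close> of them, and each
    has exactly one mark set \<open>S\<close>.\<close>
  define h where "h k S is \<omega> = (if distinct is \<and> length is = k
     then indicator {\<omega>\<in>space M. enumerates X B t s k S is \<omega>} \<omega> *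
       far_len k m S r A (positions X k is \<omega>, route_tuple R k is \<omega>) else 0 :: ennreal)" for k S "is" \<omega>
  have h [measurable]: "h k S is \<in> borel_measurable M" if S: "S \<in> Pow {..<k}" for k S "is"
  proof (cases "distinct is \<and> length is = k")
    case True
    have "far_len k m S r A \<in> borel_measurable ((\<Pi>\<^sub>M i\<in>{..<k}. borel) \<Otimes>\<^sub>M span_space k)"
      using S A m by (intro measurable_far_len) auto
    note [measurable] = this measurable_route_tuple[of "is" k] measurable_positions[OF measurable_X]
      pred_enumerates[OF measurable_X B(1)]
    have [measurable]: "route_tuple R k is \<in> M \<rightarrow>\<^sub>M span_space k"
      using True by (intro measurable_route_tuple) auto
    show ?thesis using True unfolding h_def by simp
  next
    case False
    then have "h k S is = (\<lambda>_. 0)" by (auto simp: h_def fun_eq_iff)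
    then show ?thesis by simp
  qed
  define H where "H \<omega> = (\<Sum>k. ennreal (1 / fact k) * (\<integral>\<^sup>+is. (\<Sum>S\<in>Pow {..<k}. h k S is \<omega>) \<partial>count_space UNIV))" for \<omega>
  have Hm [measurable]: "(\<lambda>\<omega>. \<integral>\<^sup>+is. (\<Sum>S\<in>Pow {..<k}. h k S is \<omega>) \<partial>count_space UNIV) \<in> borel_measurable M" for k
  proof -
    interpret C: sigma_finite_measure "count_space (UNIV :: nat list set)"
      by (rule sigma_finite_measure_count_space)
    have "(\<lambda>w. \<Sum>S\<in>Pow {..<k}. h k S (snd w) (fst w)) \<in> borel_measurable (M \<Otimes>\<^sub>M count_space UNIV)"
      by (subst measurable_pair_swap_iff)
        (auto simp: case_prod_beta intro!: measurable_pair_measure_countable1)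
    then show ?thesis
      by (intro C.borel_measurable_nn_integral) (simp add: case_prod_beta)
  qed
  have "H \<in> borel_measurable M" unfolding H_def by measurable
  moreover have "AE \<omega> in M. ?F \<omega> = H \<omega>"
    using AE_space window_finite[OF poisson B, of t] total_length_finite
  proof eventually_elim
    case (elim \<omega>)
    let ?J = "window X B t \<omega>"
    let ?En = "{is. distinct is \<and> set is = ?J}"
    have sum_h: "(\<Sum>S\<in>Pow {..<k}. h k S is \<omega>) = (if k = card ?J then ?F \<omega> * indicator ?En is else 0)" for k "is"
    proof (cases "distinct is \<and> set is = ?J \<and> length is = k")
      case True
      define S where "S = {a. a < k \<and> snd (X (is ! a) \<omega>) \<le> s}"
      have S: "S \<in> Pow {..<k}" by (auto simp: S_def)
      have en: "enumerates X B t s k T is \<omega> \<longleftrightarrow> T = S" if "T \<in> Pow {..<k}" for T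
        using True that by (auto simp: enumerates_def S_def)
      have k: "k = card ?J" using True distinct_card[of "is"] by simp
      have len: "len (\<Union>p\<in>offdiag {..<k}. route_tuple R k is \<omega> p) < \<infinity>"
      proof -
        obtain n where n: "set is \<subseteq> {..<n}" using finite_nat_set_iff_bounded[of "set is"] by auto
        have "(\<Union>p\<in>offdiag {..<k}. route_tuple R k is \<omega> p) \<subseteq> (\<Union>p\<in>offdiag {..<n}. R p \<omega>)"
        proof
          fix x assume "x \<in> (\<Union>p\<in>offdiag {..<k}. route_tuple R k is \<omega> p)"
          then obtain a b where ab: "a < k" "b < k" "a \<noteq> b" "x \<in> R (is ! a, is ! b) \<omega>"
            by (auto simp: route_tuple_def offdiag_def)
          have "is ! a \<in> set is" "is ! b \<in> set is"
            using ab(1,2) True nth_mem[of _ "is"] by blast+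
          moreover have "is ! a \<noteq> is ! b"
            using ab(1-3) True nth_eq_iff_index_eq[of "is" a b] by metis
          ultimately have "is ! a < n" "is ! b < n" "is ! a \<noteq> is ! b" using n by (meson lessThan_iff subsetD)+
          then have "(is ! a, is ! b) \<in> offdiag {..<n}" by (simp add: offdiag_def)
          then show "x \<in> (\<Union>p\<in>offdiag {..<n}. R p \<omega>)" using ab(4) by (rule UN_I)
        qed
        from len_mono[OF this] show ?thesis using elim(3) by (meson order_le_less_trans)
      qed
      have "(\<Sum>S\<in>Pow {..<k}. h k S is \<omega>) = (\<Sum>T\<in>{S}. h k T is \<omega>)"
        using S en by (intro sum.mono_neutral_right) (auto simp: h_def)
      also have "\<dots> = far_len k m S r A (positions X k is \<omega>, route_tuple R k is \<omega>)"
        using True en[OF S] elim(1) by (simp add: h_def)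
      also have "\<dots> = ?F \<omega>"
        using len many_far_enumerates[OF iffD2[OF en[OF S] refl] _ st(2), of m R r] S by (simp add: far_len_def)
      finally show ?thesis using k True by simp
    next
      case False
      then have "\<not> enumerates X B t s k S is \<omega> \<or> \<not> (distinct is \<and> length is = k)" for S
        by (auto simp only: enumerates_def)
      then have "h k S is \<omega> = 0" for S by (auto simp: h_def)
      moreover have "k = card ?J \<Longrightarrow> is \<notin> ?En" using False distinct_card[of "is"] by auto
      ultimately show ?thesis by simp
    qed
    have "H \<omega> = (\<Sum>k. if k = card ?J then ennreal (1 / fact k) * (\<integral>\<^sup>+is. ?F \<omega> * indicator ?En is \<partial>count_space UNIV) else 0)"
      unfolding H_def sum_h by (intro suminf_cong) auto
    also have "\<dots> = ennreal (1 / fact (card ?J)) * (\<integral>\<^sup>+is. ?F \<omega> * indicator ?En is \<partial>count_space UNIV)"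
      by (subst suminf_finite[of "{card ?J}"]) auto
    also have "(\<integral>\<^sup>+is. ?F \<omega> * indicator ?En is \<partial>count_space UNIV) = ?F \<omega> * emeasure (count_space UNIV) ?En"
      by (rule nn_integral_cmult_indicator) simp
    also have "emeasure (count_space UNIV) ?En = ennreal (fact (card ?J))"
      using card_enumerations[OF elim(2)] by (simp add: emeasure_count_space ennreal_of_nat_eq_real_of_nat)
    also have "ennreal (1 / fact (card ?J)) * (?F \<omega> * ennreal (fact (card ?J))) =
        (ennreal (1 / fact (card ?J)) * ennreal (fact (card ?J))) * ?F \<omega>"
      by (simp only: mult_ac)
    also have "\<dots> = ?F \<omega>" by (subst ennreal_mult[symmetric]) auto
    finally show ?case by simp
  qed
  moreover have "(\<integral>\<^sup>+\<omega>. H \<omega> \<partial>M) = marked_mean \<mu> m B t s r A"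
  proof -
    have "(\<integral>\<^sup>+\<omega>. H \<omega> \<partial>M) = (\<Sum>k. ennreal (1 / fact k) * (\<integral>\<^sup>+\<omega>. \<integral>\<^sup>+is. (\<Sum>S\<in>Pow {..<k}. h k S is \<omega>) \<partial>count_space UNIV \<partial>M))"
      unfolding H_def by (subst nn_integral_suminf) (auto simp: nn_integral_cmult)
    also have "\<dots> = (\<Sum>k. ennreal (1 / fact k) * (\<Sum>S\<in>Pow {..<k}. \<integral>\<^sup>+is. \<integral>\<^sup>+\<omega>. h k S is \<omega> \<partial>M \<partial>count_space UNIV))"
    proof (intro suminf_cong arg_cong2[of _ _ _ _ "(*)"] refl)
      fix k :: nat
      have "(\<integral>\<^sup>+\<omega>. \<integral>\<^sup>+is. (\<Sum>S\<in>Pow {..<k}. h k S is \<omega>) \<partial>count_space UNIV \<partial>M) =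
        (\<integral>\<^sup>+is. \<integral>\<^sup>+\<omega>. (\<Sum>S\<in>Pow {..<k}. h k S is \<omega>) \<partial>M \<partial>count_space UNIV)"
        by (intro nn_integral_count_space_nn_integral) auto
      also have "\<dots> = (\<integral>\<^sup>+is. (\<Sum>S\<in>Pow {..<k}. \<integral>\<^sup>+\<omega>. h k S is \<omega> \<partial>M) \<partial>count_space UNIV)"
        by (intro nn_integral_cong nn_integral_sum) auto
      also have "\<dots> = (\<Sum>S\<in>Pow {..<k}. \<integral>\<^sup>+is. \<integral>\<^sup>+\<omega>. h k S is \<omega> \<partial>M \<partial>count_space UNIV)"
        by (intro nn_integral_sum) auto
      finally show "(\<integral>\<^sup>+\<omega>. \<integral>\<^sup>+is. (\<Sum>S\<in>Pow {..<k}. h k S is \<omega>) \<partial>count_space UNIV \<partial>M) =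
        (\<Sum>S\<in>Pow {..<k}. \<integral>\<^sup>+is. \<integral>\<^sup>+\<omega>. h k S is \<omega> \<partial>M \<partial>count_space UNIV)" .
    qed
    also have "\<dots> = marked_mean \<mu> m B t s r A"
      unfolding marked_mean_def
    proof (intro suminf_cong arg_cong2[of _ _ _ _ "(*)"] refl sum.cong)
      fix k S assume S: "S \<in> Pow {..<k::nat}"
      have "(\<integral>\<^sup>+is. \<integral>\<^sup>+\<omega>. h k S is \<omega> \<partial>M \<partial>count_space UNIV) =
        (\<integral>\<^sup>+is. \<integral>\<^sup>+\<omega>. indicator {\<omega>\<in>space M. enumerates X B t s k S is \<omega>} \<omega> *
            mean_far_len \<mu> k m S r A (positions X k is \<omega>) \<partial>M \<partial>count_space UNIV)"
      proof (rule nn_integral_cong)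
        fix "is" :: "nat list"
        show "(\<integral>\<^sup>+\<omega>. h k S is \<omega> \<partial>M) = (\<integral>\<^sup>+\<omega>. indicator {\<omega>\<in>space M. enumerates X B t s k S is \<omega>} \<omega> *
            mean_far_len \<mu> k m S r A (positions X k is \<omega>) \<partial>M)"
        proof (cases "distinct is \<and> length is = k")
          case True
          then show ?thesis
            using nn_integral_route_tuple[of "is" k B "far_len k m S r A" t s S] B measurable_far_len[of S k A m r] S A m
            by (simp add: h_def mean_far_len_def)
        next
          case False
          then have "\<not> enumerates X B t s k S is \<omega>" for \<omega> by (auto simp: enumerates_def)
          moreover have "h k S is = (\<lambda>_. 0)" using False by (auto simp: h_def fun_eq_iff)
          ultimately show ?thesis by simp
        qed
      qed
      also have "\<dots> = ennreal (s ^ card S * (t - s) ^ (k - card S) * exp (- t * measure lborel B)) *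
        (\<integral>\<^sup>+z. indicator (({..<k} \<rightarrow>\<^sub>E B) \<inter> distinct_tuples k) z * mean_far_len \<mu> k m S r A z
          \<partial>(\<Pi>\<^sub>M i\<in>{..<k}. lborel))"
        using S A m
        by (intro janossy[OF prob_space_axioms poisson distinct_positions B st] measurable_mean_far_len) auto
      finally show "(\<integral>\<^sup>+is. \<integral>\<^sup>+\<omega>. h k S is \<omega> \<partial>M \<partial>count_space UNIV) = \<dots>" .
    qed
    finally show ?thesis .
  qed
  ultimately show ?thesis by blast
qed

end

section \<open>The whole plane\<close>

lemma sets_many_far:
  fixes J :: "nat set"
  assumes "\<And>p. p \<in> offdiag J \<Longrightarrow> \<rho> p \<in> sets borel"
  shows "many_far m J z \<rho> r \<in> sets borel"
proof -
  define \<Q> where "\<Q> = {Q. Q \<subseteq> offdiag J \<and> finite Q \<and> card Q = m \<and>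
     (\<forall>p\<in>Q. \<forall>q\<in>Q. p \<noteq> q \<longrightarrow> {fst p, snd p} \<inter> {fst q, snd q} = {})}"
  have "countable {Q. finite Q \<and> Q \<subseteq> (UNIV :: (nat \<times> nat) set)}"
    by (rule countable_Collect_finite_subset) simp
  then have "countable \<Q>" by (rule countable_subset[rotated]) (auto simp: \<Q>_def)
  moreover have "{x. \<forall>p\<in>Q. x \<in> \<rho> p \<and> r < dist x (z (fst p)) \<and> r < dist x (z (snd p))} \<in> sets borel"
    if Q: "Q \<in> \<Q>" for Q
  proof -
    have "{x \<in> space borel. \<forall>p\<in>Q. x \<in> \<rho> p \<and> r < dist x (z (fst p)) \<and> r < dist x (z (snd p))} \<in> sets borel"
    proof (rule sets.sets_Collect_finite_All)
      fix p assume "p \<in> Q"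
      moreover have "Q \<subseteq> offdiag J" using Q by (simp add: \<Q>_def)
      ultimately have [measurable]: "\<rho> p \<in> sets borel" using assms[of p] by blast
      show "{x \<in> space borel. x \<in> \<rho> p \<and> r < dist x (z (fst p)) \<and> r < dist x (z (snd p))} \<in> sets borel"
        by measurable
    qed (use Q in \<open>simp add: \<Q>_def\<close>)
    then show ?thesis by simp
  qed
  ultimately show ?thesis unfolding many_far_eq_UN \<Q>_def[symmetric] by (intro sets.countable_UN') auto
qed

lemma many_far_UN:
  assumes "incseq J"
  shows "many_far m (\<Union>n. J n) z \<rho> r = (\<Union>n. many_far m (J n) z \<rho> r)"
proof
  show "many_far m (\<Union>n. J n) z \<rho> r \<subseteq> (\<Union>n. many_far m (J n) z \<rho> r)"
  proof
    fix x assume "x \<in> many_far m (\<Union>n. J n) z \<rho> r"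
    then obtain Q where Q: "Q \<subseteq> offdiag (\<Union>n. J n)" "finite Q" "card Q = m"
      "\<forall>p q. p \<in> Q \<longrightarrow> q \<in> Q \<longrightarrow> p \<noteq> q \<longrightarrow> {fst p, snd p} \<inter> {fst q, snd q} = {}"
      "\<forall>i j. (i, j) \<in> Q \<longrightarrow> x \<in> \<rho> (i, j) \<and> r < dist x (z i) \<and> r < dist x (z j)"
      by (rule many_farE)
    have "\<forall>p\<in>Q. \<exists>n. fst p \<in> J n \<and> snd p \<in> J n"
    proof
      fix p assume "p \<in> Q"
      then obtain n n' where "fst p \<in> J n" "snd p \<in> J n'" using Q(1) by (fastforce simp: offdiag_def)
      then have "fst p \<in> J (max n n')" "snd p \<in> J (max n n')"
        using incseqD[OF assms, of n "max n n'"] incseqD[OF assms, of n' "max n n'"] by auto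
      then show "\<exists>n. fst p \<in> J n \<and> snd p \<in> J n" by blast
    qed
    then obtain N where N: "\<And>p. p \<in> Q \<Longrightarrow> fst p \<in> J (N p) \<and> snd p \<in> J (N p)" by metis
    obtain n where n: "\<And>p. p \<in> Q \<Longrightarrow> N p < n"
      using finite_nat_set_iff_bounded[of "N ` Q"] Q(2) by auto
    have "Q \<subseteq> offdiag (J n)"
    proof
      fix p assume p: "p \<in> Q"
      then have "fst p \<in> J n" "snd p \<in> J n"
        using N[OF p] incseqD[OF assms less_imp_le[OF n[OF p]]] by auto
      then show "p \<in> offdiag (J n)" using Q(1) p by (auto simp: offdiag_def)
    qed
    then have "x \<in> many_far m (J n) z \<rho> r"
      using Q by (intro many_farI[of Q]) blast+
    then show "x \<in> (\<Union>n. many_far m (J n) z \<rho> r)" by blast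
  qed
  show "(\<Union>n. many_far m (J n) z \<rho> r) \<subseteq> many_far m (\<Union>n. J n) z \<rho> r"
    by (intro UN_least many_far_mono) auto
qed

subsection \<open>Behaviour under similarities\<close>

text \<open>
  Translations and scalings of the plane together.
\<close>

definition similarity :: "complex \<Rightarrow> real \<Rightarrow> complex \<Rightarrow> complex" where
  "similarity a c z = a + of_real c * z"

lemma dist_similarity: "0 < c \<Longrightarrow> dist (similarity a c x) (similarity a c y) = c * dist x y"
  by (simp add: similarity_def dist_norm right_diff_distrib[symmetric] norm_mult)

lemma inj_similarity: "0 < c \<Longrightarrow> inj (similarity a c)"
  by (auto simp: inj_def similarity_def)

lemma len_similarity: "0 < c \<Longrightarrow> len (similarity a c ` A) = ennreal c * len A"
  unfolding similarity_def by (rule len_image_similarity)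

lemma surj_similarity: "0 < c \<Longrightarrow> range (similarity a c) = UNIV"
  by (rule surjI[where f="\<lambda>w. (w - a) / of_real c"]) (simp add: similarity_def)

lemma continuous_on_similarity: "continuous_on S (similarity a c)"
  unfolding similarity_def by (intro continuous_intros)

lemma measurable_similarity [measurable]: "similarity a c \<in> borel_measurable borel"
  by (intro borel_measurable_continuous_onI continuous_on_similarity)

lemma similarity_image_eq_vimage:
  assumes "0 < c"
  shows "similarity a c ` A = (\<lambda>w. (w - a) / of_real c) -` A"
proof -
  have "similarity a c ((w - a) / of_real c) = w" for w
    using assms by (simp add: similarity_def)
  moreover have "(similarity a c z - a) / of_real c = z" for z
    using assms by (simp add: similarity_def)
  note inv = this calculation
  show ?thesis
  proof (intro set_eqI iffI)
    fix w assume "w \<in> similarity a c ` A"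
    then show "w \<in> (\<lambda>w. (w - a) / of_real c) -` A" using inv by auto
  next
    fix w assume w: "w \<in> (\<lambda>w. (w - a) / of_real c) -` A"
    show "w \<in> similarity a c ` A"
      by (rule image_eqI[of _ _ "(w - a) / of_real c"]) (use w inv in auto)
  qed
qed

lemma sets_similarity_image:
  assumes "0 < c" "A \<in> sets borel"
  shows "similarity a c ` A \<in> sets borel"
proof -
  have "(\<lambda>w. (w - a) / of_real c) \<in> borel_measurable borel"
    by measurable
  from measurable_sets[OF this assms(2)] show ?thesis
    by (simp add: similarity_image_eq_vimage[OF assms(1)])
qed

lemma emeasure_lborel_similarity_vimage:
  assumes "0 < c" "A \<in> sets borel"
  shows "emeasure lborel A = ennreal (c\<^sup>2) * emeasure lborel (similarity a c -` A)"
proof -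
  have eq: "similarity a c = (\<lambda>x. a + c *\<^sub>R x)" by (simp add: similarity_def fun_eq_iff scaleR_conv_of_real)
  have "emeasure lborel A = emeasure (density (distr lborel borel (similarity a c)) (\<lambda>_. \<bar>c\<bar>^DIM(complex))) A"
    using assms(1) unfolding eq by (subst lborel_affine[of c a]) auto
  also have "\<dots> = ennreal (c\<^sup>2) * emeasure lborel (similarity a c -` A)"
    using assms by (simp add: emeasure_density_const emeasure_distr)
  finally show ?thesis .
qed

lemma emeasure_lborel_similarity:
  assumes "0 < c" "A \<in> sets borel"
  shows "emeasure lborel (similarity a c ` A) = ennreal (c\<^sup>2) * emeasure lborel A"
  using emeasure_lborel_similarity_vimage[OF assms(1) sets_similarity_image[OF assms], of a a]
  by (simp add: inj_vimage_image_eq inj_similarity assms)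

definition similarity_tuple :: "complex \<Rightarrow> real \<Rightarrow> nat \<Rightarrow> (nat \<Rightarrow> complex) \<Rightarrow> nat \<Rightarrow> complex" where
  "similarity_tuple a c k z = (\<lambda>i\<in>{..<k}. similarity a c (z i))"

lemma measurable_similarity_tuple:
  "similarity_tuple a c k \<in> (\<Pi>\<^sub>M i\<in>{..<k}. lborel) \<rightarrow>\<^sub>M (\<Pi>\<^sub>M i\<in>{..<k}. lborel)"
  unfolding similarity_tuple_def by measurable

lemma nn_integral_similarity_tuple:
  assumes c: "0 < c" and G: "G \<in> borel_measurable (\<Pi>\<^sub>M i\<in>{..<k}. borel)"
  shows "(\<integral>\<^sup>+z. G z \<partial>(\<Pi>\<^sub>M i\<in>{..<k}. lborel)) =
    ennreal (c ^ (2 * k)) * (\<integral>\<^sup>+z. G (similarity_tuple a c k z) \<partial>(\<Pi>\<^sub>M i\<in>{..<k}. lborel))"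
proof -
  interpret L: product_sigma_finite "\<lambda>_::nat. lborel :: complex measure" ..
  let ?L = "\<Pi>\<^sub>M i\<in>{..<k}. (lborel :: complex measure)"
  have sets_L: "sets ?L = sets (\<Pi>\<^sub>M i\<in>{..<k}. borel)" by (intro sets_PiM_cong) auto
  have [measurable]: "G \<in> borel_measurable ?L" using G by (simp cong: measurable_cong_sets add: sets_L)
  note [measurable] = measurable_similarity_tuple
  have "density (distr ?L ?L (similarity_tuple a c k)) (\<lambda>_. ennreal (c ^ (2 * k))) = ?L"
  proof (rule L.PiM_eqI)
    fix A :: "nat \<Rightarrow> complex set" assume A: "\<And>i. i \<in> {..<k} \<Longrightarrow> A i \<in> sets lborel"
    have box: "Pi\<^sub>E {..<k} A \<in> sets ?L" using A by (intro sets_PiM_I_finite) auto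
    have "similarity_tuple a c k -` Pi\<^sub>E {..<k} A \<inter> space ?L = (\<Pi>\<^sub>E i\<in>{..<k}. similarity a c -` A i)"
      by (auto simp: similarity_tuple_def space_PiM PiE_iff)
    then have "emeasure (density (distr ?L ?L (similarity_tuple a c k)) (\<lambda>_. ennreal (c ^ (2 * k)))) (Pi\<^sub>E {..<k} A) =
       ennreal (c ^ (2 * k)) * emeasure ?L (\<Pi>\<^sub>E i\<in>{..<k}. similarity a c -` A i)"
      using box by (simp add: emeasure_density_const emeasure_distr)
    also have "emeasure ?L (\<Pi>\<^sub>E i\<in>{..<k}. similarity a c -` A i) = (\<Prod>i<k. emeasure lborel (similarity a c -` A i))"
      using A measurable_sets[OF measurable_similarity] by (intro L.emeasure_PiM) auto
    also have "ennreal (c ^ (2 * k)) * (\<Prod>i<k. emeasure lborel (similarity a c -` A i)) =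
       (\<Prod>i<k. ennreal (c\<^sup>2) * emeasure lborel (similarity a c -` A i))"
      using c by (simp add: prod.distrib power_mult ennreal_power)
    also have "\<dots> = (\<Prod>i<k. emeasure lborel (A i))"
      using A by (intro prod.cong refl emeasure_lborel_similarity_vimage[OF c, symmetric]) auto
    finally show "emeasure (density (distr ?L ?L (similarity_tuple a c k)) (\<lambda>_. ennreal (c ^ (2 * k)))) (Pi\<^sub>E {..<k} A) =
      (\<Prod>i\<in>{..<k}. emeasure lborel (A i))" .
  qed auto
  then have "(\<integral>\<^sup>+z. G z \<partial>?L) = (\<integral>\<^sup>+z. G z \<partial>density (distr ?L ?L (similarity_tuple a c k)) (\<lambda>_. ennreal (c ^ (2 * k))))"
    by simp
  also have "\<dots> = ennreal (c ^ (2 * k)) * (\<integral>\<^sup>+z. G (similarity_tuple a c k z) \<partial>?L)"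
    by (simp add: nn_integral_density nn_integral_cmult nn_integral_distr)
  finally show ?thesis .
qed

lemma measurable_map_routes:
  assumes f: "continuous_on UNIV f"
  shows "map_routes f k \<in> span_space k \<rightarrow>\<^sub>M span_space k"
  unfolding map_routes_def
proof (rule measurable_restrict)
  fix p assume p: "p \<in> offdiag {..<k}"
  have f': "(\<lambda>A. f ` A) \<in> route_space \<rightarrow>\<^sub>M route_space"
  proof (rule measurable_route_spaceI)
    fix A assume "A \<in> space route_space"
    then show "compact (f ` A)"
      using continuous_on_subset[OF f] by (auto simp: space_route_space intro: compact_continuous_image)
  next
    fix U :: "complex set" assume "open U"
    then have "open (f -` U)" using f by (rule open_vimage)
    then have "{A. compact A \<and> A \<inter> (f -` U) \<noteq> {}} \<in> sets route_space" by (rule sets_route_space_hits)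
    then show "{A \<in> space route_space. f ` A \<inter> U \<noteq> {}} \<in> sets route_space"
      by (rule back_subst[of "\<lambda>A. A \<in> sets route_space"]) (auto simp: space_route_space)
  qed
  show "(\<lambda>\<rho>. f ` \<rho> p) \<in> span_space k \<rightarrow>\<^sub>M route_space"
    using measurable_compose[OF measurable_component_singleton[OF p] f'] .
qed

lemma (in random_routes) similarity_invariant:
  assumes zs: "distinct zs" and c: "0 < c"
  shows "\<mu> (map (similarity a c) zs) =
    distr (\<mu> zs) (span_space (length zs)) (map_routes (similarity a c) (length zs))"
proof -
  let ?k = "length zs" and ?m = "\<lambda>z. of_real c * z"
  have d: "distinct (map ?m zs)" using zs c by (auto simp: distinct_map inj_on_def)
  have m1: "map_routes ?m ?k \<in> \<mu> zs \<rightarrow>\<^sub>M span_space ?k"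
    using measurable_map_routes[of ?m ?k] sets_fdd[OF zs]
    by (auto simp: continuous_intros cong: measurable_cong_sets)
  have m2: "map_routes (\<lambda>z. a + z) ?k \<in> span_space ?k \<rightarrow>\<^sub>M span_space ?k"
    by (intro measurable_map_routes continuous_intros)
  have "\<mu> (map (similarity a c) zs) = \<mu> (map (\<lambda>z. a + z) (map ?m zs))"
    by (simp add: similarity_def[abs_def] o_def)
  also have "\<dots> = distr (\<mu> (map ?m zs)) (span_space ?k) (map_routes (\<lambda>z. a + z) ?k)"
    using translation_invariant[OF d] by simp
  also have "\<dots> = distr (distr (\<mu> zs) (span_space ?k) (map_routes ?m ?k)) (span_space ?k) (map_routes (\<lambda>z. a + z) ?k)"
    using scale_invariant[OF zs c] by simp
  also have "\<dots> = distr (\<mu> zs) (span_space ?k) (map_routes (\<lambda>z. a + z) ?k \<circ> map_routes ?m ?k)"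
    by (rule distr_distr[OF m2 m1])
  also have "map_routes (\<lambda>z. a + z) ?k \<circ> map_routes ?m ?k = map_routes (similarity a c) ?k"
    by (auto simp: fun_eq_iff map_routes_def similarity_def[abs_def] image_image)
  finally show ?thesis .
qed

lemma many_far_similarity:
  assumes S: "S \<subseteq> {..<k}" and c: "0 < c"
  shows "many_far m S (similarity_tuple a c k z) (map_routes (similarity a c) k \<rho>) (c * r) =
    similarity a c ` many_far m S z \<rho> r"
proof (rule set_eqI)
  fix y
  obtain x where y: "y = similarity a c x" using surj_similarity[OF c, of a] by (metis rangeE UNIV_I)
  define \<Q> where "\<Q> = {Q. Q \<subseteq> offdiag S \<and> finite Q \<and> card Q = m \<and>
     (\<forall>p\<in>Q. \<forall>q\<in>Q. p \<noteq> q \<longrightarrow> {fst p, snd p} \<inter> {fst q, snd q} = {})}"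
  have "y \<in> map_routes (similarity a c) k \<rho> p \<and> c * r < dist y (similarity_tuple a c k z (fst p)) \<and>
      c * r < dist y (similarity_tuple a c k z (snd p)) \<longleftrightarrow>
      x \<in> \<rho> p \<and> r < dist x (z (fst p)) \<and> r < dist x (z (snd p))"
    if Q: "Q \<in> \<Q>" "p \<in> Q" for Q p
  proof -
    have "p \<in> offdiag S" using Q by (auto simp: \<Q>_def)
    then have p: "p \<in> offdiag {..<k}" "fst p < k" "snd p < k" using S by (auto simp: offdiag_def)
    show ?thesis
      using p c by (simp add: y map_routes_def similarity_tuple_def dist_similarity
        inj_image_mem_iff[OF inj_similarity[OF c]])
  qed
  then have "y \<in> many_far m S (similarity_tuple a c k z) (map_routes (similarity a c) k \<rho>) (c * r) \<longleftrightarrow>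
      x \<in> many_far m S z \<rho> r"
    unfolding many_far_eq_UN \<Q>_def[symmetric] by simp
  then show "y \<in> many_far m S (similarity_tuple a c k z) (map_routes (similarity a c) k \<rho>) (c * r) \<longleftrightarrow>
      y \<in> similarity a c ` many_far m S z \<rho> r"
    by (simp add: y inj_image_mem_iff[OF inj_similarity[OF c]])
qed

lemma far_len_similarity:
  assumes S: "S \<subseteq> {..<k}" and c: "0 < c"
  shows "far_len k m S (c * r) (similarity a c ` A) (similarity_tuple a c k z, map_routes (similarity a c) k \<rho>) =
    ennreal c * far_len k m S r A (z, \<rho>)"
proof -
  have "(\<Union>p\<in>offdiag {..<k}. map_routes (similarity a c) k \<rho> p) = similarity a c ` (\<Union>p\<in>offdiag {..<k}. \<rho> p)"
    by (auto simp: map_routes_def)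
  then have "len (\<Union>p\<in>offdiag {..<k}. map_routes (similarity a c) k \<rho> p) = ennreal c * len (\<Union>p\<in>offdiag {..<k}. \<rho> p)"
    using c by (simp add: len_similarity)
  moreover have "ennreal c * x < \<infinity> \<longleftrightarrow> x < \<infinity>" for x
    using c by (auto simp: ennreal_mult_less_top)
  moreover have "similarity a c ` many_far m S z \<rho> r \<inter> similarity a c ` A = similarity a c ` (many_far m S z \<rho> r \<inter> A)"
    by (rule image_Int[symmetric, OF inj_similarity[OF c]])
  ultimately show ?thesis
    using c by (simp add: far_len_def many_far_similarity[OF S c] len_similarity)
qed

context poisson_sampled_routes
begin

lemma mean_far_len_similarity:
  assumes z: "z \<in> distinct_tuples k" and S: "S \<subseteq> {..<k}" and c: "0 < c" and A: "A \<in> sets borel" and m: "0 < m"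
  shows "mean_far_len \<mu> k m S (c * r) (similarity a c ` A) (similarity_tuple a c k z) =
    ennreal c * mean_far_len \<mu> k m S r A z"
proof -
  have inj: "inj_on z {..<k}" using z by (simp add: distinct_tuples_def)
  have zs: "z \<in> space (\<Pi>\<^sub>M i\<in>{..<k}. borel)" using z by (simp add: distinct_tuples_def space_PiM)
  have zs': "similarity_tuple a c k z \<in> space (\<Pi>\<^sub>M i\<in>{..<k}. borel)" by (simp add: similarity_tuple_def space_PiM)
  have inj': "inj_on (similarity_tuple a c k z) {..<k}"
    using inj injD[OF inj_similarity[OF c]] by (auto simp: inj_on_def similarity_tuple_def)
  have d: "distinct (map z [0..<k])" using inj by (auto simp: distinct_map atLeast0LessThan)
  have "map (similarity_tuple a c k z) [0..<k] = map (similarity a c) (map z [0..<k])"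
    by (simp add: similarity_tuple_def)
  then have K: "fdd_kernel \<mu> k (similarity_tuple a c k z) =
      distr (fdd_kernel \<mu> k z) (span_space k) (map_routes (similarity a c) k)"
    using similarity_invariant[OF d c, of a] inj inj'
    by (simp only: fdd_kernel_def if_True length_map length_upt minus_nat.diff_0)
  have meas: "(\<lambda>\<rho>. far_len k m S r' A' (z', \<rho>)) \<in> borel_measurable (span_space k)"
    if "A' \<in> sets borel" "z' \<in> space (\<Pi>\<^sub>M i\<in>{..<k}. borel)" for z' A' r'
    using measurable_compose[OF measurable_Pair1'[OF that(2)] measurable_far_len[OF S that(1) m]] .
  have mr: "map_routes (similarity a c) k \<in> fdd_kernel \<mu> k z \<rightarrow>\<^sub>M span_space k"
    using measurable_map_routes[OF continuous_on_similarity[of UNIV a c], of k] sets_fdd_kernel[OF zs]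
    by (simp cong: measurable_cong_sets)
  have "mean_far_len \<mu> k m S (c * r) (similarity a c ` A) (similarity_tuple a c k z) =
    (\<integral>\<^sup>+\<rho>. far_len k m S (c * r) (similarity a c ` A) (similarity_tuple a c k z, map_routes (similarity a c) k \<rho>) \<partial>fdd_kernel \<mu> k z)"
    unfolding mean_far_len_def K
    by (rule nn_integral_distr[OF mr]) (use meas[OF sets_similarity_image[OF c A] zs'] in simp)
  also have "\<dots> = (\<integral>\<^sup>+\<rho>. ennreal c * far_len k m S r A (z, \<rho>) \<partial>fdd_kernel \<mu> k z)"
    by (simp add: far_len_similarity[OF S c])
  also have "\<dots> = ennreal c * mean_far_len \<mu> k m S r A z"
    unfolding mean_far_len_def using meas[OF A zs] sets_fdd_kernel[OF zs]
    by (intro nn_integral_cmult) (simp cong: measurable_cong_sets)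
  finally show ?thesis .
qed

text \<open>
  For \<open>s = t\<close> only \<open>S = {..<k}\<close> contributes, because of the factor \<open>0 ^ (k - card S)\<close>.
\<close>

lemma marked_mean_diag:
  "marked_mean \<mu> m B t t r A = (\<Sum>k. ennreal (1 / fact k) * (ennreal (t ^ k * exp (- t * measure lborel B)) *
     (\<integral>\<^sup>+z. indicator (({..<k} \<rightarrow>\<^sub>E B) \<inter> distinct_tuples k) z * mean_far_len \<mu> k m {..<k} r A z
        \<partial>(\<Pi>\<^sub>M i\<in>{..<k}. lborel))))"
  unfolding marked_mean_def
proof (intro suminf_cong arg_cong2[of _ _ _ _ "(*)"] refl)
  fix k :: nat
  let ?f = "\<lambda>S. ennreal (t ^ card S * (t - t) ^ (k - card S) * exp (- t * measure lborel B)) *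
     (\<integral>\<^sup>+z. indicator (({..<k} \<rightarrow>\<^sub>E B) \<inter> distinct_tuples k) z * mean_far_len \<mu> k m S r A z
        \<partial>(\<Pi>\<^sub>M i\<in>{..<k}. lborel))"
  have "(\<Sum>S\<in>Pow {..<k}. ?f S) = (\<Sum>S\<in>{{..<k}}. ?f S)"
  proof (rule sum.mono_neutral_right)
    show "\<forall>S\<in>Pow {..<k} - {{..<k}}. ?f S = 0"
    proof
      fix S assume "S \<in> Pow {..<k} - {{..<k}}"
      then have "S \<subset> {..<k}" by auto
      then have "card S < k" using psubset_card_mono[of "{..<k}" S] by simp
      then have h: "(t - t) ^ (k - card S) = 0" by (simp add: zero_power)
      show "?f S = 0" unfolding h by simp
    qed
  qed auto
  then show "(\<Sum>S\<in>Pow {..<k}. ?f S) = ennreal (t ^ k * exp (- t * measure lborel B)) *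
     (\<integral>\<^sup>+z. indicator (({..<k} \<rightarrow>\<^sub>E B) \<inter> distinct_tuples k) z * mean_far_len \<mu> k m {..<k} r A z
        \<partial>(\<Pi>\<^sub>M i\<in>{..<k}. lborel))" by simp
qed

text \<open>
  Scaling space by \<open>c\<close> turns the points at density \<open>c\<^sup>2 * t\<close> into points at density \<open>t\<close>, and multiplies
  lengths by \<open>c\<close>.
\<close>

lemma marked_mean_similarity:
  assumes c: "0 < c" and A: "A \<in> sets borel" and B: "B \<in> sets borel" and m: "0 < m" and t: "0 \<le> t"
  shows "marked_mean \<mu> m (similarity a c ` B) t t (c * r) (similarity a c ` A) =
    ennreal c * marked_mean \<mu> m B (c\<^sup>2 * t) (c\<^sup>2 * t) r A"
proof -
  let ?B = "similarity a c ` B" and ?A = "similarity a c ` A"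
  let ?I = "\<lambda>k. \<integral>\<^sup>+z. indicator (({..<k} \<rightarrow>\<^sub>E B) \<inter> distinct_tuples k) z * mean_far_len \<mu> k m {..<k} r A z \<partial>(\<Pi>\<^sub>M i\<in>{..<k}. lborel)"
  have I: "(\<integral>\<^sup>+z. indicator (({..<k} \<rightarrow>\<^sub>E ?B) \<inter> distinct_tuples k) z * mean_far_len \<mu> k m {..<k} (c * r) ?A z \<partial>(\<Pi>\<^sub>M i\<in>{..<k}. lborel)) =
      ennreal (c ^ (2 * k)) * (ennreal c * ?I k)" for k
  proof -
    have L: "sets (\<Pi>\<^sub>M i\<in>{..<k}. (lborel :: complex measure)) = sets (\<Pi>\<^sub>M i\<in>{..<k}. borel)" by (intro sets_PiM_cong) auto
    note ms = measurable_mean_far_len[OF _ _ m]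
    have box: "({..<k} \<rightarrow>\<^sub>E B') \<inter> distinct_tuples k \<in> sets (\<Pi>\<^sub>M i\<in>{..<k}. borel)" if "B' \<in> sets borel" for B'
      using that by (intro sets.Int sets_PiM_I_finite sets_distinct_tuples) auto
    have mm: "(\<lambda>z. indicator (({..<k} \<rightarrow>\<^sub>E B') \<inter> distinct_tuples k) z * mean_far_len \<mu> k m {..<k} r' A' z)
      \<in> borel_measurable (\<Pi>\<^sub>M i\<in>{..<k}. borel)" if "A' \<in> sets borel" "B' \<in> sets borel" for A' B' r'
      using box[OF that(2)] ms[OF order_refl that(1)] by measurable
    have "(\<integral>\<^sup>+z. indicator (({..<k} \<rightarrow>\<^sub>E ?B) \<inter> distinct_tuples k) z * mean_far_len \<mu> k m {..<k} (c * r) ?A z \<partial>(\<Pi>\<^sub>M i\<in>{..<k}. lborel)) =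
      ennreal (c ^ (2 * k)) * (\<integral>\<^sup>+z. indicator (({..<k} \<rightarrow>\<^sub>E ?B) \<inter> distinct_tuples k) (similarity_tuple a c k z) *
         mean_far_len \<mu> k m {..<k} (c * r) ?A (similarity_tuple a c k z) \<partial>(\<Pi>\<^sub>M i\<in>{..<k}. lborel))"
      by (rule nn_integral_similarity_tuple[OF c mm[OF sets_similarity_image[OF c A] sets_similarity_image[OF c B]]])
    also have "(\<integral>\<^sup>+z. indicator (({..<k} \<rightarrow>\<^sub>E ?B) \<inter> distinct_tuples k) (similarity_tuple a c k z) *
         mean_far_len \<mu> k m {..<k} (c * r) ?A (similarity_tuple a c k z) \<partial>(\<Pi>\<^sub>M i\<in>{..<k}. lborel)) =
       (\<integral>\<^sup>+z. ennreal c * (indicator (({..<k} \<rightarrow>\<^sub>E B) \<inter> distinct_tuples k) z * mean_far_len \<mu> k m {..<k} r A z) \<partial>(\<Pi>\<^sub>M i\<in>{..<k}. lborel))"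
    proof (rule nn_integral_cong)
      fix z assume z: "z \<in> space (\<Pi>\<^sub>M i\<in>{..<k}. (lborel :: complex measure))"
      have "similarity_tuple a c k z \<in> ({..<k} \<rightarrow>\<^sub>E ?B) \<inter> distinct_tuples k \<longleftrightarrow> z \<in> ({..<k} \<rightarrow>\<^sub>E B) \<inter> distinct_tuples k"
        using z by (auto simp: similarity_tuple_def distinct_tuples_def space_PiM PiE_iff inj_on_def
            inj_image_mem_iff[OF inj_similarity[OF c]] dest: injD[OF inj_similarity[OF c]])
      then show "indicator (({..<k} \<rightarrow>\<^sub>E ?B) \<inter> distinct_tuples k) (similarity_tuple a c k z) *
         mean_far_len \<mu> k m {..<k} (c * r) ?A (similarity_tuple a c k z) =
         ennreal c * (indicator (({..<k} \<rightarrow>\<^sub>E B) \<inter> distinct_tuples k) z * mean_far_len \<mu> k m {..<k} r A z)"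
        using mean_far_len_similarity[OF _ order_refl c A m, of z k r a] by (auto simp: indicator_def)
    qed
    also have "\<dots> = ennreal c * ?I k"
      using mm[OF A B] by (intro nn_integral_cmult) (simp cong: measurable_cong_sets add: L)
    finally show ?thesis .
  qed
  have meas: "measure lborel ?B = c\<^sup>2 * measure lborel B"
    using c by (simp add: measure_def emeasure_lborel_similarity[OF c B] enn2real_mult)
  have "marked_mean \<mu> m ?B t t (c * r) ?A =
    (\<Sum>k. ennreal c * (ennreal (1 / fact k) * (ennreal ((c\<^sup>2 * t) ^ k * exp (- (c\<^sup>2 * t) * measure lborel B)) * ?I k)))"
    unfolding marked_mean_diag I meas
  proof (rule suminf_cong)
    fix k
    have e: "ennreal (t ^ k * exp (- t * (c\<^sup>2 * measure lborel B))) * ennreal (c ^ (2 * k)) =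
       ennreal ((c\<^sup>2 * t) ^ k * exp (- (c\<^sup>2 * t) * measure lborel B))"
      using c t power_mult[of c 2 k]
      by (subst ennreal_mult[symmetric]) (auto simp: power_mult_distrib mult_ac)
    have "x * (u * (v * (d * w))) = d * (x * ((u * v) * w))" for x u v d w :: ennreal
      by (simp only: mult_ac)
    then show "ennreal (1 / fact k) * (ennreal (t ^ k * exp (- t * (c\<^sup>2 * measure lborel B))) *
         (ennreal (c ^ (2 * k)) * (ennreal c * ?I k))) =
      ennreal c * (ennreal (1 / fact k) * (ennreal ((c\<^sup>2 * t) ^ k * exp (- (c\<^sup>2 * t) * measure lborel B)) * ?I k))"
      unfolding e[symmetric] .
  qed
  also have "\<dots> = ennreal c * marked_mean \<mu> m B (c\<^sup>2 * t) (c\<^sup>2 * t) r A"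
    unfolding marked_mean_diag by simp
  finally show ?thesis .
qed

end

section \<open>Thinning\<close>

text \<open>
  The probability of the subset \<open>S\<close> when each element of \<open>K\<close> is kept independently with probability \<open>s\<close>.
\<close>

definition thin_weight :: "real \<Rightarrow> 'i set \<Rightarrow> 'i set \<Rightarrow> real" where
  "thin_weight s K S = s ^ card S * (1 - s) ^ card (K - S)"

lemma sum_thin_weight_insert:
  assumes K: "finite K" "x \<notin> K"
  shows "(\<Sum>S\<in>Pow (insert x K). thin_weight s (insert x K) S * f S) =
    (\<Sum>S\<in>Pow K. thin_weight s K S * ((1 - s) * f S + s * f (insert x S)))"
proof -
  have "(\<Sum>S\<in>Pow (insert x K). thin_weight s (insert x K) S * f S) =
    (\<Sum>S\<in>Pow K. thin_weight s (insert x K) S * f S) + (\<Sum>S\<in>insert x ` Pow K. thin_weight s (insert x K) S * f S)"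
    using K by (subst Pow_insert, subst sum.union_disjoint) auto
  also have "(\<Sum>S\<in>insert x ` Pow K. thin_weight s (insert x K) S * f S) =
    (\<Sum>S\<in>Pow K. thin_weight s (insert x K) (insert x S) * f (insert x S))"
    using K by (subst sum.reindex) (auto simp: inj_on_def)
  also have "(\<Sum>S\<in>Pow K. thin_weight s (insert x K) S * f S) = (\<Sum>S\<in>Pow K. thin_weight s K S * ((1 - s) * f S))"
  proof (rule sum.cong[OF refl])
    fix S assume S: "S \<in> Pow K"
    then have "insert x K - S = insert x (K - S)" "x \<notin> K - S" using K by auto
    then have "card (insert x K - S) = Suc (card (K - S))" using K by simp
    then show "thin_weight s (insert x K) S * f S = thin_weight s K S * ((1 - s) * f S)"
      by (simp add: thin_weight_def)
  qed
  also have "(\<Sum>S\<in>Pow K. thin_weight s (insert x K) (insert x S) * f (insert x S)) =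
      (\<Sum>S\<in>Pow K. thin_weight s K S * (s * f (insert x S)))"
  proof (rule sum.cong[OF refl])
    fix S assume S: "S \<in> Pow K"
    then have "insert x K - insert x S = K - S" "x \<notin> S" "finite S" using K finite_subset by auto
    then show "thin_weight s (insert x K) (insert x S) * f (insert x S) = thin_weight s K S * (s * f (insert x S))"
      by (simp add: thin_weight_def)
  qed
  finally show ?thesis by (simp add: sum.distrib distrib_left)
qed

text \<open>The probability that a random subset contains none of some disjoint pairs.\<close>

lemma sum_thin_weight_avoiding:
  assumes "finite Q" "finite K" "Q \<subseteq> offdiag K"
    "\<And>p q. p \<in> Q \<Longrightarrow> q \<in> Q \<Longrightarrow> p \<noteq> q \<Longrightarrow> {fst p, snd p} \<inter> {fst q, snd q} = {}"
  shows "(\<Sum>S\<in>Pow K. thin_weight s K S * (if \<exists>(i, j)\<in>Q. i \<in> S \<and> j \<in> S then 0 else 1)) = (1 - s\<^sup>2) ^ card Q"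
  using assms
proof (induction Q arbitrary: K rule: finite_induct)
  case empty
  have "(\<Sum>S\<in>Pow K. thin_weight s K S) = (\<Prod>x\<in>K. s + (1 - s))"
    using empty(1) by (subst prod_add) (auto simp: thin_weight_def)
  then show ?case by simp
next
  case (insert p Q)
  obtain i j where p: "p = (i, j)" by (cases p)
  let ?g = "\<lambda>Q S. if \<exists>(i, j)\<in>Q. i \<in> S \<and> j \<in> S then 0 else 1 :: real"
  define K' where "K' = K - {i, j}"
  have ij: "i \<in> K" "j \<in> K" "i \<noteq> j" using insert.prems(2) by (auto simp: p offdiag_def)
  then have K: "K = insert i (insert j K')" and fin: "finite K'" "i \<notin> insert j K'" "j \<notin> K'"
    using insert.prems(1) by (auto simp: K'_def)
  have disj: "fst q \<noteq> i \<and> fst q \<noteq> j \<and> snd q \<noteq> i \<and> snd q \<noteq> j" if "q \<in> Q" for q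
  proof -
    have "q \<noteq> p" using insert.hyps(2) that by blast
    then have "{fst p, snd p} \<inter> {fst q, snd q} = {}" using insert.prems(3)[of p q] that by auto
    then show ?thesis by (auto simp: p)
  qed
  have Q': "Q \<subseteq> offdiag K'"
  proof
    fix q assume q: "q \<in> Q"
    then have "q \<in> offdiag K" using insert.prems(2) by blast
    then show "q \<in> offdiag K'" using disj[OF q] by (auto simp: offdiag_def K'_def)
  qed
  have IH: "(\<Sum>S\<in>Pow K'. thin_weight s K' S * ?g Q S) = (1 - s\<^sup>2) ^ card Q"
    using Q' fin(1) insert.prems(3) by (intro insert.IH) auto
  define f where "f = ?g (insert p Q)"
  have "(\<Sum>S\<in>Pow K. thin_weight s K S * f S) =
    (\<Sum>S\<in>Pow K'. thin_weight s K' S * ((1 - s) * ((1 - s) * f S + s * f (insert i S)) +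
       s * ((1 - s) * f (insert j S) + s * f (insert i (insert j S)))))"
    unfolding K using fin sum_thin_weight_insert[of "insert j K'" i s f]
      sum_thin_weight_insert[of K' j s "\<lambda>S. (1 - s) * f S + s * f (insert i S)"] by simp
  also have "\<dots> = (\<Sum>S\<in>Pow K'. thin_weight s K' S * ?g Q S * (1 - s\<^sup>2))"
  proof (rule sum.cong[OF refl])
    fix S assume "S \<in> Pow K'"
    then have S: "i \<notin> S" "j \<notin> S" using fin by auto
    have g0: "f S = ?g Q S" using S by (auto simp: p f_def)
    have inv: "(\<exists>(a, b)\<in>Q. a \<in> T \<and> b \<in> T) \<longleftrightarrow> (\<exists>(a, b)\<in>Q. a \<in> S \<and> b \<in> S)"
      if T: "T = insert i S \<or> T = insert j S" for T
    proof -
      have "fst q \<in> T \<and> snd q \<in> T \<longleftrightarrow> fst q \<in> S \<and> snd q \<in> S" if "q \<in> Q" for q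
        using disj[OF that] T by blast
      then show ?thesis by (simp add: case_prod_beta cong: bex_cong)
    qed
    have g1: "f (insert i S) = ?g Q S" using S ij(3) inv[of "insert i S"] by (simp add: p f_def)
    have g2: "f (insert j S) = ?g Q S" using S ij(3) inv[of "insert j S"] by (simp add: p f_def)
    have g3: "f (insert i (insert j S)) = 0" by (simp add: p f_def)
    show "thin_weight s K' S * ((1 - s) * ((1 - s) * f S + s * f (insert i S)) +
       s * ((1 - s) * f (insert j S) + s * f (insert i (insert j S)))) =
      thin_weight s K' S * ?g Q S * (1 - s\<^sup>2)"
      unfolding g0 g1 g2 g3 by (simp add: algebra_simps power2_eq_square)
  qed
  also have "\<dots> = (1 - s\<^sup>2) ^ card Q * (1 - s\<^sup>2)"
    by (simp only: sum_distrib_right[symmetric] IH)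
  finally show ?case using insert.hyps by (simp add: f_def)
qed

text \<open>
  If \<open>x\<close> is covered by \<open>m\<close> disjoint pairs, then some pair survives the thinning with probability at least
  \<open>1 - (1 - s\<^sup>2) ^ m\<close>, and \<open>x\<close> is still covered.
\<close>

lemma sum_thin_weight_containing:
  assumes x: "x \<in> many_far m {..<k::nat} z \<rho> r" and s: "0 \<le> s" "s \<le> 1"
  shows "1 - (1 - s\<^sup>2) ^ m \<le> (\<Sum>S\<in>Pow {..<k}. thin_weight s {..<k} S * indicator (many_far 1 S z \<rho> r) x)"
proof -
  obtain Q where Q: "Q \<subseteq> offdiag {..<k}" "finite Q" "card Q = m"
    "\<forall>p q. p \<in> Q \<longrightarrow> q \<in> Q \<longrightarrow> p \<noteq> q \<longrightarrow> {fst p, snd p} \<inter> {fst q, snd q} = {}"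
    "\<forall>i j. (i, j) \<in> Q \<longrightarrow> x \<in> \<rho> (i, j) \<and> r < dist x (z i) \<and> r < dist x (z j)"
    using x by (rule many_farE)
  let ?g = "\<lambda>Q S. if \<exists>(i, j)\<in>Q. i \<in> S \<and> j \<in> S then 0 else 1 :: real"
  have "(\<Sum>S\<in>Pow {..<k}. thin_weight s {..<k} S) = 1"
    using sum_thin_weight_avoiding[of "{} :: (nat \<times> nat) set" "{..<k}" s] by simp
  moreover have "(\<Sum>S\<in>Pow {..<k}. thin_weight s {..<k} S * ?g Q S) = (1 - s\<^sup>2) ^ card Q"
    by (intro sum_thin_weight_avoiding Q(1,2) finite_lessThan Q(4)[rule_format])
  ultimately have "1 - (1 - s\<^sup>2) ^ m = (\<Sum>S\<in>Pow {..<k}. thin_weight s {..<k} S * (1 - ?g Q S))"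
    using Q(3) by (simp add: right_diff_distrib sum_subtractf)
  also have "\<dots> \<le> (\<Sum>S\<in>Pow {..<k}. thin_weight s {..<k} S * indicator (many_far 1 S z \<rho> r) x)"
  proof (intro sum_mono mult_left_mono)
    fix S assume "S \<in> Pow {..<k}"
    show "1 - ?g Q S \<le> indicator (many_far 1 S z \<rho> r) x"
    proof (cases "\<exists>(i, j)\<in>Q. i \<in> S \<and> j \<in> S")
      case True
      then obtain i j where ij: "(i, j) \<in> Q" "i \<in> S" "j \<in> S" by blast
      then have "(i, j) \<in> offdiag S" using Q(1) by (auto simp: offdiag_def)
      then have "x \<in> many_far 1 S z \<rho> r" unfolding mem_many_far_1 using Q(5) ij(1) by blast
      then show ?thesis by (simp split: split_indicator)
    qed simp
    show "0 \<le> thin_weight s {..<k} S" using s by (simp add: thin_weight_def)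
  qed
  finally show ?thesis .
qed

lemma far_len_thinned:
  assumes w: "w \<in> space ((\<Pi>\<^sub>M i\<in>{..<k}. borel) \<Otimes>\<^sub>M span_space k)" and A: "A \<in> sets borel" and s: "0 \<le> s" "s \<le> 1"
  shows "ennreal (1 - (1 - s\<^sup>2) ^ m) * far_len k m {..<k} r A w \<le>
    (\<Sum>S\<in>Pow {..<k}. ennreal (thin_weight s {..<k} S) * far_len k 1 S r A w)"
proof (cases "len (\<Union>p\<in>offdiag {..<k}. snd w p) < \<infinity>")
  case True
  have \<rho>: "snd w p \<in> sets borel" if "p \<in> offdiag {..<k}" for p
    using w that by (auto simp: space_pair_measure space_PiM space_route_space PiE_iff intro: borel_compact)
  have sub: "offdiag S \<subseteq> offdiag {..<k}" if "S \<in> Pow {..<k}" for S using that by (auto simp: offdiag_def)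
  have b: "many_far m' S (fst w) (snd w) r \<inter> A \<in> sets borel" if "S \<in> Pow {..<k}" for S m'
    using sub[OF that] \<rho> A by (intro sets.Int sets_many_far) auto
  have fl: "far_len k m' S r A w = (\<integral>\<^sup>+x. indicator (many_far m' S (fst w) (snd w) r \<inter> A) x \<partial>len_measure)"
    if "S \<in> Pow {..<k}" for S m'
    using b[OF that, of m'] True by (simp add: far_len_def emeasure_len_measure)
  have nn: "0 \<le> thin_weight s {..<k} S" for S using s by (simp add: thin_weight_def)
  have "ennreal (1 - (1 - s\<^sup>2) ^ m) * far_len k m {..<k} r A w =
     (\<integral>\<^sup>+x. ennreal (1 - (1 - s\<^sup>2) ^ m) * indicator (many_far m {..<k} (fst w) (snd w) r \<inter> A) x \<partial>len_measure)"
    unfolding fl[OF Pow_top] using b[OF Pow_top, of m] by (intro nn_integral_cmult[symmetric]) auto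
  also have "\<dots> \<le> (\<integral>\<^sup>+x. (\<Sum>S\<in>Pow {..<k}. ennreal (thin_weight s {..<k} S) * indicator (many_far 1 S (fst w) (snd w) r \<inter> A) x) \<partial>len_measure)"
  proof (rule nn_integral_mono)
    fix x :: complex
    show "ennreal (1 - (1 - s\<^sup>2) ^ m) * indicator (many_far m {..<k} (fst w) (snd w) r \<inter> A) x \<le>
      (\<Sum>S\<in>Pow {..<k}. ennreal (thin_weight s {..<k} S) * indicator (many_far 1 S (fst w) (snd w) r \<inter> A) x)"
    proof (cases "x \<in> many_far m {..<k} (fst w) (snd w) r \<inter> A")
      case True
      have "ennreal (1 - (1 - s\<^sup>2) ^ m) \<le> ennreal (\<Sum>S\<in>Pow {..<k}. thin_weight s {..<k} S * indicator (many_far 1 S (fst w) (snd w) r) x)"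
        using True s by (intro ennreal_leI sum_thin_weight_containing) auto
      also have "\<dots> = (\<Sum>S\<in>Pow {..<k}. ennreal (thin_weight s {..<k} S * indicator (many_far 1 S (fst w) (snd w) r) x))"
        using nn by (intro sum_ennreal[symmetric]) (auto split: split_indicator)
      also have "\<dots> = (\<Sum>S\<in>Pow {..<k}. ennreal (thin_weight s {..<k} S) * indicator (many_far 1 S (fst w) (snd w) r \<inter> A) x)"
        using True by (intro sum.cong) (auto split: split_indicator)
      finally show ?thesis using True by simp
    qed simp
  qed
  also have "\<dots> = (\<Sum>S\<in>Pow {..<k}. \<integral>\<^sup>+x. ennreal (thin_weight s {..<k} S) * indicator (many_far 1 S (fst w) (snd w) r \<inter> A) x \<partial>len_measure)"
    using b by (intro nn_integral_sum) auto
  also have "\<dots> = (\<Sum>S\<in>Pow {..<k}. ennreal (thin_weight s {..<k} S) * far_len k 1 S r A w)"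
  proof (rule sum.cong[OF refl])
    fix S assume S: "S \<in> Pow {..<k}"
    show "(\<integral>\<^sup>+x. ennreal (thin_weight s {..<k} S) * indicator (many_far 1 S (fst w) (snd w) r \<inter> A) x \<partial>len_measure) =
      ennreal (thin_weight s {..<k} S) * far_len k 1 S r A w"
      unfolding fl[OF S] using b[OF S, of 1] by (intro nn_integral_cmult) auto
  qed
  finally show ?thesis .
qed (simp add: far_len_def)

context poisson_sampled_routes
begin

lemma mean_far_len_thinned:
  assumes z: "z \<in> space (\<Pi>\<^sub>M i\<in>{..<k}. borel)" and A: "A \<in> sets borel" and s: "0 \<le> s" "s \<le> 1" and m: "0 < m"
  shows "ennreal (1 - (1 - s\<^sup>2) ^ m) * mean_far_len \<mu> k m {..<k} r A z \<le>
    (\<Sum>S\<in>Pow {..<k}. ennreal (thin_weight s {..<k} S) * mean_far_len \<mu> k 1 S r A z)"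
proof -
  have sp: "space (fdd_kernel \<mu> k z) = space (span_space k)"
    using sets_eq_imp_space_eq[OF sets_fdd_kernel[OF z]] .
  have meas: "(\<lambda>\<rho>. far_len k m' S r A (z, \<rho>)) \<in> borel_measurable (fdd_kernel \<mu> k z)"
    if "S \<in> Pow {..<k}" "0 < m'" for S m'
  proof -
    have "S \<subseteq> {..<k}" using that by simp
    from measurable_compose[OF measurable_Pair1'[OF z] measurable_far_len[OF this A that(2)]]
    show ?thesis by (simp cong: measurable_cong_sets add: sets_fdd_kernel[OF z])
  qed
  have "ennreal (1 - (1 - s\<^sup>2) ^ m) * mean_far_len \<mu> k m {..<k} r A z =
     (\<integral>\<^sup>+\<rho>. ennreal (1 - (1 - s\<^sup>2) ^ m) * far_len k m {..<k} r A (z, \<rho>) \<partial>fdd_kernel \<mu> k z)"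
    unfolding mean_far_len_def using meas[of "{..<k}" m] m by (intro nn_integral_cmult[symmetric]) auto
  also have "\<dots> \<le> (\<integral>\<^sup>+\<rho>. (\<Sum>S\<in>Pow {..<k}. ennreal (thin_weight s {..<k} S) * far_len k 1 S r A (z, \<rho>)) \<partial>fdd_kernel \<mu> k z)"
    using z by (intro nn_integral_mono far_len_thinned[OF _ A s]) (simp add: space_pair_measure sp)
  also have "\<dots> = (\<Sum>S\<in>Pow {..<k}. \<integral>\<^sup>+\<rho>. ennreal (thin_weight s {..<k} S) * far_len k 1 S r A (z, \<rho>) \<partial>fdd_kernel \<mu> k z)"
    using meas[of _ 1] by (intro nn_integral_sum) auto
  also have "\<dots> = (\<Sum>S\<in>Pow {..<k}. ennreal (thin_weight s {..<k} S) * mean_far_len \<mu> k 1 S r A z)"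
    unfolding mean_far_len_def using meas[of _ 1] by (intro sum.cong refl nn_integral_cmult) auto
  finally show ?thesis .
qed

lemma marked_mean_thinned:
  assumes B: "B \<in> sets borel" and A: "A \<in> sets borel" and s: "0 \<le> s" "s \<le> 1" and m: "0 < m"
  shows "ennreal (1 - (1 - s\<^sup>2) ^ m) * marked_mean \<mu> m B 1 1 r A \<le> marked_mean \<mu> 1 B 1 s r A"
proof -
  define q where "q = ennreal (1 - (1 - s\<^sup>2) ^ m)"
  define e where "e = ennreal (exp (- measure lborel B))"
  let ?L = "\<lambda>k. \<Pi>\<^sub>M i\<in>{..<k}. (lborel :: complex measure)"
  let ?ind = "\<lambda>k. indicator (({..<k} \<rightarrow>\<^sub>E B) \<inter> distinct_tuples k)"
  have L: "sets (?L k) = sets (\<Pi>\<^sub>M i\<in>{..<k}. borel)" for k by (intro sets_PiM_cong) auto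
  have "q * marked_mean \<mu> m B 1 1 r A = (\<Sum>k. ennreal (1 / fact k) * (q * (e * (\<integral>\<^sup>+z. ?ind k z * mean_far_len \<mu> k m {..<k} r A z \<partial>?L k))))"
    unfolding marked_mean_diag by (simp add: e_def mult.left_commute[of q] flip: ennreal_suminf_cmult)
  also have "\<dots> \<le> marked_mean \<mu> 1 B 1 s r A"
    unfolding marked_mean_def
  proof (intro suminf_le mult_left_mono)
    fix k :: nat
    have [measurable]: "({..<k} \<rightarrow>\<^sub>E B) \<inter> distinct_tuples k \<in> sets (?L k)"
      unfolding L using B by (intro sets.Int sets_PiM_I_finite sets_distinct_tuples) auto
    have mm [measurable]: "mean_far_len \<mu> k m' S r A \<in> borel_measurable (?L k)" if "S \<in> Pow {..<k}" "0 < m'" for S m'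
      using measurable_mean_far_len[of S k A m' r] that A by (simp cong: measurable_cong_sets add: L)
    have "q * (e * (\<integral>\<^sup>+z. ?ind k z * mean_far_len \<mu> k m {..<k} r A z \<partial>?L k)) =
       e * (\<integral>\<^sup>+z. ?ind k z * (q * mean_far_len \<mu> k m {..<k} r A z) \<partial>?L k)"
      using mm[of "{..<k}" m] m by (simp add: nn_integral_cmult[symmetric] mult.left_commute[of q] mult.assoc)
    also have "\<dots> \<le> e * (\<integral>\<^sup>+z. (\<Sum>S\<in>Pow {..<k}. ennreal (thin_weight s {..<k} S) * (?ind k z * mean_far_len \<mu> k 1 S r A z)) \<partial>?L k)"
    proof (intro mult_left_mono nn_integral_mono)
      fix z assume "z \<in> space (?L k)"
      then have "z \<in> space (\<Pi>\<^sub>M i\<in>{..<k}. borel)" by (simp add: space_PiM)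
      from mean_far_len_thinned[OF this A s m, of r]
      show "?ind k z * (q * mean_far_len \<mu> k m {..<k} r A z) \<le>
        (\<Sum>S\<in>Pow {..<k}. ennreal (thin_weight s {..<k} S) * (?ind k z * mean_far_len \<mu> k 1 S r A z))"
        by (simp add: q_def split: split_indicator)
    qed simp
    also have "\<dots> = e * (\<Sum>S\<in>Pow {..<k}. ennreal (thin_weight s {..<k} S) * (\<integral>\<^sup>+z. ?ind k z * mean_far_len \<mu> k 1 S r A z \<partial>?L k))"
      using mm[of _ 1] by (simp add: nn_integral_sum nn_integral_cmult)
    also have "\<dots> = (\<Sum>S\<in>Pow {..<k}. ennreal (s ^ card S * (1 - s) ^ (k - card S) * exp (- 1 * measure lborel B)) *
       (\<integral>\<^sup>+z. ?ind k z * mean_far_len \<mu> k 1 S r A z \<partial>?L k))"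
      unfolding sum_distrib_left
    proof (rule sum.cong[OF refl])
      fix S assume "S \<in> Pow {..<k}"
      then have "card ({..<k} - S) = k - card S"
        using finite_subset[of S "{..<k}"] by (simp add: card_Diff_subset)
      then have "e * ennreal (thin_weight s {..<k} S) = ennreal (s ^ card S * (1 - s) ^ (k - card S) * exp (- 1 * measure lborel B))"
        using s unfolding e_def by (subst ennreal_mult[symmetric]) (auto simp: thin_weight_def mult_ac)
      then show "e * (ennreal (thin_weight s {..<k} S) * (\<integral>\<^sup>+z. ?ind k z * mean_far_len \<mu> k 1 S r A z \<partial>?L k)) =
        ennreal (s ^ card S * (1 - s) ^ (k - card S) * exp (- 1 * measure lborel B)) *
       (\<integral>\<^sup>+z. ?ind k z * mean_far_len \<mu> k 1 S r A z \<partial>?L k)"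
        by (simp only: mult.assoc[symmetric])
    qed
    finally show "q * (e * (\<integral>\<^sup>+z. ?ind k z * mean_far_len \<mu> k m {..<k} r A z \<partial>?L k)) \<le> \<dots>" .
  qed auto
  finally show ?thesis by (simp add: q_def)
qed

end

section \<open>Edge-intensities\<close>

text \<open>
  A translation invariant measure is a multiple of Lebesgue measure: integrate the indicator of
  \<open>x + y \<in> A\<close>, \<open>y\<close> in the unit ball, against both measures in either order.
\<close>

lemma translation_invariant_eq_lborel:
  fixes N :: "complex measure"
  assumes N: "sigma_finite_measure N" and sets: "sets N = sets borel"
    and inv: "\<And>a A. A \<in> sets borel \<Longrightarrow> emeasure N ((+) a ` A) = emeasure N A"
    and A: "A \<in> sets borel"
  shows "emeasure N A = emeasure N (ball 0 1) / emeasure lborel (ball 0 1 :: complex set) * emeasure lborel A"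
proof -
  interpret N: sigma_finite_measure N by (rule N)
  interpret P: pair_sigma_finite N lborel ..
  define C where "C = (ball 0 1 :: complex set)"
  have [measurable_cong]: "sets N = sets borel" by (rule sets)
  have [measurable]: "A \<in> sets borel" "C \<in> sets borel" using A by (auto simp: C_def)
  have shift: "(\<lambda>x. x + y) -` A = (+) (- y) ` A" for y
    by (auto simp: image_iff intro!: bexI[of _ "_ + y"])
  have shiftC: "{x. u - x \<in> C} = (+) u ` C" for u
  proof (intro set_eqI iffI)
    fix x assume "x \<in> {x. u - x \<in> C}"
    then have "x - u \<in> C" by (simp add: C_def norm_minus_commute)
    then show "x \<in> (+) u ` C" by (intro image_eqI[of _ _ "x - u"]) auto
  next
    fix x assume "x \<in> (+) u ` C"
    then obtain y where "y \<in> C" "x = u + y" by auto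
    then show "x \<in> {x. u - x \<in> C}" by (simp add: C_def)
  qed
  have "emeasure lborel C * emeasure N A = (\<integral>\<^sup>+y. emeasure N A * indicator C y \<partial>lborel)"
    by (subst nn_integral_cmult_indicator) (auto simp: mult.commute)
  also have "\<dots> = (\<integral>\<^sup>+y. (\<integral>\<^sup>+x. indicator C y * indicator A (x + y) \<partial>N) \<partial>lborel)"
  proof (rule nn_integral_cong)
    fix y :: complex
    have "(\<integral>\<^sup>+x. indicator C y * indicator A (x + y) \<partial>N) = (\<integral>\<^sup>+x. indicator C y * indicator ((+) (- y) ` A) x \<partial>N)"
    proof (intro nn_integral_cong)
      fix x
      have "x \<in> (+) (- y) ` A \<longleftrightarrow> x + y \<in> A" unfolding shift[symmetric] by simp
      then show "indicator C y * indicator A (x + y) = (indicator C y * indicator ((+) (- y) ` A) x :: ennreal)"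
        by (simp only: indicator_def)
    qed
    also have "\<dots> = indicator C y * emeasure N ((+) (- y) ` A)"
    proof (rule nn_integral_cmult_indicator)
      have "(\<lambda>x. x + y) -` A \<in> sets borel" using measurable_sets[of "\<lambda>x. x + y" borel borel A] by simp
      then show "(+) (- y) ` A \<in> sets N" by (simp add: shift sets)
    qed
    also have "\<dots> = emeasure N A * indicator C y" using inv[OF A, of "- y"] by (simp add: mult.commute)
    finally show "emeasure N A * indicator C y = (\<integral>\<^sup>+x. indicator C y * indicator A (x + y) \<partial>N)" by simp
  qed
  also have "\<dots> = (\<integral>\<^sup>+x. (\<integral>\<^sup>+y. indicator C y * indicator A (x + y) \<partial>lborel) \<partial>N)"
    by (rule P.Fubini[of "\<lambda>(x, y). indicator C y * indicator A (x + y)", simplified]) measurable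
  also have "\<dots> = (\<integral>\<^sup>+x. (\<integral>\<^sup>+u. indicator C (u - x) * indicator A u \<partial>lborel) \<partial>N)"
  proof (rule nn_integral_cong)
    fix x :: complex
    have "(\<integral>\<^sup>+u. indicator C (u - x) * indicator A u \<partial>lborel) =
        (\<integral>\<^sup>+u. indicator C (u - x) * indicator A u \<partial>distr lborel borel ((+) x))"
      by (simp add: lborel_distr_plus)
    also have "\<dots> = (\<integral>\<^sup>+y. indicator C y * indicator A (x + y) \<partial>lborel)"
      by (subst nn_integral_distr) (auto, measurable)
    finally show "(\<integral>\<^sup>+y. indicator C y * indicator A (x + y) \<partial>lborel) = (\<integral>\<^sup>+u. indicator C (u - x) * indicator A u \<partial>lborel)" ..
  qed
  also have "\<dots> = (\<integral>\<^sup>+u. (\<integral>\<^sup>+x. indicator C (u - x) * indicator A u \<partial>N) \<partial>lborel)"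
    by (rule P.Fubini[of "\<lambda>(x, u). indicator C (u - x) * indicator A u", simplified, symmetric]) measurable
  also have "\<dots> = (\<integral>\<^sup>+u. emeasure N C * indicator A u \<partial>lborel)"
  proof (rule nn_integral_cong)
    fix u :: complex
    have "(\<integral>\<^sup>+x. indicator C (u - x) * indicator A u \<partial>N) = (\<integral>\<^sup>+x. indicator A u * indicator ((+) u ` C) x \<partial>N)"
      by (intro nn_integral_cong) (auto simp: shiftC[symmetric] split: split_indicator)
    also have "\<dots> = indicator A u * emeasure N ((+) u ` C)"
    proof (rule nn_integral_cmult_indicator)
      have "{x \<in> space borel. u - x \<in> C} \<in> sets borel" by measurable
      then show "(+) u ` C \<in> sets N" by (simp add: shiftC sets)
    qed
    also have "\<dots> = emeasure N C * indicator A u" using inv[of C u] by (simp add: mult.commute)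
    finally show "(\<integral>\<^sup>+x. indicator C (u - x) * indicator A u \<partial>N) = emeasure N C * indicator A u" .
  qed
  also have "\<dots> = emeasure N C * emeasure lborel A" by (simp add: nn_integral_cmult_indicator)
  finally have eq: "emeasure lborel C * emeasure N A = emeasure N C * emeasure lborel A" .
  have "0 < emeasure lborel C"
    using emeasure_ball[of 1 "0::complex"] unfolding C_def by simp
  moreover have "emeasure lborel C < \<infinity>" unfolding C_def by (rule emeasure_lborel_ball_finite)
  ultimately have "emeasure N A = (emeasure N C * emeasure lborel A) / emeasure lborel C"
    unfolding eq[symmetric] by (simp add: mult.commute[of "emeasure lborel C"] ennreal_mult_divide_eq less_top)
  then show ?thesis unfolding C_def by (simp add: ennreal_times_divide mult.commute)
qed

lemma cball_exhaustion:
  "cball (0::complex) (real n) \<in> sets borel" "emeasure lborel (cball (0::complex) (real n)) < \<infinity>"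
  "incseq (\<lambda>n. cball (0::complex) (real n))" "(\<Union>n. cball (0::complex) (real n)) = UNIV"
  using real_arch_simple emeasure_lborel_cball_finite[of "0::complex" "real n"]
  by (auto simp: incseq_def)

context poisson_sampled_routes
begin

text \<open>
  The points covered by \<open>m\<close> disjoint pairs among all points that have arrived by time \<open>t\<close>. For \<open>m = 1\<close>
  this is the edge process whose intensity is studied.
\<close>

definition plane_far :: "nat \<Rightarrow> real \<Rightarrow> real \<Rightarrow> 'w \<Rightarrow> complex set" where
  "plane_far m t r \<omega> = many_far m (arrived X t \<omega>) (\<lambda>i. fst (X i \<omega>)) (\<lambda>p. R p \<omega>) r"

definition plane_mean :: "nat \<Rightarrow> real \<Rightarrow> real \<Rightarrow> complex set \<Rightarrow> ennreal" where
  "plane_mean m t r A = (\<integral>\<^sup>+\<omega>. len (plane_far m t r \<omega> \<inter> A) \<partial>M)"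

lemma borel_routes:
  assumes "\<omega> \<in> space M" "p \<in> offdiag J"
  shows "R p \<omega> \<in> sets borel"
proof -
  have "p \<in> offdiag UNIV" using assms(2) by (auto simp: offdiag_def)
  then show ?thesis using compact_route[OF measurable_routes assms(1)] by (intro borel_compact)
qed

lemma sets_plane_far: "\<omega> \<in> space M \<Longrightarrow> plane_far m t r \<omega> \<in> sets borel"
  unfolding plane_far_def by (intro sets_many_far borel_routes)

text \<open>
  The length is measurable only up to the null event that some routes have infinite length; \<open>H\<close> is a
  random variable that agrees with it almost surely.
\<close>

lemma plane_far_exhaustion:
  assumes B: "\<And>n. B n \<in> sets borel" "\<And>n. emeasure lborel (B n) < \<infinity>" "incseq B" "(\<Union>n. B n) = UNIV"
    and st: "0 \<le> s" "s \<le> t" and A: "A \<in> sets borel" and m: "0 < m"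
  shows "\<exists>H\<in>borel_measurable M. (AE \<omega> in M. len (plane_far m s r \<omega> \<inter> A) = H \<omega>) \<and>
     (\<integral>\<^sup>+\<omega>. H \<omega> \<partial>M) = (SUP n. marked_mean \<mu> m (B n) t s r A)"
proof -
  let ?W = "\<lambda>n \<omega>. many_far m (window X (B n) s \<omega>) (\<lambda>i. fst (X i \<omega>)) (\<lambda>p. R p \<omega>) r \<inter> A"
  have "\<forall>n. \<exists>H\<in>borel_measurable M. (AE \<omega> in M. len (?W n \<omega>) = H \<omega>) \<and> (\<integral>\<^sup>+\<omega>. H \<omega> \<partial>M) = marked_mean \<mu> m (B n) t s r A"
    using window_mean[OF B(1,2) st A m] by blast
  from choice[OF this[unfolded Bex_def]] obtain H where
    H0: "\<forall>n. H n \<in> borel_measurable M \<and> (AE \<omega> in M. len (?W n \<omega>) = H n \<omega>) \<and>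
      (\<integral>\<^sup>+\<omega>. H n \<omega> \<partial>M) = marked_mean \<mu> m (B n) t s r A" ..
  then have H: "\<And>n. H n \<in> borel_measurable M" "\<And>n. AE \<omega> in M. len (?W n \<omega>) = H n \<omega>"
      "\<And>n. (\<integral>\<^sup>+\<omega>. H n \<omega> \<partial>M) = marked_mean \<mu> m (B n) t s r A"
    by (simp_all only:)
  have winc: "incseq (\<lambda>n. window X (B n) s \<omega>)" for \<omega>
    using B(3) by (auto simp: incseq_def window_def)
  have inc: "?W n \<omega> \<subseteq> ?W (Suc n) \<omega>" for n \<omega>
    using incseq_SucD[OF winc, of n \<omega>] by (intro Int_mono many_far_mono) auto
  have AE: "AE \<omega> in M. \<forall>n. len (?W n \<omega>) = H n \<omega>" using H(2) by (simp add: AE_all_countable)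
  have "AE \<omega> in M. len (plane_far m s r \<omega> \<inter> A) = (SUP n. H n \<omega>)"
    using AE_space AE
  proof eventually_elim
    case (elim \<omega>)
    have b: "?W n \<omega> \<in> sets borel" for n
      using A by (intro sets.Int sets_many_far borel_routes[OF elim(1)])
    have "(\<Union>n. window X (B n) s \<omega>) = arrived X s \<omega>"
      using B(4) by (auto simp: window_def arrived_def)
    then have "plane_far m s r \<omega> = (\<Union>n. many_far m (window X (B n) s \<omega>) (\<lambda>i. fst (X i \<omega>)) (\<lambda>p. R p \<omega>) r)"
      unfolding plane_far_def using many_far_UN[OF winc] by metis
    then have "len (plane_far m s r \<omega> \<inter> A) = len (\<Union>n. ?W n \<omega>)" by simp
    also have "\<dots> = emeasure len_measure (\<Union>n. ?W n \<omega>)"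
      using b by (intro emeasure_len_measure[symmetric] sets.countable_UN) auto
    also have "\<dots> = (SUP n. emeasure len_measure (?W n \<omega>))"
      using b inc by (intro SUP_emeasure_incseq[symmetric] incseq_SucI) auto
    finally show ?case using b elim(2) by (simp add: emeasure_len_measure)
  qed
  moreover have "(\<integral>\<^sup>+\<omega>. (SUP n. H n \<omega>) \<partial>M) = (SUP n. marked_mean \<mu> m (B n) t s r A)"
  proof -
    have "(\<integral>\<^sup>+\<omega>. (SUP n. H n \<omega>) \<partial>M) = (SUP n. \<integral>\<^sup>+\<omega>. H n \<omega> \<partial>M)"
    proof (rule nn_integral_monotone_convergence_SUP_AE[OF _ H(1)])
      fix n
      show "AE \<omega> in M. H n \<omega> \<le> H (Suc n) \<omega>"
        using AE by eventually_elim (metis inc len_mono)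
    qed
    then show ?thesis by (simp add: H(3))
  qed
  moreover have "(\<lambda>\<omega>. SUP n. H n \<omega>) \<in> borel_measurable M" using H(1) by measurable
  ultimately show ?thesis by (intro bexI[of _ "\<lambda>\<omega>. SUP n. H n \<omega>"] conjI)
qed

lemma plane_mean_eq_SUP:
  assumes B: "\<And>n. B n \<in> sets borel" "\<And>n. emeasure lborel (B n) < \<infinity>" "incseq B" "(\<Union>n. B n) = UNIV"
    and st: "0 \<le> s" "s \<le> t" and A: "A \<in> sets borel" and m: "0 < m"
  shows "plane_mean m s r A = (SUP n. marked_mean \<mu> m (B n) t s r A)"
proof -
  obtain H where "AE \<omega> in M. len (plane_far m s r \<omega> \<inter> A) = H \<omega>"
    "(\<integral>\<^sup>+\<omega>. H \<omega> \<partial>M) = (SUP n. marked_mean \<mu> m (B n) t s r A)"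
    using plane_far_exhaustion[OF B st A m] by blast
  then show ?thesis unfolding plane_mean_def using nn_integral_cong_AE by metis
qed

lemma plane_far_measurable:
  assumes "0 \<le> t" "A \<in> sets borel" "0 < m"
  obtains H where "H \<in> borel_measurable M" "AE \<omega> in M. len (plane_far m t r \<omega> \<inter> A) = H \<omega>"
    "(\<integral>\<^sup>+\<omega>. H \<omega> \<partial>M) = plane_mean m t r A"
proof -
  obtain H where H: "H \<in> borel_measurable M" "AE \<omega> in M. len (plane_far m t r \<omega> \<inter> A) = H \<omega>"
    using plane_far_exhaustion[OF cball_exhaustion assms(1) order_refl assms(2,3)] by blast
  then have "(\<integral>\<^sup>+\<omega>. H \<omega> \<partial>M) = plane_mean m t r A"
    unfolding plane_mean_def by (intro nn_integral_cong_AE) (auto elim: eventually_mono)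
  then show ?thesis using H that by blast
qed

lemma plane_mean_similarity:
  assumes c: "0 < c" and t: "0 \<le> t" and A: "A \<in> sets borel" and m: "0 < m"
  shows "plane_mean m t (c * r) (similarity a c ` A) = ennreal c * plane_mean m (c\<^sup>2 * t) r A"
proof -
  let ?B = "\<lambda>n. cball (0::complex) (real n)" and ?f = "similarity a c"
  have "plane_mean m t (c * r) (?f ` A) = (SUP n. marked_mean \<mu> m (?f ` ?B n) t t (c * r) (?f ` A))"
  proof (rule plane_mean_eq_SUP)
    show "?f ` ?B n \<in> sets borel" for n using cball_exhaustion(1) by (rule sets_similarity_image[OF c])
    show "emeasure lborel (?f ` ?B n) < \<infinity>" for n
      using cball_exhaustion(2)[of n] by (simp only: emeasure_lborel_similarity[OF c cball_exhaustion(1)])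
        (simp add: ennreal_mult_less_top)
    show "incseq (\<lambda>n. ?f ` ?B n)" using cball_exhaustion(3) unfolding incseq_def by (blast intro: image_mono)
    show "(\<Union>n. ?f ` ?B n) = UNIV"
      using surj_similarity[OF c] cball_exhaustion(4) by (simp only: image_UN[symmetric])
    show "?f ` A \<in> sets borel" using A by (rule sets_similarity_image[OF c])
  qed (use t m in auto)
  also have "\<dots> = (SUP n. ennreal c * marked_mean \<mu> m (?B n) (c\<^sup>2 * t) (c\<^sup>2 * t) r A)"
    using marked_mean_similarity[OF c A cball_exhaustion(1) m t] by simp
  also have "\<dots> = ennreal c * (SUP n. marked_mean \<mu> m (?B n) (c\<^sup>2 * t) (c\<^sup>2 * t) r A)"
    by (rule SUP_mult_left_ennreal[symmetric])
  also have "(SUP n. marked_mean \<mu> m (?B n) (c\<^sup>2 * t) (c\<^sup>2 * t) r A) = plane_mean m (c\<^sup>2 * t) r A"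
    using t A m by (intro plane_mean_eq_SUP[symmetric] cball_exhaustion) auto
  finally show ?thesis .
qed

lemma plane_mean_thinned:
  assumes A: "A \<in> sets borel" and s: "0 \<le> s" "s \<le> 1" and m: "0 < m"
  shows "ennreal (1 - (1 - s\<^sup>2) ^ m) * plane_mean m 1 r A \<le> plane_mean 1 s r A"
proof -
  let ?B = "\<lambda>n. cball (0::complex) (real n)"
  have "ennreal (1 - (1 - s\<^sup>2) ^ m) * plane_mean m 1 r A =
     (SUP n. ennreal (1 - (1 - s\<^sup>2) ^ m) * marked_mean \<mu> m (?B n) 1 1 r A)"
    using plane_mean_eq_SUP[OF cball_exhaustion, of 1 1 A m r] A m by (simp add: SUP_mult_left_ennreal)
  also have "\<dots> \<le> (SUP n. marked_mean \<mu> 1 (?B n) 1 s r A)"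
    by (intro SUP_mono' marked_mean_thinned[OF cball_exhaustion(1) A s m])
  also have "\<dots> = plane_mean 1 s r A"
    using s A by (intro plane_mean_eq_SUP[symmetric] cball_exhaustion) auto
  finally show ?thesis .
qed

lemma plane_far_antimono: "r' \<le> r \<Longrightarrow> plane_far m t r \<omega> \<subseteq> plane_far m t r' \<omega>"
  unfolding plane_far_def by (rule many_far_mono) auto

lemma plane_mean_antimono: "r' \<le> r \<Longrightarrow> plane_mean m t r A \<le> plane_mean m t r' A"
  unfolding plane_mean_def by (intro nn_integral_mono len_mono Int_mono plane_far_antimono) auto

lemma plane_mean_UN:
  assumes "0 \<le> t" "0 < m" and A: "\<And>i::nat. A i \<in> sets borel" "disjoint_family A"
  shows "plane_mean m t r (\<Union>i. A i) = (\<Sum>i. plane_mean m t r (A i))"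
proof -
  have "\<forall>i. \<exists>H. H \<in> borel_measurable M \<and> (AE \<omega> in M. len (plane_far m t r \<omega> \<inter> A i) = H \<omega>) \<and>
      (\<integral>\<^sup>+\<omega>. H \<omega> \<partial>M) = plane_mean m t r (A i)"
    using plane_far_measurable[OF assms(1) A(1) assms(2)] by blast
  from choice[OF this] obtain H where
    "\<forall>i. H i \<in> borel_measurable M \<and> (AE \<omega> in M. len (plane_far m t r \<omega> \<inter> A i) = H i \<omega>) \<and>
      (\<integral>\<^sup>+\<omega>. H i \<omega> \<partial>M) = plane_mean m t r (A i)" ..
  then have H: "\<And>i. H i \<in> borel_measurable M" "\<And>i. AE \<omega> in M. len (plane_far m t r \<omega> \<inter> A i) = H i \<omega>"
    "\<And>i. (\<integral>\<^sup>+\<omega>. H i \<omega> \<partial>M) = plane_mean m t r (A i)" by (simp_all only:)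
  have AE: "AE \<omega> in M. \<forall>i. len (plane_far m t r \<omega> \<inter> A i) = H i \<omega>" using H(2) by (simp add: AE_all_countable)
  have "plane_mean m t r (\<Union>i. A i) = (\<integral>\<^sup>+\<omega>. (\<Sum>i. H i \<omega>) \<partial>M)"
    unfolding plane_mean_def
  proof (rule nn_integral_cong_AE, use AE_space AE in eventually_elim)
    case (elim \<omega>)
    let ?D = "\<lambda>i. plane_far m t r \<omega> \<inter> A i"
    have b: "?D i \<in> sets borel" for i using A(1) sets_plane_far[OF elim(1)] by auto
    have "emeasure len_measure (\<Union>i. ?D i) = len (\<Union>i. ?D i)"
      using b by (intro emeasure_len_measure sets.countable_UN) auto
    then have "len (plane_far m t r \<omega> \<inter> (\<Union>i. A i)) = emeasure len_measure (\<Union>i. ?D i)"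
      by (simp only: Int_UN_distrib)
    also have "\<dots> = (\<Sum>i. emeasure len_measure (?D i))"
      using b A(2) by (intro suminf_emeasure[symmetric]) (auto simp: disjoint_family_on_def)
    also have "\<dots> = (\<Sum>i. H i \<omega>)" using b elim(2) by (simp add: emeasure_len_measure)
    finally show ?case .
  qed
  also have "\<dots> = (\<Sum>i. \<integral>\<^sup>+\<omega>. H i \<omega> \<partial>M)" using H(1) by (rule nn_integral_suminf)
  finally show ?thesis by (simp add: H(3))
qed

end

context weak_SIRSN
begin

text \<open>
  The intensity at time \<open>1\<close>, normalized by the unit disc.
\<close>

definition intensity :: "real \<Rightarrow> ennreal" where
  "intensity r = plane_mean 1 1 r (ball 0 1) / emeasure lborel (ball 0 1 :: complex set)"

lemma plane_mean_le_area:
  "\<exists>l<\<infinity>. \<forall>r. \<forall>A\<in>sets borel. plane_mean 1 1 r A \<le> l * emeasure lborel A"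
proof -
  obtain l where l: "l < \<infinity>" "has_edge_intensity M (network X R 1) l" using finite_edge_intensity by blast
  have "plane_mean 1 1 r A \<le> l * emeasure lborel A" if "A \<in> sets borel" for r A
  proof -
    have "plane_mean 1 1 r A \<le> (\<integral>\<^sup>+\<omega>. len (network X R 1 \<omega> \<inter> A) \<partial>M)"
      unfolding plane_mean_def plane_far_def network_def
      by (intro nn_integral_mono len_mono Int_mono many_far_subset) auto
    then show ?thesis using l(2) that by (simp add: has_edge_intensity_def)
  qed
  then show ?thesis using l(1) by blast
qed

lemma plane_mean_eq_intensity:
  assumes "A \<in> sets borel"
  shows "plane_mean 1 1 r A = intensity r * emeasure lborel A"
proof -
  define N where "N = measure_of UNIV (sets borel) (plane_mean 1 1 r)"
  obtain l where l: "l < \<infinity>" "\<forall>r. \<forall>A\<in>sets borel. plane_mean 1 1 r A \<le> l * emeasure lborel A"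
    using plane_mean_le_area by blast
  note l = l(1) l(2)[rule_format]
  have sN: "sets N = sets borel"
    using sets.sigma_sets_eq[of "borel :: complex measure"] by (simp add: N_def sets_measure_of_conv)
  have em: "emeasure N A = plane_mean 1 1 r A" if "A \<in> sets borel" for A
  proof (rule emeasure_measure_of[OF N_def])
    show "positive (sets N) (plane_mean 1 1 r)" by (simp add: positive_def plane_mean_def)
    show "countably_additive (sets N) (plane_mean 1 1 r)"
      unfolding countably_additive_def sN
      by (intro allI impI plane_mean_UN[symmetric]) auto
  qed (use that sN in auto)
  have "sigma_finite_measure N"
  proof
    have "emeasure N (cball 0 (real n)) < \<infinity>" for n
      using order_le_less_trans[OF l(2)[OF cball_exhaustion(1), of r n]] cball_exhaustion(1,2)[of n] l(1)
      by (simp add: em ennreal_mult_less_top)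
    then show "\<exists>A. countable A \<and> A \<subseteq> sets N \<and> \<Union>A = space N \<and> (\<forall>a\<in>A. emeasure N a \<noteq> \<infinity>)"
      using cball_exhaustion(1,4) sets_eq_imp_space_eq[OF sN]
      by (intro exI[of _ "range (\<lambda>n. cball 0 (real n))"]) (auto simp: sN less_top)
  qed
  moreover have "emeasure N ((+) a ` A) = emeasure N A" if "A \<in> sets borel" for a A
  proof -
    have eq: "(+) a ` A = similarity a 1 ` A" by (simp add: similarity_def[abs_def])
    then have "(+) a ` A \<in> sets borel" using sets_similarity_image[of 1 A a] that by simp
    then show ?thesis
      using plane_mean_similarity[of 1 1 A 1 r a] that by (simp add: em eq)
  qed
  ultimately have "emeasure N A = emeasure N (ball 0 1) / emeasure lborel (ball 0 1 :: complex set) * emeasure lborel A"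
    using sN assms by (intro translation_invariant_eq_lborel)
  then show ?thesis using assms by (simp add: em intensity_def)
qed

lemma intensity_antimono: "r' \<le> r \<Longrightarrow> intensity r \<le> intensity r'"
  unfolding intensity_def by (intro divide_right_mono_ennreal plane_mean_antimono)

lemma area_unit_ball: "0 < emeasure lborel (ball 0 1 :: complex set)" "emeasure lborel (ball 0 1 :: complex set) < \<infinity>"
  using emeasure_ball[of 1 "0::complex"] emeasure_lborel_ball_finite[of "0::complex" 1] by simp_all

lemma intensity_finite: "intensity r < \<infinity>"
proof -
  obtain l where l: "l < \<infinity>" "\<forall>r. \<forall>A\<in>sets borel. plane_mean 1 1 r A \<le> l * emeasure lborel A"
    using plane_mean_le_area by blast
  note l = l(1) l(2)[rule_format]
  have "plane_mean 1 1 r (ball 0 1) < \<infinity>"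
    using order_le_less_trans[OF l(2)[of "ball 0 1" r]] l(1) area_unit_ball by (auto simp: ennreal_mult_less_top)
  then show ?thesis
    unfolding intensity_def using area_unit_ball
    by (auto simp: ennreal_divide_eq_top_iff less_top[symmetric])
qed

text \<open>Scaling expresses the intensity at time \<open>t\<close> by the one at time \<open>1\<close>.\<close>

lemma plane_mean_scaled:
  assumes t: "0 < t" and A: "A \<in> sets borel"
  shows "plane_mean 1 t r A = ennreal (sqrt t) * intensity (sqrt t * r) * emeasure lborel A"
proof -
  define c where "c = sqrt t"
  have c: "0 < c" "c\<^sup>2 = t" using t by (auto simp: c_def)
  have "ennreal c * plane_mean 1 t r A = plane_mean 1 1 (c * r) (similarity 0 c ` A)"
    using plane_mean_similarity[of c 1 A 1 r 0] c A by simp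
  also have "\<dots> = intensity (c * r) * (ennreal (c\<^sup>2) * emeasure lborel A)"
    using c A by (simp only: plane_mean_eq_intensity sets_similarity_image emeasure_lborel_similarity)
  also have "\<dots> = ennreal c * (ennreal c * intensity (c * r) * emeasure lborel A)"
  proof -
    have "ennreal (c\<^sup>2) = ennreal c * ennreal c"
      using c(1) by (simp add: power2_eq_square ennreal_mult)
    then show ?thesis by (simp only: mult_ac)
  qed
  finally have "ennreal c * plane_mean 1 t r A = ennreal c * (ennreal c * intensity (c * r) * emeasure lborel A)" .
  then show ?thesis
    using c by (subst (asm) ennreal_mult_cancel_left) (auto simp: c_def[symmetric])
qed

text \<open>
  By monotone convergence the infimum is the intensity of the points covered by routes with arbitrarily
  distant endpoints, and these points are covered by \<open>m\<close> disjoint pairs.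
\<close>

lemma INF_intensity_le:
  assumes "0 < m"
  shows "(INF n. intensity (real n)) * emeasure lborel (ball 0 1 :: complex set) \<le> plane_mean m 1 r (ball 0 1)"
proof -
  let ?A = "ball 0 1 :: complex set"
  have "\<forall>n. \<exists>H. H \<in> borel_measurable M \<and> (AE \<omega> in M. len (plane_far 1 1 (real n) \<omega> \<inter> ?A) = H \<omega>) \<and>
      (\<integral>\<^sup>+\<omega>. H \<omega> \<partial>M) = plane_mean 1 1 (real n) ?A"
  proof
    fix n :: nat
    show "\<exists>H. H \<in> borel_measurable M \<and> (AE \<omega> in M. len (plane_far 1 1 (real n) \<omega> \<inter> ?A) = H \<omega>) \<and>
      (\<integral>\<^sup>+\<omega>. H \<omega> \<partial>M) = plane_mean 1 1 (real n) ?A"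
      by (rule plane_far_measurable[of 1 ?A 1 "real n"]) auto
  qed
  from choice[OF this] obtain H where
    "\<forall>n. H n \<in> borel_measurable M \<and> (AE \<omega> in M. len (plane_far 1 1 (real n) \<omega> \<inter> ?A) = H n \<omega>) \<and>
      (\<integral>\<^sup>+\<omega>. H n \<omega> \<partial>M) = plane_mean 1 1 (real n) ?A" ..
  then have H: "\<And>n. H n \<in> borel_measurable M" "\<And>n. AE \<omega> in M. len (plane_far 1 1 (real n) \<omega> \<inter> ?A) = H n \<omega>"
    "\<And>n. (\<integral>\<^sup>+\<omega>. H n \<omega> \<partial>M) = plane_mean 1 1 (real n) ?A" by (simp_all only:)
  have int: "(\<integral>\<^sup>+\<omega>. H n \<omega> \<partial>M) = intensity (real n) * emeasure lborel ?A" for n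
    unfolding H(3) by (rule plane_mean_eq_intensity) simp
  have fin: "(\<integral>\<^sup>+\<omega>. H n \<omega> \<partial>M) < \<infinity>" for n
    unfolding int using intensity_finite area_unit_ball(2) by (simp add: ennreal_mult_less_top)
  have AE: "AE \<omega> in M. \<forall>n. len (plane_far 1 1 (real n) \<omega> \<inter> ?A) = H n \<omega>"
    using H(2) by (simp add: AE_all_countable)
  have anti: "AE \<omega> in M. H (Suc n) \<omega> \<le> H n \<omega>" for n
    using AE by eventually_elim (metis Int_mono len_mono of_nat_Suc order_refl plane_far_antimono le_add_same_cancel1 zero_le_one add.commute)
  have "(INF n. intensity (real n)) * emeasure lborel ?A \<le> (INF n. intensity (real n) * emeasure lborel ?A)"
    by (intro INF_greatest mult_right_mono INF_lower) auto
  also have "\<dots> = (\<integral>\<^sup>+\<omega>. (INF n. H n \<omega>) \<partial>M)"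
    unfolding int[symmetric]
    using anti H(1) fin[of 0] by (intro nn_integral_monotone_convergence_INF_AE'[symmetric]) auto
  also have "\<dots> \<le> plane_mean m 1 r ?A"
    unfolding plane_mean_def
  proof (rule nn_integral_mono_AE)
    have "AE \<omega> in M. H 0 \<omega> \<noteq> \<infinity>"
      using fin[of 0] H(1) by (intro nn_integral_noteq_infinite) auto
    then show "AE \<omega> in M. (INF n. H n \<omega>) \<le> len (plane_far m 1 r \<omega> \<inter> ?A)"
      using AE_space AE
    proof eventually_elim
      case (elim \<omega>)
      let ?D = "\<lambda>n::nat. plane_far 1 1 (real n) \<omega> \<inter> ?A"
      have b: "?D n \<in> sets borel" for n using sets_plane_far[OF elim(2)] by auto
      have dec: "decseq ?D"
        unfolding decseq_def by (intro allI impI Int_mono plane_far_antimono) auto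
      have em: "emeasure len_measure (?D n) = H n \<omega>" for n using b elim(3) by (simp add: emeasure_len_measure)
      have lt: "H n \<omega> \<noteq> \<infinity>" for n
      proof -
        have "H n \<omega> \<le> H 0 \<omega>"
          using elim(3)[rule_format, of n] elim(3)[rule_format, of 0] len_mono[OF decseqD[OF dec, of 0 n]] by simp
        then show ?thesis using elim(1) by (metis top_unique infinity_ennreal_def)
      qed
      have "(INF n. H n \<omega>) = (INF n. emeasure len_measure (?D n))" by (simp only: em)
      also have "\<dots> = emeasure len_measure (\<Inter>n. ?D n)"
      proof (rule INF_emeasure_decseq)
        show "emeasure len_measure (?D n) \<noteq> \<infinity>" for n unfolding em by (rule lt)
      qed (use b dec in auto)
      also have "\<dots> = len (\<Inter>n. ?D n)"
      proof (rule emeasure_len_measure)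
        show "(\<Inter>n. ?D n) \<in> sets borel" using b by (intro sets.countable_INT'') auto
      qed
      also have "\<dots> \<le> len (plane_far m 1 r \<omega> \<inter> ?A)"
      proof (rule len_mono, rule subsetI)
        fix x assume x: "x \<in> (\<Inter>n. ?D n)"
        have "x \<in> plane_far m 1 r \<omega>"
          unfolding plane_far_def
        proof (rule many_far_of_all_far)
          fix n
          have "x \<in> ?D n" using x by (rule INT_D) simp
          then show "x \<in> many_far 1 (arrived X 1 \<omega>) (\<lambda>i. fst (X i \<omega>)) (\<lambda>p. R p \<omega>) (real n)"
            by (simp only: plane_far_def Int_iff)
        qed
        then show "x \<in> plane_far m 1 r \<omega> \<inter> ?A" using x by auto
      qed
      finally show ?case .
    qed
  qed
  finally show ?thesis .
qed

text \<open>
  By thinning to a quarter of the points, the points covered by routes with distant endpoints at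
  time \<open>1\<close> are still covered at time \<open>1/4\<close>, whereas by scaling their intensity is halved.
\<close>

lemma INF_intensity: "(INF n. intensity (real n)) = 0"
proof -
  let ?A = "ball 0 1 :: complex set"
  define \<kappa> where "\<kappa> = (INF n. intensity (real n))"
  have fin: "\<kappa> < \<infinity>"
    unfolding \<kappa>_def using intensity_finite[of "real 0"] by (rule order_le_less_trans[OF INF_lower[OF UNIV_I]])
  \<comment> \<open>The radius \<open>2 * real n\<close> at time \<open>1 / 4\<close> corresponds to the radius \<open>real n\<close> at time \<open>1\<close>, and
    \<open>15 / 16 = 1 - (1 / 4)\<^sup>2\<close> is the probability that a given pair does not survive.\<close>
  have step: "\<kappa> \<le> ennreal (1 / 2) * intensity (real n)" for n
  proof -
    have "ennreal (1 - (15 / 16) ^ Suc m) * \<kappa> \<le> ennreal (1 / 2) * intensity (real n)" for m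
    proof -
      have "ennreal (1 - (15 / 16) ^ Suc m) * \<kappa> * emeasure lborel ?A \<le>
          ennreal (1 - (1 - (1 / 4)\<^sup>2) ^ Suc m) * plane_mean (Suc m) 1 (2 * real n) ?A"
        using INF_intensity_le[of "Suc m" "2 * real n"]
        by (simp add: \<kappa>_def mult.assoc power2_eq_square mult_left_mono del: power_Suc)
      also have "\<dots> \<le> plane_mean 1 (1 / 4) (2 * real n) ?A"
        by (rule plane_mean_thinned) auto
      also have "\<dots> = ennreal (1 / 2) * intensity (real n) * emeasure lborel ?A"
        by (subst plane_mean_scaled) (auto simp: real_sqrt_divide)
      finally show ?thesis
        using area_unit_ball ennreal_mult_le_mult_iff[of "emeasure lborel ?A" "ennreal (1 - (15 / 16) ^ Suc m) * \<kappa>"]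
        by (simp add: mult.commute[of _ "emeasure lborel ?A"] del: power_Suc)
    qed
    moreover have "(\<lambda>m. ennreal (1 - (15 / 16) ^ Suc m) * \<kappa>) \<longlonglongrightarrow> ennreal (1 - 0) * \<kappa>"
    proof (rule tendsto_mult_ennreal)
      have "(\<lambda>m. (15 / 16 :: real) ^ Suc m) \<longlonglongrightarrow> 0"
        by (intro LIMSEQ_Suc LIMSEQ_power_zero) auto
      then show "(\<lambda>m. ennreal (1 - (15 / 16) ^ Suc m)) \<longlonglongrightarrow> ennreal (1 - 0)"
        by (intro tendsto_ennrealI tendsto_diff tendsto_const)
    qed (use fin in auto)
    ultimately show ?thesis by (intro LIMSEQ_le_const2[of _ \<kappa>]) auto
  qed
  have "ennreal 2 * \<kappa> \<le> intensity (real n)" for n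
  proof -
    have "ennreal 2 * \<kappa> \<le> ennreal 2 * (ennreal (1 / 2) * intensity (real n))"
      using step by (rule mult_left_mono) simp
    also have "\<dots> = intensity (real n)"
      by (simp only: mult.assoc[symmetric] ennreal_mult[symmetric]) simp
    finally show ?thesis .
  qed
  then have "ennreal 2 * \<kappa> \<le> \<kappa>" unfolding \<kappa>_def by (intro INF_greatest) simp
  have "\<kappa> = 0"
  proof (cases \<kappa>)
    case (real r)
    then have "ennreal (2 * r) \<le> ennreal r"
      using \<open>ennreal 2 * \<kappa> \<le> \<kappa>\<close> by (simp only: ennreal_mult)
    then show ?thesis using real by (simp add: ennreal_le_iff)
  qed (use fin in simp_all)
  then show ?thesis by (simp add: \<kappa>_def)
qed

lemma intensity_tendsto: "(intensity \<longlongrightarrow> 0) at_top"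
proof (rule order_tendstoI)
  fix a :: ennreal assume "0 < a"
  then have "(INF n. intensity (real n)) < a" by (simp add: INF_intensity)
  then obtain n where "intensity (real n) < a" by (auto simp: INF_less_iff)
  show "eventually (\<lambda>r. intensity r < a) at_top"
    using eventually_ge_at_top[of "real n"]
    by (rule eventually_mono) (use \<open>intensity (real n) < a\<close> in \<open>auto intro: order_le_less_trans[OF intensity_antimono]\<close>)
qed auto

end

section \<open>Routes are arcs\<close>

text \<open>The polygonal line through the points \<open>v i\<close>, parametrized so that it is at \<open>v i\<close> at time \<open>i\<close>.\<close>

definition polyline :: "(int \<Rightarrow> complex) \<Rightarrow> real \<Rightarrow> complex" where
  "polyline v u = v \<lfloor>u\<rfloor> + of_real (frac u) * (v (\<lfloor>u\<rfloor> + 1) - v \<lfloor>u\<rfloor>)"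

lemma polyline_linear:
  assumes "real_of_int i \<le> u" "u \<le> real_of_int i + 1"
  shows "polyline v u = v i + of_real (u - of_int i) * (v (i + 1) - v i)"
proof (cases "u = real_of_int i + 1")
  case True
  have fl: "\<lfloor>u\<rfloor> = i + 1" unfolding True by linarith
  have "frac u = 0" unfolding frac_def fl using True by simp
  then show ?thesis unfolding polyline_def fl using True by simp
next
  case False
  then have fl: "\<lfloor>u\<rfloor> = i" using assms by linarith
  then show ?thesis by (simp add: polyline_def frac_def)
qed

lemma polyline_of_int [simp]: "polyline v (real_of_int i) = v i"
  by (simp add: polyline_def)

lemma polyline_image_Icc: "polyline v ` {real_of_int i..real_of_int i + 1} = closed_segment (v i) (v (i + 1))"
proof -
  have "polyline v ` {real_of_int i..real_of_int i + 1} =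
    (\<lambda>u. v i + of_real (u - of_int i) * (v (i + 1) - v i)) ` {real_of_int i..real_of_int i + 1}"
    using polyline_linear[of i _ v] by (intro image_cong refl) simp
  also have "\<dots> = (\<lambda>t. v i + of_real t * (v (i + 1) - v i)) ` (\<lambda>u. u - of_int i) ` {real_of_int i..real_of_int i + 1}"
    by (simp only: image_image)
  also have "(\<lambda>u. u - of_int i) ` {real_of_int i..real_of_int i + 1} = {0..1::real}"
  proof (intro set_eqI iffI)
    fix t :: real assume "t \<in> {0..1}"
    then show "t \<in> (\<lambda>u. u - of_int i) ` {real_of_int i..real_of_int i + 1}"
      by (intro image_eqI[of _ _ "t + of_int i"]) auto
  qed auto
  also have "(\<lambda>t. v i + of_real t * (v (i + 1) - v i)) ` {0..1} = closed_segment (v i) (v (i + 1))"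
    unfolding closed_segment_image_interval
    by (intro image_cong refl) (simp add: scaleR_conv_of_real algebra_simps)
  finally show ?thesis .
qed

lemma polyline_in_edge: "polyline v u \<in> closed_segment (v \<lfloor>u\<rfloor>) (v (\<lfloor>u\<rfloor> + 1))"
proof -
  have "u \<in> {real_of_int \<lfloor>u\<rfloor>..real_of_int \<lfloor>u\<rfloor> + 1}" by auto
  then show ?thesis unfolding polyline_image_Icc[symmetric] by (rule imageI)
qed

lemma isCont_polyline: "isCont (polyline v) u"
proof -
  define i where "i = \<lfloor>u\<rfloor>"
  have seg: "continuous_on {real_of_int j..real_of_int j + 1} (polyline v)" for j
  proof -
    have "continuous_on {real_of_int j..real_of_int j + 1} (\<lambda>u. v j + of_real (u - of_int j) * (v (j + 1) - v j))"
      by (intro continuous_intros)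
    then show ?thesis
      by (rule continuous_on_eq) (rule polyline_linear[symmetric]; simp)
  qed
  have "continuous_on ({real_of_int (i - 1)..real_of_int (i - 1) + 1} \<union> {real_of_int i..real_of_int i + 1}) (polyline v)"
    by (intro continuous_on_closed_Un closed_atLeastAtMost seg)
  then have "continuous_on {real_of_int i - 1<..<real_of_int i + 1} (polyline v)"
    by (rule continuous_on_subset) auto
  moreover have "u \<in> {real_of_int i - 1<..<real_of_int i + 1}" unfolding i_def by (auto; linarith)
  ultimately show ?thesis by (simp add: continuous_on_eq_continuous_at)
qed

lemma dist_polyline_less:
  assumes "dist (v \<lfloor>u\<rfloor>) z < e" "dist (v (\<lfloor>u\<rfloor> + 1)) z < e"
  shows "dist (polyline v u) z < e"
proof -
  have "closed_segment (v \<lfloor>u\<rfloor>) (v (\<lfloor>u\<rfloor> + 1)) \<subseteq> ball z e"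
    using assms by (intro closed_segment_subset) (auto simp: dist_commute)
  then show ?thesis using polyline_in_edge[of v u] by (auto simp: dist_commute)
qed

lemma polyline_tendsto_at_bot:
  assumes "(v \<longlongrightarrow> z) at_bot"
  shows "(polyline v \<longlongrightarrow> z) at_bot"
proof (rule tendstoI)
  fix e :: real assume "0 < e"
  then obtain k where k: "\<And>i. i \<le> k \<Longrightarrow> dist (v i) z < e"
    using tendstoD[OF assms] by (auto simp: eventually_at_bot_linorder)
  show "eventually (\<lambda>u. dist (polyline v u) z < e) at_bot"
    unfolding eventually_at_bot_linorder
  proof (intro exI allI impI)
    fix u assume "u \<le> real_of_int (k - 1)"
    then have "\<lfloor>u\<rfloor> + 1 \<le> k" by linarith
    then show "dist (polyline v u) z < e" by (intro dist_polyline_less k) auto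
  qed
qed

lemma polyline_tendsto_at_top:
  assumes "(v \<longlongrightarrow> z) at_top"
  shows "(polyline v \<longlongrightarrow> z) at_top"
proof (rule tendstoI)
  fix e :: real assume "0 < e"
  then obtain k where k: "\<And>i. k \<le> i \<Longrightarrow> dist (v i) z < e"
    using tendstoD[OF assms] by (auto simp: eventually_at_top_linorder)
  show "eventually (\<lambda>u. dist (polyline v u) z < e) at_top"
    unfolding eventually_at_top_linorder
  proof (intro exI allI impI)
    fix u assume "real_of_int k \<le> u"
    then have "k \<le> \<lfloor>u\<rfloor>" by linarith
    then show "dist (polyline v u) z < e" by (intro dist_polyline_less k) auto
  qed
qed

text \<open>
  The parameter of the polygonal line ranges over an interval that may be unbounded; the tangent
  turns it into a bounded one, to which the endpoints are added.
\<close>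

lemma route_arc:
  assumes "route z z' A"
  obtains g where "arc g" "path_image g = A" "g 0 = z" "g 1 = z'"
proof -
  have zz': "z \<noteq> z'" using assms by (simp add: route_def)
  obtain I :: "int set" and v :: "int \<Rightarrow> complex" where body:
    "let E = {i. i \<in> I \<and> i + 1 \<in> I};
         edge = (\<lambda>i. closed_segment (v i) (v (i + 1)))
      in (\<forall>i\<in>I. \<forall>j\<in>I. {i..j} \<subseteq> I) \<and>
         ((\<exists>a\<in>I. I \<subseteq> {a..} \<and> v a = z) \<or>
          (\<forall>a. \<exists>i\<in>I. i < a) \<and> (v \<longlongrightarrow> z) at_bot \<and> (\<forall>i\<in>E. z \<notin> edge i)) \<and>
         ((\<exists>b\<in>I. I \<subseteq> {..b} \<and> v b = z') \<or>
          (\<forall>b. \<exists>i\<in>I. b < i) \<and> (v \<longlongrightarrow> z') at_top \<and> (\<forall>i\<in>E. z' \<notin> edge i)) \<and>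
         (\<forall>i\<in>E. v i \<noteq> v (i + 1)) \<and>
         (\<forall>i\<in>E. \<forall>j\<in>E. i < j \<longrightarrow> edge i \<inter> edge j = (if j = i + 1 then {v j} else {})) \<and>
         (\<lambda>i. dist (v i) (v (i + 1))) summable_on E \<and>
         A = {z, z'} \<union> (\<Union>i\<in>E. edge i)"
    using assms unfolding route_def by (elim conjE exE) (rule that)
  define E where "E = {i. i \<in> I \<and> i + 1 \<in> I}"
  define edge where "edge i = closed_segment (v i) (v (i + 1))" for i
  note body' = body[unfolded Let_def E_def[symmetric] edge_def[symmetric]]
  note conv = body'[THEN conjunct1] and body' = body'[THEN conjunct2]
  note low = body'[THEN conjunct1] and body' = body'[THEN conjunct2]
  note upp = body'[THEN conjunct1] and body' = body'[THEN conjunct2]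
  note ne = body'[THEN conjunct1] and body' = body'[THEN conjunct2]
  note cross = body'[THEN conjunct1] and A = body'[THEN conjunct2, THEN conjunct2]
  let ?p = "polyline v"
  have lin_inj: "u = w" if i: "i \<in> E" and u: "real_of_int i \<le> u" "u \<le> real_of_int i + 1"
      and w: "real_of_int i \<le> w" "w \<le> real_of_int i + 1" and eq: "?p u = ?p w" for i u w
  proof -
    have "of_real (u - of_int i) * (v (i + 1) - v i) = of_real (w - of_int i) * (v (i + 1) - v i)"
      using eq polyline_linear[OF u] polyline_linear[OF w] by simp
    moreover have "v (i + 1) - v i \<noteq> 0" using ne i by auto
    ultimately have "complex_of_real (u - of_int i) = complex_of_real (w - of_int i)" by simp
    then have "u - of_int i = w - of_int i" by (simp only: of_real_eq_iff)
    then show ?thesis by simp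
  qed
  have inj_lt: "?p u \<noteq> ?p w" if uw: "u < w" "\<lfloor>u\<rfloor> \<in> E" "\<lfloor>w\<rfloor> \<in> E" for u w
  proof
    assume eq: "?p u = ?p w"
    have le: "\<lfloor>u\<rfloor> \<le> \<lfloor>w\<rfloor>" using uw(1) by (intro floor_mono) simp
    show False
    proof (cases "\<lfloor>u\<rfloor> = \<lfloor>w\<rfloor>")
      case True
      then have "u = w" using lin_inj[OF uw(2) _ _ _ _ eq] by linarith
      then show False using uw(1) by simp
    next
      case False
      then have lt: "\<lfloor>u\<rfloor> < \<lfloor>w\<rfloor>" using le by simp
      have "?p u \<in> edge \<lfloor>u\<rfloor> \<inter> edge \<lfloor>w\<rfloor>"
        using polyline_in_edge[of v u] polyline_in_edge[of v w] eq by (simp add: edge_def)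
      then have s: "\<lfloor>w\<rfloor> = \<lfloor>u\<rfloor> + 1" "?p u = v \<lfloor>w\<rfloor>"
        using cross uw(2,3) lt by (auto split: if_splits)
      then have "?p u = ?p (real_of_int \<lfloor>u\<rfloor> + 1)"
        using polyline_of_int[of v "\<lfloor>u\<rfloor> + 1"] by simp
      then have "u = real_of_int \<lfloor>u\<rfloor> + 1" using lin_inj[OF uw(2), of u "real_of_int \<lfloor>u\<rfloor> + 1"] by linarith
      then show False by linarith
    qed
  qed
  obtain \<alpha> where \<alpha>: "(\<exists>a\<in>I. I \<subseteq> {a..} \<and> v a = z \<and> \<alpha> = arctan (real_of_int a)) \<or>
      ((\<forall>a. \<exists>i\<in>I. i < a) \<and> (v \<longlongrightarrow> z) at_bot \<and> (\<forall>i\<in>E. z \<notin> edge i)) \<and> \<alpha> = - (pi / 2)"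
    using low by blast
  obtain \<beta> where \<beta>: "(\<exists>b\<in>I. I \<subseteq> {..b} \<and> v b = z' \<and> \<beta> = arctan (real_of_int b)) \<or>
      ((\<forall>b. \<exists>i\<in>I. b < i) \<and> (v \<longlongrightarrow> z') at_top \<and> (\<forall>i\<in>E. z' \<notin> edge i)) \<and> \<beta> = pi / 2"
    using upp by blast
  have \<alpha>_ge: "- (pi / 2) \<le> \<alpha>" "\<alpha> < pi / 2"
    using \<alpha> arctan_bounded pi_gt_zero by (auto simp: less_imp_le)
  from \<beta> have "\<beta> = pi / 2 \<or> (\<exists>y. \<beta> = arctan y)" by blast
  moreover have "- (pi / 2) < pi / 2" using pi_gt_zero by linarith
  ultimately have \<beta>_le: "\<beta> \<le> pi / 2" "- (pi / 2) < \<beta>"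
    using arctan_bounded by (metis less_imp_le order_refl)+
  have \<alpha>\<beta>: "\<alpha> < \<beta>"
    using \<alpha>
  proof (elim disjE bexE conjE)
    fix a assume a: "a \<in> I" "I \<subseteq> {a..}" "v a = z" "\<alpha> = arctan (real_of_int a)"
    from \<beta> show ?thesis
    proof (elim disjE bexE conjE)
      fix b assume b: "b \<in> I" "v b = z'" "\<beta> = arctan (real_of_int b)"
      then have "a \<noteq> b" "a \<le> b" using a zz' by auto
      then show ?thesis using a b by (simp add: arctan_less_iff)
    qed (use \<alpha>_ge in simp)
  qed (use \<beta>_le in simp)
  have ar: "tan (arctan y) = y" "- (pi / 2) < arctan y" "arctan y < pi / 2" for y
    using arctan[of y] by auto
  have bnd: "- (pi / 2) < s" "s < pi / 2" "arctan (tan s) = s" if "\<alpha> < s" "s < \<beta>" for s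
    using that \<alpha>_ge \<beta>_le by (auto intro!: arctan_tan)
  have low_ex: "\<exists>j\<in>I. j \<le> \<lfloor>u\<rfloor>" if "\<alpha> < arctan u" for u
    using \<alpha>
  proof (elim disjE bexE conjE)
    fix a assume a: "a \<in> I" "\<alpha> = arctan (real_of_int a)"
    then have "real_of_int a < u" using that by (simp add: arctan_less_iff)
    then show ?thesis using a(1) by (intro bexI[of _ a]) linarith+
  qed (meson less_imp_le)
  have upp_ex: "\<exists>j\<in>I. \<lfloor>u\<rfloor> + 1 \<le> j" if "arctan u < \<beta>" for u
    using \<beta>
  proof (elim disjE bexE conjE)
    fix b assume b: "b \<in> I" "\<beta> = arctan (real_of_int b)"
    then have "u < real_of_int b" using that by (simp add: arctan_less_iff)
    then show ?thesis using b(1) by (intro bexI[of _ b]) linarith+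
  qed (meson zless_imp_add1_zle)
  have inE: "\<lfloor>u\<rfloor> \<in> E" if u: "\<alpha> < arctan u" "arctan u < \<beta>" for u
  proof -
    obtain j j' where "j \<in> I" "j \<le> \<lfloor>u\<rfloor>" "j' \<in> I" "\<lfloor>u\<rfloor> + 1 \<le> j'"
      using low_ex[OF u(1)] upp_ex[OF u(2)] by blast
    then have "{j..j'} \<subseteq> I" "\<lfloor>u\<rfloor> \<in> {j..j'}" "\<lfloor>u\<rfloor> + 1 \<in> {j..j'}" using conv by auto
    then show ?thesis by (auto simp: E_def)
  qed
  have z_notin: "?p u \<noteq> z" if u: "\<alpha> < arctan u" "arctan u < \<beta>" for u
    using \<alpha>
  proof (elim disjE bexE conjE)
    fix a assume a: "a \<in> I" "v a = z" "\<alpha> = arctan (real_of_int a)"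
    then have au: "real_of_int a < u" using u by (simp add: arctan_less_iff)
    then have "a + 1 \<le> \<lfloor>u\<rfloor> + 1" by linarith
    moreover have "\<lfloor>u\<rfloor> + 1 \<in> I" using inE[OF u] by (simp add: E_def)
    ultimately have "{a..\<lfloor>u\<rfloor> + 1} \<subseteq> I" "a + 1 \<in> {a..\<lfloor>u\<rfloor> + 1}" using conv a(1) by auto
    then have "a \<in> E" using a(1) by (auto simp: E_def)
    then have "?p (real_of_int a) \<noteq> ?p u" using inE[OF u] au by (intro inj_lt) auto
    then show ?thesis using a(2) by auto
  next
    assume "\<forall>i\<in>E. z \<notin> edge i"
    then show ?thesis using inE[OF u] polyline_in_edge[of v u] by (auto simp: edge_def)
  qed
  have z'_notin: "?p u \<noteq> z'" if u: "\<alpha> < arctan u" "arctan u < \<beta>" for u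
    using \<beta>
  proof (elim disjE bexE conjE)
    fix b assume b: "b \<in> I" "v b = z'" "\<beta> = arctan (real_of_int b)"
    then have ub: "u < real_of_int b" using u by (simp add: arctan_less_iff)
    have fE: "\<lfloor>u\<rfloor> \<in> E" by (rule inE[OF u])
    have le: "\<lfloor>u\<rfloor> \<le> b - 1" using ub by linarith
    have "{\<lfloor>u\<rfloor>..b} \<subseteq> I" using conv b(1) fE by (auto simp: E_def)
    then have bE: "b - 1 \<in> E" using le b(1) by (auto simp: E_def)
    show ?thesis
    proof
      assume eq: "?p u = z'"
      show False
      proof (cases "\<lfloor>u\<rfloor> = b - 1")
        case True
        have "?p u = ?p (real_of_int b)" using eq b(2) by simp
        then have "u = real_of_int b" using True by (intro lin_inj[OF bE]) (simp; linarith)+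
        then show False using ub by simp
      next
        case False
        then have "\<lfloor>u\<rfloor> < b - 1" using le by simp
        moreover have "z' \<in> edge \<lfloor>u\<rfloor> \<inter> edge (b - 1)"
          using eq polyline_in_edge[of v u] b(2) by (auto simp: edge_def)
        ultimately have "z' = v (b - 1)" using cross fE bE by (auto split: if_splits)
        then show False using ne bE b(2) by auto
      qed
    qed
  next
    assume "\<forall>i\<in>E. z' \<notin> edge i"
    then show ?thesis using inE[OF u] polyline_in_edge[of v u] by (auto simp: edge_def)
  qed
  \<comment> \<open>At an end where the index set is finite, \<open>tan\<close> takes the value of the first or last index; at the
    other ends its absolute value tends to infinity.\<close>
  define h where "h s = (if s \<le> \<alpha> then z else if \<beta> \<le> s then z' else ?p (tan s))" for s
  have h_mid: "h s = ?p (tan s)" if "\<alpha> < s" "s < \<beta>" for s using that by (simp add: h_def)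
  have cont: "continuous_on {\<alpha>..\<beta>} h"
  proof (rule continuous_on_IccI[OF _ _ _ \<alpha>\<beta>])
    have "(?p \<longlongrightarrow> z) (filtermap tan (at_right \<alpha>))"
      using \<alpha>
    proof (elim disjE bexE conjE)
      fix a assume a: "v a = z" "\<alpha> = arctan (real_of_int a)"
      have "isCont tan \<alpha>" using a(2) cos_arctan_not_zero by (simp add: isCont_tan)
      then have "(tan \<longlongrightarrow> real_of_int a) (at_right \<alpha>)"
        using a(2) ar by (auto simp: isCont_def intro: filterlim_mono at_le)
      from isCont_tendsto_compose[OF isCont_polyline this, of v] show ?thesis
        using a(1) by (simp add: filterlim_def filtermap_filtermap)
    next
      assume "(v \<longlongrightarrow> z) at_bot" "\<alpha> = - (pi / 2)"
      then show ?thesis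
        using filterlim_compose[OF polyline_tendsto_at_bot filterlim_tan_at_right]
        by (simp add: filterlim_def filtermap_filtermap)
    qed
    then have "((\<lambda>s. ?p (tan s)) \<longlongrightarrow> z) (at_right \<alpha>)" by (simp add: filterlim_def filtermap_filtermap)
    moreover have "eventually (\<lambda>s. ?p (tan s) = h s) (at_right \<alpha>)"
      using eventually_at_right_less[of \<alpha>] eventually_at_right_real[OF \<alpha>\<beta>] by eventually_elim (simp add: h_mid)
    ultimately show "(h \<longlongrightarrow> h \<alpha>) (at_right \<alpha>)"
      by (simp add: h_def[of \<alpha>] tendsto_cong)
    have "(?p \<longlongrightarrow> z') (filtermap tan (at_left \<beta>))"
      using \<beta>
    proof (elim disjE bexE conjE)
      fix b assume b: "v b = z'" "\<beta> = arctan (real_of_int b)"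
      have "isCont tan \<beta>" using b(2) cos_arctan_not_zero by (simp add: isCont_tan)
      then have "(tan \<longlongrightarrow> real_of_int b) (at_left \<beta>)"
        using b(2) ar by (auto simp: isCont_def intro: filterlim_mono at_le)
      from isCont_tendsto_compose[OF isCont_polyline this, of v] show ?thesis
        using b(1) by (simp add: filterlim_def filtermap_filtermap)
    next
      assume v: "(v \<longlongrightarrow> z') at_top" and \<beta>': "\<beta> = pi / 2"
      show ?thesis
        using filterlim_compose[OF polyline_tendsto_at_top[OF v] filterlim_tan_at_left]
        unfolding \<beta>' by (simp add: filterlim_def filtermap_filtermap)
    qed
    then have "((\<lambda>s. ?p (tan s)) \<longlongrightarrow> z') (at_left \<beta>)" by (simp add: filterlim_def filtermap_filtermap)
    moreover have "eventually (\<lambda>s. ?p (tan s) = h s) (at_left \<beta>)"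
      using eventually_at_left_real[OF \<alpha>\<beta>] by eventually_elim (simp add: h_mid)
    ultimately show "(h \<longlongrightarrow> h \<beta>) (at_left \<beta>)"
      using \<alpha>\<beta> by (simp add: h_def[of \<beta>] tendsto_cong)
    fix s assume s: "\<alpha> < s" "s < \<beta>"
    have "cos s \<noteq> 0" using bnd[OF s] cos_gt_zero_pi[of s] by auto
    then have "isCont (\<lambda>s. ?p (tan s)) s"
      by (intro isCont_o2[OF _ isCont_polyline] isCont_tan)
    then have "((\<lambda>s. ?p (tan s)) \<longlongrightarrow> h s) (at s)" using s by (simp add: isCont_def h_mid)
    moreover have "eventually (\<lambda>t. t \<in> {\<alpha><..<\<beta>}) (at s)"
      using s by (intro eventually_at_in_open') auto
    then have "eventually (\<lambda>s. ?p (tan s) = h s) (at s)"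
      by eventually_elim (simp add: h_mid)
    ultimately show "(h \<longlongrightarrow> h s) (at s)" by (simp add: tendsto_cong)
  qed
  have inj: "inj_on h {\<alpha>..\<beta>}"
  proof (rule linorder_inj_onI)
    fix s t assume st: "s < t" "s \<in> {\<alpha>..\<beta>}" "t \<in> {\<alpha>..\<beta>}"
    have mid: "\<alpha> < arctan (tan s)" "arctan (tan s) < \<beta>" if "\<alpha> < s" "s < \<beta>" for s
      using bnd[OF that] that by auto
    consider "s = \<alpha>" "t = \<beta>" | "s = \<alpha>" "\<alpha> < t" "t < \<beta>" | "\<alpha> < s" "s < \<beta>" "t = \<beta>" | "\<alpha> < s" "s < \<beta>" "\<alpha> < t" "t < \<beta>"
      using st by fastforce
    then show "h s \<noteq> h t"
    proof cases
      case 1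
      then show ?thesis using zz' \<alpha>\<beta> by (simp add: h_def)
    next
      case 2
      then show ?thesis using z_notin[OF mid[OF 2(2,3)]] by (auto simp: h_def)
    next
      case 3
      then show ?thesis using z'_notin[OF mid[OF 3(1,2)]] \<alpha>\<beta> by (auto simp: h_def)
    next
      case 4
      have "tan s < tan t" using st(1) bnd[OF 4(1,2)] bnd[OF 4(3,4)] by (intro tan_monotone) auto
      then show ?thesis
        using inj_lt[OF _ inE[OF mid[OF 4(1,2)]] inE[OF mid[OF 4(3,4)]]] 4 by (simp add: h_mid)
    qed
  qed auto
  have img: "h ` {\<alpha>..\<beta>} = A"
  proof
    show "h ` {\<alpha>..\<beta>} \<subseteq> A"
    proof (rule image_subsetI)
      fix s assume "s \<in> {\<alpha>..\<beta>}"
      then consider "s = \<alpha>" | "s = \<beta>" | "\<alpha> < s" "s < \<beta>" by fastforce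
      then show "h s \<in> A"
      proof cases
        case 3
        then have "\<lfloor>tan s\<rfloor> \<in> E" using bnd[OF 3] by (intro inE) auto
        then show ?thesis using 3 polyline_in_edge[of v "tan s"] by (auto simp: h_mid A edge_def)
      qed (use \<alpha>\<beta> in \<open>auto simp: h_def A\<close>)
    qed
    show "A \<subseteq> h ` {\<alpha>..\<beta>}"
    proof
      fix x assume "x \<in> A"
      then consider "x = z" | "x = z'" | i where "i \<in> E" "x \<in> edge i" by (auto simp: A)
      then show "x \<in> h ` {\<alpha>..\<beta>}"
      proof cases
        case 1
        then show ?thesis using \<alpha>\<beta> by (intro image_eqI[of _ _ \<alpha>]) (auto simp: h_def)
      next
        case 2
        then show ?thesis using \<alpha>\<beta> by (intro image_eqI[of _ _ \<beta>]) (auto simp: h_def)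
      next
        case (3 i)
        then have "x \<in> ?p ` {real_of_int i..real_of_int i + 1}"
          by (simp only: polyline_image_Icc edge_def)
        then obtain u where u: "x = ?p u" "real_of_int i \<le> u" "u \<le> real_of_int i + 1"
          by (elim imageE) auto
        have I: "i \<in> I" "i + 1 \<in> I" using 3(1) by (auto simp: E_def)
        have l: "\<alpha> < arctan u \<or> \<alpha> = arctan u \<and> x = z"
          using \<alpha>
        proof (elim disjE bexE conjE)
          fix a assume a: "I \<subseteq> {a..}" "v a = z" "\<alpha> = arctan (real_of_int a)"
          then have "real_of_int a \<le> u" using I u by auto
          then show ?thesis using a u(1) by (auto simp: arctan_less_iff le_less)
        qed (use ar in simp)
        have r: "arctan u < \<beta> \<or> \<beta> = arctan u \<and> x = z'"
          using \<beta>
        proof (elim disjE bexE conjE)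
          fix b assume b: "I \<subseteq> {..b}" "v b = z'" "\<beta> = arctan (real_of_int b)"
          then have "i + 1 \<le> b" using I by auto
          then have "u \<le> real_of_int b" using u by linarith
          then show ?thesis using b u(1) by (auto simp: arctan_less_iff le_less)
        next
          assume "\<beta> = pi / 2"
          then show ?thesis using ar(3)[of u] by (simp only: simp_thms)
        qed
        show ?thesis
        proof (rule image_eqI[of _ _ "arctan u"])
          show "arctan u \<in> {\<alpha>..\<beta>}" using l r by auto
          show "x = h (arctan u)" using l r u(1) ar \<alpha>\<beta> by (auto simp: h_def)
        qed
      qed
    qed
  qed
  define g where "g t = h (\<alpha> + t * (\<beta> - \<alpha>))" for t
  let ?m = "\<lambda>t. \<alpha> + t * (\<beta> - \<alpha>)"
  have m: "?m ` {0..1} = {\<alpha>..\<beta>}"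
  proof
    show "?m ` {0..1} \<subseteq> {\<alpha>..\<beta>}"
    proof (rule image_subsetI)
      fix t :: real assume "t \<in> {0..1}"
      then have "0 \<le> t * (\<beta> - \<alpha>)" "t * (\<beta> - \<alpha>) \<le> 1 * (\<beta> - \<alpha>)"
        using \<alpha>\<beta> by (auto intro!: mult_right_mono)
      then show "?m t \<in> {\<alpha>..\<beta>}" by simp
    qed
    show "{\<alpha>..\<beta>} \<subseteq> ?m ` {0..1}"
    proof
      fix s assume "s \<in> {\<alpha>..\<beta>}"
      then show "s \<in> ?m ` {0..1}"
        using \<alpha>\<beta> by (intro image_eqI[of _ _ "(s - \<alpha>) / (\<beta> - \<alpha>)"]) auto
    qed
  qed
  show thesis
  proof (rule that)
    have "continuous_on {0..1} (h \<circ> ?m)"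
      using cont m by (intro continuous_on_compose continuous_intros) simp
    moreover have "inj_on (h \<circ> ?m) {0..1}"
      using inj m \<alpha>\<beta> by (intro comp_inj_on) (auto simp: inj_on_def)
    ultimately show "arc g" by (simp add: arc_def path_def g_def[abs_def] o_def)
    have "g ` {0..1} = h ` ?m ` {0..1}" by (simp add: g_def[abs_def] image_image)
    then show "path_image g = A" unfolding path_image_def m img .
    show "g 0 = z" "g 1 = z'" using \<alpha>\<beta> by (auto simp: g_def h_def)
  qed
qed

section \<open>Doubly infinite geodesics\<close>

lemma subroute_commute: "subroute A p q = subroute A q p"
  unfolding subroute_def by (intro arg_cong[of _ _ Inter]) auto

lemma subroute_subset: "connected A \<Longrightarrow> p \<in> A \<Longrightarrow> q \<in> A \<Longrightarrow> subroute A p q \<subseteq> A"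
  unfolding subroute_def by (intro Inter_lower) auto

lemma connected_subroute:
  assumes "route z z' A" "p \<in> A" "q \<in> A"
  shows "connected (subroute A p q)" "p \<in> subroute A p q" "q \<in> subroute A p q"
    "subroute A p q \<subseteq> A" "bounded (subroute A p q)"
proof -
  obtain g where g: "arc g" "path_image g = A" using assms(1) by (rule route_arc)
  have A: "connected A" "bounded A"
    using g arc_imp_path connected_path_image bounded_path_image by blast+
  show sub: "subroute A p q \<subseteq> A" by (rule subroute_subset[OF A(1) assms(2,3)])
  show "bounded (subroute A p q)" using sub A(2) bounded_subset by blast
  show "p \<in> subroute A p q" "q \<in> subroute A p q" by (auto simp: subroute_def)
  obtain s t where st: "s \<in> {0..1}" "p = g s" "t \<in> {0..1}" "q = g t"
    using assms(2,3) g(2) by (auto simp: path_image_def)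
  have cont: "continuous_on {0..1} g" using g(1) by (simp add: arc_def path_def)
  have con: "connected (g ` {u..w})" if "0 \<le> u" "w \<le> 1" for u w
    using that by (intro connected_continuous_image continuous_on_subset[OF cont]) auto
  show "connected (subroute A p q)"
  proof (cases "s \<le> t")
    case True
    then show ?thesis using subroute_arc[OF g(1), of s t] st con[of s t] by (simp add: g(2))
  next
    case False
    then show ?thesis
      using subroute_arc[OF g(1), of t s] st con[of t s] by (simp add: g(2) subroute_commute[of A "g s"])
  qed
qed

text \<open>On an arc, a point between \<open>a\<close> and \<open>b\<close> is separated from each end of the arc by \<open>a\<close> or \<open>b\<close>.\<close>

lemma between_on_route:
  assumes r: "route z z' A" and ab: "a \<in> A" "b \<in> A" and x: "x \<in> subroute A a b" and e: "e = z \<or> e = z'"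
  shows "a \<in> subroute A e x \<or> b \<in> subroute A e x"
proof -
  obtain g where g: "arc g" "path_image g = A" "g 0 = z" "g 1 = z'" using r by (rule route_arc)
  have main: "g s \<in> subroute A e x \<or> g t \<in> subroute A e x"
    if st: "0 \<le> s" "s \<le> t" "t \<le> 1" and x: "x \<in> subroute A (g s) (g t)" for s t
  proof -
    obtain u where u: "x = g u" "s \<le> u" "u \<le> t"
      using x subroute_arc[OF g(1) st] by (auto simp: g(2))
    from e show ?thesis
    proof
      assume "e = z"
      then have "subroute A e x = g ` {0..u}"
        using subroute_arc[OF g(1), of 0 u] st u by (simp add: g)
      then show ?thesis using st u by auto
    next
      assume "e = z'"
      then have "subroute A e x = g ` {u..1}"
        using subroute_arc[OF g(1), of u 1] st u by (simp add: g subroute_commute[of A z'])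
      then show ?thesis using st u by auto
    qed
  qed
  obtain s t where st: "s \<in> {0..1}" "a = g s" "t \<in> {0..1}" "b = g t"
    using ab g(2) by (auto simp: path_image_def)
  show ?thesis
  proof (cases "s \<le> t")
    case True
    then show ?thesis using main[of s t] x st by auto
  next
    case False
    have "x \<in> subroute A (g t) (g s)" using x st by (simp add: subroute_commute[of A "g s"])
    then show ?thesis using main[of t s] False st by auto
  qed
qed

lemma route_endpoints: "route z z' A \<Longrightarrow> z \<in> A" "route z z' A \<Longrightarrow> z' \<in> A"
  by (auto simp: route_def Let_def)

lemma eventually_notin_bounded:
  fixes f :: "nat \<Rightarrow> complex"
  assumes f: "filterlim f at_infinity sequentially" and D: "bounded D"
  shows "eventually (\<lambda>k. f k \<notin> D) sequentially"
proof -
  obtain c where c: "0 < c" "\<forall>x\<in>D. norm x \<le> c" using D bounded_pos by blast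
  have "eventually (\<lambda>k. c + 1 \<le> norm (f k)) sequentially"
    using f c(1) filterlim_at_infinity[of 0 f sequentially] by auto
  then show ?thesis by eventually_elim (use c in force)
qed

text \<open>
  Every point of a doubly infinite geodesic lies on routes both of whose endpoints are far away.
  Otherwise, infinitely many of the segments come from routes with a common endpoint \<open>\<xi>\<close>. All these
  routes agree between \<open>\<xi>\<close> and \<open>x\<close> by compatibility, so one of the two ends of each segment, which
  go to infinity, lies in a fixed bounded set.
\<close>

lemma geodesic_far:
  assumes comp: "compatible_routes UNIV (\<lambda>i. fst (X i \<omega>)) (\<lambda>p. R p \<omega>)"
    and fin: "\<And>n. finite (window X (cball 0 (real n)) t \<omega>)"
    and p: "\<And>k. p k \<in> offdiag (arrived X t \<omega>)" and ab: "\<And>k. a k \<in> R (p k) \<omega>" "\<And>k. b k \<in> R (p k) \<omega>"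
    and inc: "incseq (\<lambda>k. subroute (R (p k) \<omega>) (a k) (b k))"
    and lim: "filterlim a at_infinity sequentially" "filterlim b at_infinity sequentially"
    and x: "x \<in> (\<Union>k. subroute (R (p k) \<omega>) (a k) (b k))"
  shows "x \<in> many_far 1 (arrived X t \<omega>) (\<lambda>i. fst (X i \<omega>)) (\<lambda>p. R p \<omega>) (real n)"
proof (rule ccontr)
  assume not_far: "\<not> ?thesis"
  let ?z = "\<lambda>i. fst (X i \<omega>)" and ?S = "\<lambda>k. subroute (R (p k) \<omega>) (a k) (b k)"
  have off: "p k \<in> offdiag UNIV" for k using p[of k] by (auto simp: offdiag_def)
  have route: "route (?z (fst (p k))) (?z (snd (p k))) (R (p k) \<omega>)" for k
    using comp off[of k] by (cases "p k") (auto simp: compatible_routes_def)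
  obtain k0 where "x \<in> ?S k0" using x by blast
  then have xS: "x \<in> ?S k" if "k0 \<le> k" for k using incseqD[OF inc that] by blast
  obtain N :: nat where N: "norm x + real n \<le> real N" using real_arch_simple by blast
  define F where "F = window X (cball 0 (real N)) t \<omega>"
  have "\<exists>e\<in>F. e = fst (p k) \<or> e = snd (p k)" if k: "k0 \<le> k" for k
  proof -
    obtain i j where pk: "p k = (i, j)" by (cases "p k")
    have "x \<in> R (p k) \<omega>" using xS[OF k] connected_subroute(4)[OF route ab] by blast
    then have near: "dist x (?z i) \<le> real n \<or> dist x (?z j) \<le> real n"
      using not_far p[of k] unfolding mem_many_far_1 pk by force
    have arr: "i \<in> arrived X t \<omega>" "j \<in> arrived X t \<omega>" using p[of k] by (auto simp: pk offdiag_def)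
    have "e \<in> F" if "dist x (?z e) \<le> real n" "e \<in> arrived X t \<omega>" for e
    proof -
      have "norm (?z e) \<le> norm x + dist x (?z e)"
        by (metis dist_0_norm dist_commute dist_triangle2 add.commute)
      then show ?thesis using that N by (auto simp: F_def window_def arrived_def)
    qed
    then show ?thesis using near arr by (auto simp: pk)
  qed
  then obtain e where e: "\<And>k. k0 \<le> k \<Longrightarrow> e k \<in> F \<and> (e k = fst (p k) \<or> e k = snd (p k))" by metis
  have "finite F" using fin by (simp add: F_def)
  then have "\<exists>\<xi>. infinite {k \<in> {k0..}. e k = \<xi>}"
    using pigeonhole_infinite[of "{k0..}" e] e finite_subset[of "e ` {k0..}" F] by (auto simp: infinite_Ici)
  then obtain \<xi> where \<xi>: "infinite {k. k0 \<le> k \<and> e k = \<xi>}" by auto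
  define K where "K = {k. k0 \<le> k \<and> e k = \<xi>}"
  have "K \<noteq> {}" using \<xi> by (metis K_def finite.emptyI)
  then obtain k1 where k1: "k1 \<in> K" by blast
  have mem: "?z \<xi> \<in> R (p k) \<omega>" "x \<in> R (p k) \<omega>" "?z \<xi> = ?z (fst (p k)) \<or> ?z \<xi> = ?z (snd (p k))" if "k \<in> K" for k
  proof -
    have k: "k0 \<le> k" "e k = \<xi>" using that by (auto simp: K_def)
    show end_k: "?z \<xi> = ?z (fst (p k)) \<or> ?z \<xi> = ?z (snd (p k))" using e[OF k(1)] k(2) by auto
    then show "?z \<xi> \<in> R (p k) \<omega>" using route_endpoints[OF route[of k]] by auto
    show "x \<in> R (p k) \<omega>" using xS[OF k(1)] connected_subroute(4)[OF route ab] by blast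
  qed
  define D where "D = insert x (subroute (R (p k1) \<omega>) (?z \<xi>) x)"
  have "bounded D" unfolding D_def using connected_subroute(5)[OF route mem(1,2)[OF k1]] by simp
  have "a k \<in> D \<or> b k \<in> D" if k: "k \<in> K" for k
  proof -
    have "subroute (R (p k) \<omega>) (?z \<xi>) x \<subseteq> D"
    proof (cases "?z \<xi> = x")
      case True
      then have "subroute (R (p k) \<omega>) (?z \<xi>) x \<subseteq> {x}"
        unfolding subroute_def using mem(2)[OF k] by (intro Inter_lower) auto
      then show ?thesis by (auto simp: D_def)
    next
      case False
      have "compatible (R (p k) \<omega>) (R (p k1) \<omega>)"
        using comp off[of k] off[of k1] unfolding compatible_routes_def by blast
      then have "subroute (R (p k) \<omega>) (?z \<xi>) x = subroute (R (p k1) \<omega>) (?z \<xi>) x"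
        using mem[OF k] mem[OF k1] False by (auto simp: compatible_def)
      then show ?thesis by (auto simp: D_def)
    qed
    moreover have "a k \<in> subroute (R (p k) \<omega>) (?z \<xi>) x \<or> b k \<in> subroute (R (p k) \<omega>) (?z \<xi>) x"
      using k by (intro between_on_route[OF route ab] mem(3) xS) (auto simp: K_def)
    ultimately show ?thesis by blast
  qed
  moreover have "eventually (\<lambda>k. a k \<notin> D \<and> b k \<notin> D) sequentially"
    using eventually_notin_bounded[OF lim(1) \<open>bounded D\<close>] eventually_notin_bounded[OF lim(2) \<open>bounded D\<close>]
    by eventually_elim simp
  then obtain m where "\<And>k. m \<le> k \<Longrightarrow> a k \<notin> D \<and> b k \<notin> D" by (auto simp: eventually_sequentially)
  ultimately have "K \<subseteq> {..<m}" by (metis lessThan_iff not_le subsetI)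
  then show False using \<xi> finite_subset unfolding K_def by blast
qed

context weak_SIRSN
begin

lemma far_edges_eq_plane_far: "far_edges X R t r \<omega> = plane_far 1 t r \<omega>"
  unfolding plane_far_def by (rule far_edges_eq_many_far)

lemma far_edges_intensity:
  assumes "0 < t"
  shows "has_edge_intensity M (far_edges X R t r) (ennreal (sqrt t) * intensity (sqrt t * r))"
  unfolding has_edge_intensity_def far_edges_eq_plane_far
  using plane_mean_scaled[OF assms] by (simp add: plane_mean_def)

lemma far_edges_intensity_tendsto:
  assumes "0 < t"
  shows "((\<lambda>r. ennreal (sqrt t) * intensity (sqrt t * r)) \<longlongrightarrow> 0) at_top"
proof -
  have "filterlim (\<lambda>r. sqrt t * r) at_top at_top"
    using assms by (intro filterlim_tendsto_pos_mult_at_top[OF tendsto_const] filterlim_ident) auto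
  then have "((\<lambda>r. intensity (sqrt t * r)) \<longlongrightarrow> 0) at_top"
    by (rule filterlim_compose[OF intensity_tendsto])
  then have "((\<lambda>r. ennreal (sqrt t) * intensity (sqrt t * r)) \<longlongrightarrow> ennreal (sqrt t) * 0) at_top"
    by (intro ennreal_tendsto_cmult) auto
  then show ?thesis by simp
qed

text \<open>
  Almost surely, the points covered by routes with arbitrarily distant endpoints form a set of length \<open>0\<close>.
\<close>

lemma AE_len_all_far_eq_0:
  assumes t: "0 < t"
  shows "AE \<omega> in M. \<forall>N. len ((\<Inter>n. plane_far 1 t (real n) \<omega>) \<inter> cball 0 (real N)) = 0"
  unfolding AE_all_countable
proof
  fix N :: nat
  let ?A = "cball (0::complex) (real N)"
  have "\<forall>n. \<exists>H. H \<in> borel_measurable M \<and> (AE \<omega> in M. len (plane_far 1 t (real n) \<omega> \<inter> ?A) = H \<omega>) \<and>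
      (\<integral>\<^sup>+\<omega>. H \<omega> \<partial>M) = plane_mean 1 t (real n) ?A"
  proof
    fix n :: nat
    show "\<exists>H. H \<in> borel_measurable M \<and> (AE \<omega> in M. len (plane_far 1 t (real n) \<omega> \<inter> ?A) = H \<omega>) \<and>
      (\<integral>\<^sup>+\<omega>. H \<omega> \<partial>M) = plane_mean 1 t (real n) ?A"
      by (rule plane_far_measurable[of t ?A 1 "real n"]) (use t in auto)
  qed
  from choice[OF this] obtain H where
    "\<forall>n. H n \<in> borel_measurable M \<and> (AE \<omega> in M. len (plane_far 1 t (real n) \<omega> \<inter> ?A) = H n \<omega>) \<and>
      (\<integral>\<^sup>+\<omega>. H n \<omega> \<partial>M) = plane_mean 1 t (real n) ?A" ..
  then have H: "\<And>n. H n \<in> borel_measurable M" "\<And>n. AE \<omega> in M. len (plane_far 1 t (real n) \<omega> \<inter> ?A) = H n \<omega>"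
    "\<And>n. (\<integral>\<^sup>+\<omega>. H n \<omega> \<partial>M) = plane_mean 1 t (real n) ?A" by (simp_all only:)
  have "(\<lambda>n. ennreal (sqrt t) * intensity (sqrt t * real n)) \<longlonglongrightarrow> 0"
    by (rule filterlim_compose[OF far_edges_intensity_tendsto[OF t] filterlim_real_sequentially])
  then have "(\<lambda>n. emeasure lborel ?A * (ennreal (sqrt t) * intensity (sqrt t * real n))) \<longlonglongrightarrow> emeasure lborel ?A * 0"
    using cball_exhaustion(2)[of N] by (intro ennreal_tendsto_cmult) simp
  moreover have "plane_mean 1 t (real n) ?A = emeasure lborel ?A * (ennreal (sqrt t) * intensity (sqrt t * real n))" for n
    using plane_mean_scaled[OF t, of ?A "real n"] by (simp add: mult_ac)
  ultimately have lim: "(\<lambda>n. \<integral>\<^sup>+\<omega>. H n \<omega> \<partial>M) \<longlonglongrightarrow> 0" unfolding H(3) by simp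
  have "(\<integral>\<^sup>+\<omega>. (INF n. H n \<omega>) \<partial>M) \<le> 0"
    by (rule LIMSEQ_le_const[OF lim]) (auto intro!: exI[of _ 0] nn_integral_mono INF_lower)
  then have "AE \<omega> in M. (INF n. H n \<omega>) = 0"
    using H(1) by (subst (asm) le_zero_eq, subst (asm) nn_integral_0_iff_AE) auto
  moreover have "AE \<omega> in M. \<forall>n. len (plane_far 1 t (real n) \<omega> \<inter> ?A) = H n \<omega>"
    using H(2) by (simp add: AE_all_countable)
  ultimately show "AE \<omega> in M. len ((\<Inter>n. plane_far 1 t (real n) \<omega>) \<inter> ?A) = 0"
  proof eventually_elim
    case (elim \<omega>)
    have "len ((\<Inter>n. plane_far 1 t (real n) \<omega>) \<inter> ?A) \<le> (INF n. H n \<omega>)"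
      using elim(2) by (intro INF_greatest) (metis (no_types, lifting) INF_lower Int_mono UNIV_I len_mono order_refl)
    then show ?case using elim(1) by simp
  qed
qed

lemma AE_no_doubly_infinite_geodesic:
  assumes t: "0 < t"
  shows "AE \<omega> in M. \<not> (\<exists>\<pi>. doubly_infinite_geodesic X R t \<omega> \<pi>)"
proof -
  have "AE \<omega> in M. \<forall>n. finite (window X (cball 0 (real n)) t \<omega>)"
    unfolding AE_all_countable by (intro allI window_finite[OF poisson cball_exhaustion(1,2)])
  then show ?thesis
    using sampled_compatible AE_len_all_far_eq_0[OF t]
  proof eventually_elim
    case (elim \<omega>)
    show ?case
    proof
      assume "\<exists>\<pi>. doubly_infinite_geodesic X R t \<omega> \<pi>"
      then obtain p a b where p: "\<forall>k. p k \<in> offdiag (arrived X t \<omega>) \<and> a k \<in> R (p k) \<omega> \<and> b k \<in> R (p k) \<omega>"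
        and inc: "incseq (\<lambda>k. subroute (R (p k) \<omega>) (a k) (b k))"
        and lim: "filterlim a at_infinity sequentially" "filterlim b at_infinity sequentially"
        unfolding doubly_infinite_geodesic_def by blast
      let ?S = "\<lambda>k. subroute (R (p k) \<omega>) (a k) (b k)"
      let ?far = "\<Inter>n. plane_far 1 t (real n) \<omega>"
      have far: "?S k \<subseteq> ?far" for k
      proof
        fix x assume "x \<in> ?S k"
        then have "x \<in> (\<Union>k. ?S k)" by blast
        then show "x \<in> ?far"
          unfolding plane_far_def using p inc lim elim(1,2)
          by (intro INT_I geodesic_far[where p=p and a=a and b=b]) auto
      qed
      have route: "\<exists>z z'. route z z' (R (p k) \<omega>)" for k
      proof -
        obtain i j where ij: "p k = (i, j)" by (cases "p k")
        moreover have "p k \<in> offdiag (arrived X t \<omega>)" using p by blast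
        ultimately have "(i, j) \<in> offdiag UNIV" by (auto simp: offdiag_def)
        then have "route (fst (X i \<omega>)) (fst (X j \<omega>)) (R (i, j) \<omega>)"
          using elim(2) by (auto simp: compatible_routes_def)
        then show ?thesis unfolding ij by blast
      qed
      note S = connected_subroute[OF _ p[rule_format, THEN conjunct2, THEN conjunct1] p[rule_format, THEN conjunct2, THEN conjunct2]]
      have "eventually (\<lambda>k. a k \<notin> {a 0}) sequentially"
        using lim(1) by (rule eventually_notin_bounded) simp
      then obtain k where k: "a k \<noteq> a 0" by (auto simp: eventually_sequentially)
      obtain z z' where "route z z' (R (p k) \<omega>)" using route by blast
      \<comment> \<open>The geodesic contains a connected set with two distinct points, hence of positive length.\<close>
      note Sk = S[OF this]
      obtain z0 z0' where "route z0 z0' (R (p 0) \<omega>)" using route by blast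
      then have "a 0 \<in> ?S k" using S(2) incseqD[OF inc, of 0 k] by blast
      then have "ennreal (dist (a k) (a 0)) \<le> len (?S k)"
        using Sk by (intro dist_le_len_connected)
      moreover obtain c where c: "\<forall>x\<in>?S k. norm x \<le> c" using Sk(5) bounded_iff by blast
      obtain N :: nat where "c \<le> real N" using real_arch_simple by blast
      then have "?S k \<subseteq> cball 0 (real N)" using c by fastforce
      then have "len (?S k) \<le> len (?far \<inter> cball 0 (real N))" using far by (intro len_mono) blast
      ultimately have "ennreal (dist (a k) (a 0)) \<le> 0" using elim(3) by simp
      then show False using k by simp
    qed
  qed
qed

end

theorem proposition14:
  fixes \<mu> :: "complex list \<Rightarrow> (nat \<times> nat \<Rightarrow> complex set) measure"
    and M :: "'w measure"
    and X :: "nat \<Rightarrow> 'w \<Rightarrow> complex \<times> real"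
    and R :: "nat \<times> nat \<Rightarrow> 'w \<Rightarrow> complex set"
    and lam :: real
  assumes "weak_SIRSN \<mu> M X R"
    and "0 < lam"
  shows "(\<exists>p :: real \<Rightarrow> ennreal.
            (\<forall>r>0. has_edge_intensity M (far_edges X R lam r) (p r)) \<and> (p \<longlongrightarrow> 0) at_top) \<and>
         (AE \<omega> in M. \<not> (\<exists>\<pi>. doubly_infinite_geodesic X R lam \<omega> \<pi>))"
proof
  interpret weak_SIRSN \<mu> M X R by (rule assms(1))
  show "\<exists>p. (\<forall>r>0. has_edge_intensity M (far_edges X R lam r) (p r)) \<and> (p \<longlongrightarrow> 0) at_top"
    by (rule exI[of _ "\<lambda>r. ennreal (sqrt lam) * intensity (sqrt lam * r)"])
      (use far_edges_intensity[OF assms(2)] far_edges_intensity_tendsto[OF assms(2)] in simp)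
  show "AE \<omega> in M. \<not> (\<exists>\<pi>. doubly_infinite_geodesic X R lam \<omega> \<pi>)"
    using assms(2) by (rule AE_no_doubly_infinite_geodesic)
qed

end
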